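(* Consider the $3$-state Potts broadcast process on a Galton–Watson tree with offspring distribution $\mathbf{d}$, with parameter $\lambda$. Then non-reconstruction holds in each of the following cases: 1. $\mathbf{d}=2$ with probability 1 and $0<\lambda\le0.69$; 2. $\mathbf{d}=3$ with probability 1 and $0<\lambda\le0.555$; 3. $\mathbf{d}=2$ with probability $1/2$ and $\mathbf{d}=3$ with probability $1/2$, and $0<\lambda\le0.61$; 4. $\mathbf{d}=3$ with probability 1 and $\lambda=-\frac12$ (proper $3$-colorings of the ternary tree).
   Context: Potts channel with $q=3$: on $D=\{1,2,3\}$, $M_{i,j}=1-p$ if $i=j$ and $M_{i,j}=p/2$ otherwise, where $p\in[0,1]$ and $\lambda=1-\frac{3p}{2}$. Let $T$ be a random rooted tree in which the number of children of every vertex is an independent copy of $\mathbf{d}$. Given $T$, the root $\rho$ gets a uniformly random color, and for each vertex $v$ with parent $u$, $\sigma_v$ is drawn from the row $M_{\sigma_u,\cdot}$, independently over edges. $L^a(n)$ denotes the distribution of the configuration on the vertices at distance $n$ from the root conditioned on $\sigma_\rho=a$. Non-reconstruction holds if for every $a,b\in D$, $\lim_{n\to\infty}\mathbb{E}_T[d_{TV}(L^a(n),L^b(n))]=0$, where $d_{TV}(\mu,\nu)=\frac12\sum_\sigma|\mu(\sigma)-\nu(\sigma)|$ and $\mathbb{E}_T$ is over the random tree. *)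

theory Defs
  imports "HOL-Probability.Probability" "HOL-Probability.Product_PMF"
begin

text \<open>
  A rooted tree is encoded in Ulam--Harris style by its family of offspring numbers: the root is
  \<^term>\<open>[]\<close>, and the children of a vertex \<open>v\<close> are \<open>v @ [0], \<dots>, v @ [t v - 1]\<close>. The parent of
  \<open>v \<noteq> []\<close> is \<open>butlast v\<close>. Values of \<open>t\<close> at words that are not vertices are irrelevant.
\<close>

type_synonym rtree = "nat list \<Rightarrow> nat"

primrec generation :: "rtree \<Rightarrow> nat \<Rightarrow> nat list set" where
  "generation t 0 = {[]}"
| "generation t (Suc n) = {v @ [i] | v i. v \<in> generation t n \<and> i < t v}"

definition gw_tree :: "nat pmf \<Rightarrow> rtree measure" where
  "gw_tree d = (\<Pi>\<^sub>M v\<in>UNIV. measure_pmf d)"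

definition colors :: "nat set" where
  "colors = {1, 2, 3}"

definition potts_M :: "real \<Rightarrow> nat \<Rightarrow> nat \<Rightarrow> real" where
  "potts_M p i j = (if i = j then 1 - p else p / 2)"

text \<open>The row of \<open>i\<close> as a distribution; meaningful for \<open>0 \<le> p \<le> 1\<close> and \<open>i \<in> colors\<close>, see
  \<open>pmf_potts_row\<close>.\<close>

definition potts_row :: "real \<Rightarrow> nat \<Rightarrow> nat pmf" where
  "potts_row p i = embed_pmf (\<lambda>j. if j \<in> colors then potts_M p i j else 0)"

lemma pmf_potts_row:
  assumes "0 \<le> p" "p \<le> 1" "i \<in> colors"
  shows "pmf (potts_row p i) j = (if j \<in> colors then potts_M p i j else 0)"
  unfolding potts_row_def
proof (rule pmf_embed_pmf)
  show "0 \<le> (if x \<in> colors then potts_M p i x else 0)" for x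
    using assms by (auto simp: potts_M_def)
  have "(\<integral>\<^sup>+ x. ennreal (if x \<in> colors then potts_M p i x else 0) \<partial>count_space UNIV)
      = (\<Sum>x\<in>colors. ennreal (potts_M p i x))"
    by (subst nn_integral_count_space'[where A = colors]) (auto simp: colors_def)
  also have "\<dots> = ennreal (\<Sum>x\<in>colors. potts_M p i x)"
    using assms by (intro sum_ennreal) (auto simp: potts_M_def)
  also have "(\<Sum>x\<in>colors. potts_M p i x) = 1"
    using assms(3) by (auto simp: colors_def potts_M_def)
  finally show "(\<integral>\<^sup>+ x. ennreal (if x \<in> colors then potts_M p i x else 0) \<partial>count_space UNIV) = 1"
    by simp
qed

text \<open>Joint law of the colors of all vertices up to depth \<open>n\<close>, with a uniform root color;
  the configuration is \<^term>\<open>undefined\<close> at all other words.\<close>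

primrec broadcast :: "real \<Rightarrow> rtree \<Rightarrow> nat \<Rightarrow> (nat list \<Rightarrow> nat) pmf" where
  "broadcast p t 0 = map_pmf (\<lambda>c. (\<lambda>_. undefined)([] := c)) (pmf_of_set colors)"
| "broadcast p t (Suc n) = bind_pmf (broadcast p t n) (\<lambda>\<sigma>.
     map_pmf (\<lambda>\<tau>. override_on \<sigma> \<tau> (generation t (Suc n)))
       (Pi_pmf (generation t (Suc n)) undefined (\<lambda>v. potts_row p (\<sigma> (butlast v)))))"

definition level_law :: "real \<Rightarrow> rtree \<Rightarrow> nat \<Rightarrow> nat \<Rightarrow> (nat list \<Rightarrow> nat) pmf" where
  "level_law p t a n =
     map_pmf (\<lambda>\<sigma>. restrict \<sigma> (generation t n)) (cond_pmf (broadcast p t n) {\<sigma>. \<sigma> [] = a})"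

definition d_TV :: "'a pmf \<Rightarrow> 'a pmf \<Rightarrow> real" where
  "d_TV \<mu> \<nu> = 1 / 2 * (\<Sum>\<^sub>\<infinity>\<sigma>. \<bar>pmf \<mu> \<sigma> - pmf \<nu> \<sigma>\<bar>)"

definition non_reconstruction :: "nat pmf \<Rightarrow> real \<Rightarrow> bool" where
  "non_reconstruction d p \<longleftrightarrow>
     (\<forall>a\<in>colors. \<forall>b\<in>colors.
        (\<lambda>n. \<integral>t. d_TV (level_law p t a n) (level_law p t b n) \<partial>gw_tree d) \<longlonglongrightarrow> 0)"

lemma finite_generation: "finite (generation t n)"
proof (induction n)
  case (Suc n)
  have "generation t (Suc n) = (\<Union>v\<in>generation t n. (\<lambda>i. v @ [i]) ` {..<t v})"
    by auto
  with Suc show ?case by simp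
qed simp

lemma map_broadcast_root: "map_pmf (\<lambda>\<sigma>. \<sigma> []) (broadcast p t n) = pmf_of_set colors"
proof (induction n)
  case 0
  show ?case by (simp add: map_pmf_comp)
next
  case (Suc n)
  have "map_pmf (\<lambda>\<sigma>. \<sigma> []) (broadcast p t (Suc n)) = bind_pmf (broadcast p t n) (\<lambda>\<sigma>. return_pmf (\<sigma> []))"
    by (simp add: map_bind_pmf map_pmf_comp override_on_def)
  with Suc show ?case by (simp add: map_pmf_def)
qed

text \<open>The event on which \<open>level_law\<close> conditions has positive probability.\<close>

lemma root_color_possible:
  assumes "a \<in> colors"
  shows "set_pmf (broadcast p t n) \<inter> {\<sigma>. \<sigma> [] = a} \<noteq> {}"
proof -
  have "(\<lambda>\<sigma>. \<sigma> []) ` set_pmf (broadcast p t n) = colors"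
    using arg_cong[OF map_broadcast_root[of p t n], of set_pmf] by (simp add: colors_def)
  with assms obtain \<sigma> where "\<sigma> \<in> set_pmf (broadcast p t n)" "a = \<sigma> []" by blast
  then show ?thesis by blast
qed

text \<open>The integrand in \<open>non_reconstruction\<close> is measurable and bounded, so the Bochner integral
  is the genuine expectation.\<close>

lemma broadcast_cong_generation:
  assumes "\<And>k. k \<le> n \<Longrightarrow> generation t k = generation t' k"
  shows "broadcast p t n = broadcast p t' n"
  using assms
proof (induction n)
  case (Suc n)
  have "broadcast p t n = broadcast p t' n"
    using Suc by simp
  moreover have "generation t (Suc n) = generation t' (Suc n)"
    by (rule Suc.prems) simp
  ultimately show ?case by (simp del: generation.simps)
qed simp

lemma generation_pred_measurable:
  "Measurable.pred (gw_tree d) (\<lambda>t. v \<in> generation t n)"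
proof (induction n arbitrary: v)
  case (Suc n)
  have sp: "(\<lambda>t. t u) \<in> measurable (gw_tree d) (count_space UNIV)" for u :: "nat list"
  proof -
    have "(\<lambda>t. t u) \<in> measurable (gw_tree d) (measure_pmf d)"
      unfolding gw_tree_def by (rule measurable_component_singleton) simp
    then show ?thesis by (simp cong: measurable_cong_sets)
  qed
  have *: "v \<in> generation t (Suc n) \<longleftrightarrow> v \<noteq> [] \<and> butlast v \<in> generation t n \<and> last v < t (butlast v)"
    for t
    by (cases v rule: rev_cases) auto
  have "Measurable.pred (gw_tree d) (\<lambda>t. last v < t (butlast v))"
    using measurable_compose[OF sp[of "butlast v"], of "\<lambda>k. last v < k"] by simp
  with Suc[of "butlast v"] show ?case unfolding * by simp
qed simp

lemma generation_measurable:
  "(\<lambda>t. \<lambda>k\<in>{..n}. generation t k) \<in> 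
     measurable (gw_tree d) (count_space ({..n} \<rightarrow>\<^sub>E Collect finite))"
proof (rule measurable_count_space_eq_countable[THEN iffD2])
  show "countable ({..n} \<rightarrow>\<^sub>E (Collect finite :: nat list set set))"
    by (intro countable_PiE) (auto intro: countable_Collect_finite)
  show "(\<lambda>t. \<lambda>k\<in>{..n}. generation t k) \<in> space (gw_tree d) \<rightarrow> ({..n} \<rightarrow>\<^sub>E Collect finite) \<and>
    (\<forall>G\<in>({..n} \<rightarrow>\<^sub>E Collect finite).
       (\<lambda>t. \<lambda>k\<in>{..n}. generation t k) -` {G} \<inter> space (gw_tree d) \<in> sets (gw_tree d))"
  proof (intro conjI ballI)
    show "(\<lambda>t. \<lambda>k\<in>{..n}. generation t k) \<in> space (gw_tree d) \<rightarrow> ({..n} \<rightarrow>\<^sub>E Collect finite)"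
      by (auto simp: finite_generation)
    fix G :: "nat \<Rightarrow> nat list set" assume G: "G \<in> {..n} \<rightarrow>\<^sub>E Collect finite"
    have eq: "(\<lambda>t. \<lambda>k\<in>{..n}. generation t k) -` {G} \<inter> space (gw_tree d)
      = {t \<in> space (gw_tree d). \<forall>k\<in>{..n}. \<forall>v. v \<in> generation t k \<longleftrightarrow> v \<in> G k}"
    proof (intro set_eqI)
      fix t
      have "((\<lambda>k\<in>{..n}. generation t k) = G) \<longleftrightarrow> (\<forall>k\<in>{..n}. generation t k = G k)"
        using G by (auto simp: PiE_def extensional_def restrict_def fun_eq_iff)
      then show "t \<in> (\<lambda>t. \<lambda>k\<in>{..n}. generation t k) -` {G} \<inter> space (gw_tree d) \<longleftrightarrow>
        t \<in> {t \<in> space (gw_tree d). \<forall>k\<in>{..n}. \<forall>v. v \<in> generation t k \<longleftrightarrow> v \<in> G k}"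
        by (simp add: set_eq_iff) blast
    qed
    have "Measurable.pred (gw_tree d) (\<lambda>t. v \<in> generation t k \<longleftrightarrow> v \<in> G k)" for v k
      using generation_pred_measurable[where v = v and n = k and d = d] by (cases "v \<in> G k") (simp_all add: pred_intros_logic)
    then have "Measurable.pred (gw_tree d) (\<lambda>t. \<forall>k\<in>{..n}. \<forall>v. v \<in> generation t k \<longleftrightarrow> v \<in> G k)"
      by (intro pred_intros_finite pred_intros_countable) auto
    then show "(\<lambda>t. \<lambda>k\<in>{..n}. generation t k) -` {G} \<inter> space (gw_tree d) \<in> sets (gw_tree d)"
      unfolding eq by (rule predE)
  qed
qed

lemma d_TV_level_law_measurable:
  "(\<lambda>t. d_TV (level_law p t a n) (level_law p t b n)) \<in> borel_measurable (gw_tree d)"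
proof -
  define g :: "rtree \<Rightarrow> nat \<Rightarrow> nat list set" where "g t = (\<lambda>k\<in>{..n}. generation t k)" for t
  define F where "F t = d_TV (level_law p t a n) (level_law p t b n)" for t
  define h where "h G = F (SOME t. g t = G)" for G
  have "F t = h (g t)" for t
  proof -
    define s where "s = (SOME s. g s = g t)"
    have "g s = g t"
      unfolding s_def by (rule someI[of "\<lambda>s. g s = g t" t]) simp
    from fun_cong[OF this] have e: "generation s k = generation t k" if "k \<le> n" for k
      using that unfolding g_def by (metis atMost_iff restrict_apply')
    then have "broadcast p s n = broadcast p t n"
      by (rule broadcast_cong_generation)
    with e[of n] show ?thesis by (simp add: h_def F_def level_law_def flip: s_def)
  qed
  moreover have "(\<lambda>t. h (g t)) \<in> borel_measurable (gw_tree d)"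
    unfolding g_def by (rule measurable_compose[OF generation_measurable]) simp
  ultimately show ?thesis unfolding F_def by simp
qed

lemma d_TV_bounds: "0 \<le> d_TV \<mu> \<nu>" "d_TV \<mu> \<nu> \<le> 1"
proof -
  show "0 \<le> d_TV \<mu> \<nu>" unfolding d_TV_def by (simp add: infsum_nonneg)
  have s: "pmf \<xi> summable_on UNIV" "infsum (pmf \<xi>) UNIV = 1" for \<xi> :: "'a pmf"
    using pmf_abs_summable[of \<xi> UNIV] infsetsum_pmf_eq_1[of \<xi> UNIV] infsetsum_infsum[of "pmf \<xi>" UNIV]
    by (auto simp: abs_summable_equivalent[symmetric] dest: abs_summable_summable)
  have a: "(\<lambda>\<sigma>. pmf \<mu> \<sigma> + pmf \<nu> \<sigma>) summable_on UNIV"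
    by (intro summable_on_add s)
  have "(\<Sum>\<^sub>\<infinity>\<sigma>. \<bar>pmf \<mu> \<sigma> - pmf \<nu> \<sigma>\<bar>) \<le> (\<Sum>\<^sub>\<infinity>\<sigma>. pmf \<mu> \<sigma> + pmf \<nu> \<sigma>)"
  proof (rule infsum_mono)
    show le: "\<bar>pmf \<mu> \<sigma> - pmf \<nu> \<sigma>\<bar> \<le> pmf \<mu> \<sigma> + pmf \<nu> \<sigma>" for \<sigma>
      using pmf_nonneg[of \<mu> \<sigma>] pmf_nonneg[of \<nu> \<sigma>] by linarith
    show "(\<lambda>\<sigma>. \<bar>pmf \<mu> \<sigma> - pmf \<nu> \<sigma>\<bar>) summable_on UNIV"
      by (rule summable_on_comparison_test[OF a le]) simp
  qed (rule a)
  also have "\<dots> = 2"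
    using infsum_add[OF s(1) s(1), of \<mu> \<nu>] s(2)[of \<mu>] s(2)[of \<nu>] by simp
  finally show "d_TV \<mu> \<nu> \<le> 1" by (simp add: d_TV_def)
qed

end

theory Submission
  imports Defs
begin

text \<open>
  \<^item> For \<open>\<lambda> > 0\<close> (Formentin and Kuelske): the symmetrized Kullback--Leibler divergence between the laws
  of the leaves given two root colors is additive over the subtrees of the children. Passing through
  one edge contracts its sum over the pairs of colors: with \<open>x\<close> the relative deviation of the posterior
  from the uniform law (so \<open>\<Sum>x = 0\<close>, \<open>x \<ge> -1\<close>), the claim is
  \<open>\<Sum> \<lambda> x ln (1 + \<lambda> x) \<le> c \<Sum> x ln (1 + x)\<close>. Differentiating along \<open>t \<mapsto> t x\<close> leaves a rational
  inequality in the elementary symmetric functions of \<open>x\<close>. If \<open>c\<close> times the mean offspring number is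
  below \<open>1\<close>, the divergence decays exponentially.

  \<^item> For proper colorings the divergence is infinite, and the chi-square information is used instead. An
  edge multiplies it by exactly \<open>\<lambda>\<^sup>2 = 1/4\<close>, but it is not subadditive when the messages of the children
  are combined. Averaging over permutations of the colors bounds the excess, and for three children
  the total factor per generation stays below \<open>1\<close>.
\<close>

section \<open>The contraction inequality for \<open>\<lambda> > 0\<close>\<close>

text \<open>The room for colorings is small. If every child carries information at most
  \<open>4*y\<close>, each edge leaves \<open>y\<close>, and the combination of three children has
  to stay below \<open>4*y\<close>. A bound valid for every accumulated message costs
  \<open>19/10\<close> per added child; used twice it gives 1 + 1.9 + 1.9 = 4.8 in the linear term.
  But a message that has just crossed one coloring edge gives no color more than half of the mass,
  and adding a child to such a message costs only \<open>21/20\<close>. A product of two messages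
  loses this property, so the third child again costs \<open>19/10\<close>: 1 + 1.05 + 1.9 = 3.95.
  The price of the sharper bound is a term \<open>y^2\<close>, harmful because \<open>y\<close>
  starts at \<open>1/2\<close>; the coefficient \<open>-2/5\<close> in the general bound offsets
  enough of it.

  For \<lambda> > 0 the inequality is verified at the largest \<lambda> only. All estimates hold
  tree by tree; randomness of the tree enters through the mean generation size alone.\<close>

lemma nonneg_of_mult_nonneg:
  fixes a b :: real
  shows "0 < a \<Longrightarrow> 0 \<le> a * b \<Longrightarrow> 0 \<le> b"
  by (simp add: zero_le_mult_iff)

text \<open>The numbers are the roots of \<open>T^3 - P*T - M\<close> with
  \<open>P = (x^2+y^2+z^2)/2\<close> and \<open>M = x*y*z\<close>; the discriminant
  \<open>4*P^3 - 27*M^2\<close> is the square of the product of the root differences.\<close>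

lemma zero_sum_cubic_bound:
  fixes x y z :: real
  assumes "x + y + z = 0"
  shows "27 * (x*y*z)^2 \<le> 4 * ((x^2+y^2+z^2)/2)^3"
proof -
  have z: "z = - x - y" using assms by simp
  have "4 * ((x^2+y^2+z^2)/2)^3 - 27 * (x*y*z)^2 = ((x-y)*(y-z)*(z-x))^2"
    unfolding z by (simp add: field_simps power2_eq_square power3_eq_cube)
  then show ?thesis by (smt (verit) zero_le_power2)
qed

text \<open>\<open>1 - P + M\<close> and \<open>3 - P\<close> are the third and the second
  elementary symmetric functions of the positive numbers \<open>1+x\<close>, \<open>1+y\<close>,
  \<open>1+z\<close>.\<close>

lemma zero_sum_quotient_sum:
  fixes x y z :: real
  assumes "x + y + z = 0" "1 + x > 0" "1 + y > 0" "1 + z > 0"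
  defines "P \<equiv> (x^2+y^2+z^2)/2" and "M \<equiv> x*y*z"
  shows "x^2/(1+x) + y^2/(1+y) + z^2/(1+z) = (2*P - 3*M) / (1 - P + M)"
    and "1 - P + M > 0" and "P \<le> 3"
proof -
  have z: "z = - x - y" using assms by simp
  have e: "1 - P + M = (1+x)*(1+y)*(1+z)"
    unfolding P_def M_def z by (simp add: field_simps power2_eq_square)
  then show "1 - P + M > 0" using assms by simp
  have "3 - P = (1+x)*(1+y) + (1+y)*(1+z) + (1+x)*(1+z)"
    unfolding P_def z by (simp add: field_simps power2_eq_square)
  also have "\<dots> > 0" using assms by (simp add: add_pos_pos)
  finally show "P \<le> 3" by simp
  have "x^2/(1+x) + y^2/(1+y) + z^2/(1+z)
      = (x^2*((1+y)*(1+z)) + y^2*((1+x)*(1+z)) + z^2*((1+x)*(1+y))) / ((1+x)*(1+y)*(1+z))"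
    using assms(2-4) by (simp add: add_divide_distrib)
  also have "x^2*((1+y)*(1+z)) + y^2*((1+x)*(1+z)) + z^2*((1+x)*(1+y)) = 2*P - 3*M"
    unfolding P_def M_def z by (simp add: field_simps power2_eq_square)
  finally show "x^2/(1+x) + y^2/(1+y) + z^2/(1+z) = (2*P - 3*M) / (1 - P + M)"
    using e by simp
qed

text \<open>Scaling by \<open>l\<close> turns \<open>(P, M)\<close> into
  \<open>(l^2*P, l^3*M)\<close>, so both sides are rational functions of the same pair;
  \<open>poly\<close> is the inequality after cross-multiplication.\<close>

lemma quotient_sum_contraction:
  fixes x y z c l :: real
  assumes s: "x + y + z = 0" "1 + x > 0" "1 + y > 0" "1 + z > 0"
    and l: "0 < l" "l < 1"
    and poly: "\<And>P M. 0 \<le> P \<Longrightarrow> P \<le> 3 \<Longrightarrow> 27 * M^2 \<le> 4 * P^3 \<Longrightarrow>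
      l^2 * (2*P - 3*l*M) * (1 - P + M) \<le> c * (2*P - 3*M) * (1 - l^2*P + l^3*M)"
  shows "l^2 * (x^2/(1+l*x) + y^2/(1+l*y) + z^2/(1+l*z)) \<le> c * (x^2/(1+x) + y^2/(1+y) + z^2/(1+z))"
proof -
  define P where "P = (x^2+y^2+z^2)/2"
  define M where "M = x*y*z"
  have pos: "1 + l*u > 0" if "1 + u > 0" for u
  proof -
    have "1 + l*u = (1-l) + l*(1+u)" by (simp add: algebra_simps)
    also have "\<dots> > 0" using that l by (simp add: add_pos_pos)
    finally show ?thesis .
  qed
  have s': "l*x + l*y + l*z = 0" using s(1) by (simp flip: distrib_left)
  have Pl: "((l*x)^2+(l*y)^2+(l*z)^2)/2 = l^2*P" and Ml: "(l*x)*(l*y)*(l*z) = l^3*M"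
    unfolding P_def M_def by (simp_all add: field_simps power2_eq_square power3_eq_cube)
  note q = zero_sum_quotient_sum[OF s, folded P_def M_def]
  note ql = zero_sum_quotient_sum[OF s' pos[OF s(2)] pos[OF s(3)] pos[OF s(4)], unfolded Pl Ml]
  have "l^2 * (x^2/(1+l*x) + y^2/(1+l*y) + z^2/(1+l*z)) = (l*x)^2/(1+l*x) + (l*y)^2/(1+l*y) + (l*z)^2/(1+l*z)"
    by (simp add: power_mult_distrib distrib_left)
  also have "\<dots> = l^2 * (2*P - 3*l*M) / (1 - l^2*P + l^3*M)"
    unfolding ql(1) by (simp add: algebra_simps power2_eq_square power3_eq_cube)
  also have "\<dots> \<le> c * (2*P - 3*M) / (1 - P + M)"
  proof -
    have "0 \<le> P" by (simp add: P_def)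
    then have "l^2 * (2*P - 3*l*M) * (1 - P + M) \<le> c * (2*P - 3*M) * (1 - l^2*P + l^3*M)"
      using zero_sum_cubic_bound[OF s(1)] q(3) by (intro poly) (simp_all add: P_def M_def)
    then show ?thesis using q(2) ql(2) by (simp add: divide_le_eq pos_le_divide_eq mult.commute)
  qed
  finally show ?thesis unfolding q(1) by simp
qed

lemma log_sum_contraction:
  fixes x y z c l :: real
  assumes s: "x + y + z = 0" "1 + x > 0" "1 + y > 0" "1 + z > 0"
    and l: "0 < l" "l < 1" "l^2 \<le> c"
    and poly: "\<And>P M. 0 \<le> P \<Longrightarrow> P \<le> 3 \<Longrightarrow> 27 * M^2 \<le> 4 * P^3 \<Longrightarrow>
      l^2 * (2*P - 3*l*M) * (1 - P + M) \<le> c * (2*P - 3*M) * (1 - l^2*P + l^3*M)"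
  shows "l*x * ln (1+l*x) + l*y * ln (1+l*y) + l*z * ln (1+l*z) \<le> 
     c * (x * ln (1+x) + y * ln (1+y) + z * ln (1+z))"
proof -
  define f where "f u t = c * (u * ln (1+t*u)) - l*u * ln (1+t*(l*u))" for u t :: real
  define f' where "f' u t = c * (u^2 / (1+t*u)) - l^2 * (u^2/(1+t*(l*u)))" for u t :: real
  have pos: "1 + t*u > 0" if "1 + u > 0" "0 \<le> t" "t \<le> 1" for u t :: real
  proof -
    have "1 + t*u = (1-t) + t*(1+u)" by (simp add: algebra_simps)
    also have "\<dots> > 0" using that by (cases "t = 0") (auto simp: add_nonneg_pos)
    finally show ?thesis .
  qed
  have posl: "1 + t*(l*u) > 0" if "1 + u > 0" "0 \<le> t" "t \<le> 1" for u t :: real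
    using pos[of u "t*l"] that l by (simp add: mult_le_one mult.assoc)
  have d: "(f u has_real_derivative f' u t) (at t)" if "1 + u > 0" "0 \<le> t" "t \<le> 1" for u t
    unfolding f_def f'_def
    using pos[OF that] posl[OF that]
    by (auto intro!: derivative_eq_intros simp: power2_eq_square algebra_simps)
  \<comment> \<open>All logarithms vanish at \<open>t = 0\<close>, so monotonicity on the unit
    interval is the claim. For \<open>t > 0\<close> the derivative times \<open>t^2\<close> is
    controlled by \<open>quotient_sum_contraction\<close> at the scaled triple; at
    \<open>t = 0\<close> that factor is lost and \<open>l^2 \<le> c\<close> takes over.\<close>
  have "f x 0 + f y 0 + f z 0 \<le> f x 1 + f y 1 + f z 1"
  proof (rule DERIV_nonneg_imp_nondecreasing[of 0 1 "\<lambda>t. f x t + f y t + f z t"])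
    fix t :: real assume t: "0 \<le> t" "t \<le> 1"
    have D: "((\<lambda>t. f x t + f y t + f z t) has_real_derivative f' x t + f' y t + f' z t) (at t)"
      using t s by (intro DERIV_add d)
    moreover have "f' x t + f' y t + f' z t \<ge> 0"
    proof (cases "t = 0")
      case True
      then show ?thesis unfolding f'_def using l(3)
        by (simp add: mult_right_mono add_nonneg_nonneg)
    next
      case False
      have "l^2 * ((t*x)^2/(1+l*(t*x)) + (t*y)^2/(1+l*(t*y)) + (t*z)^2/(1+l*(t*z)))
         \<le> c * ((t*x)^2/(1+t*x) + (t*y)^2/(1+t*y) + (t*z)^2/(1+t*z))"
        using s t by (intro quotient_sum_contraction l pos poly) (auto simp flip: distrib_left)
      then have "0 \<le> t^2 * (f' x t + f' y t + f' z t)"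
        unfolding f'_def by (simp add: algebra_simps power_mult_distrib)
      then show ?thesis using False by (simp add: zero_le_mult_iff)
    qed
    ultimately show "\<exists>D. ((\<lambda>t. f x t + f y t + f z t) has_real_derivative D) (at t) \<and> 0 \<le> D"
      by blast
  qed simp
  then show ?thesis unfolding f_def by (simp add: algebra_simps)
qed

text \<open>Both factors have the same sign and grow in absolute value with the parameter. Hence one
  contraction estimate at \<open>m\<close> serves all smaller positive values.\<close>

lemma mult_ln_mono:
  fixes l m u :: real
  assumes "0 < l" "l \<le> m" "m < 1" "1 + u > 0"
  shows "l*u * ln (1+l*u) \<le> m*u * ln (1+m*u)"
proof (cases "u \<ge> 0")
  case True
  then have "l*u \<le> m*u" "0 \<le> l*u" using assms by (auto intro: mult_right_mono)
  moreover from this have "ln (1+l*u) \<le> ln (1+m*u)" by (subst ln_le_cancel_iff) auto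
  ultimately show ?thesis by (intro mult_mono[of "l*u" "m*u"]) auto
next
  case False
  have a: "m*u \<le> l*u" using False assms by (intro mult_right_mono_neg) auto
  have b: "l*u \<le> 0" using False assms by (simp add: mult_nonneg_nonpos)
  have "m*u \<ge> m * (-1)" using assms by (intro mult_left_mono) auto
  then have c: "1 + m*u > 0" using assms by linarith
  have "ln (1+m*u) \<le> ln (1+l*u)" "ln (1+l*u) \<le> 0" using a b c by auto
  then have "(-(l*u)) * (- ln (1+l*u)) \<le> (-(m*u)) * (- ln (1+m*u))"
    using a b by (intro mult_mono) auto
  then show ?thesis by simp
qed

definition contracts :: "real \<Rightarrow> real \<Rightarrow> bool" where
  "contracts l c \<longleftrightarrow> 0 < l \<and> l < 1 \<and> l^2 \<le> c \<and> (\<forall>P M. 0 \<le> P \<longrightarrow> P \<le> 3 \<longrightarrow> 27 * M^2 \<le> 4 * P^3 \<longrightarrow>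
      l^2 * (2*P - 3*l*M) * (1 - P + M) \<le> c * (2*P - 3*M) * (1 - l^2*P + l^3*M))"

text \<open>For fixed \<open>P\<close> the extreme points are \<open>(2 * t, - t, - t)\<close> with \<open>t = 3 * M / (2 * P)\<close>; there both
  sides factor, and what remains is a quadratic polynomial in \<open>t\<close> whose discriminant is the last hypothesis.\<close>

lemma contractsI:
  fixes l c :: real
  assumes l: "0 < l" "l < 1" "l^2 \<le> c" "c < 1"
    and disc: "(2 + 3*l - 3*c - 2*c*l)^2 \<le> 24*l*(1-c)^2" 
    and disc': "(l-c)^2 \<le> 8*(1-c)*(c-l^2)"
  shows "contracts l c"
  unfolding contracts_def
proof (intro conjI allI impI l)
  define a0 where "a0 = 2*(c - l^2)"
  define a1 where "a1 = 3*(c - l^3)"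
  define a2 where "a2 = 2*l^2*(1-c)"
  define a3 where "a3 = l^2*(2 + 3*l - 3*c - 2*c*l)"
  define a4 where "a4 = 3*l^3*(1-c)"
  note a_defs = a0_def a1_def a2_def a3_def a4_def
  fix P M :: real
  assume P: "0 \<le> P" and P3: "P \<le> 3" and M: "27 * M^2 \<le> 4 * P^3"
  have "l^3 \<le> l^2" using l by (intro power_decreasing) auto
  with l have "l^3 \<le> c" by linarith
  then have nn: "a0 \<ge> 0" "a1 \<ge> 0" "a2 \<ge> 0" "a4 > 0" using l by (auto simp: a_defs)
  \<comment> \<open>After the substitution \<open>M = m*P\<close> this quadratic is the slope in
    \<open>P\<close>; \<open>disc\<close> says that its discriminant is not positive.\<close>
  have quad: "a2 - a3*m + a4*m^2 \<ge> 0" for m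
  proof -
    have "4*a4*(a2 - a3*m + a4*m^2) = (2*a4*m - a3)^2 + l^4 * (24*l*(1-c)^2 - (2 + 3*l - 3*c - 2*c*l)^2)"
      unfolding a_defs by (simp add: algebra_simps power2_eq_square power3_eq_cube power4_eq_xxxx)
    moreover have "0 \<le> l^4 * (24*l*(1-c)^2 - (2 + 3*l - 3*c - 2*c*l)^2)"
      using disc by (intro mult_nonneg_nonneg) simp_all
    ultimately have "0 \<le> 4*a4*(a2 - a3*m + a4*m^2)" by (metis add_nonneg_nonneg zero_le_power2)
    moreover have "0 < 4*a4" using nn(4) by simp
    ultimately show ?thesis by (rule nonneg_of_mult_nonneg[rotated])
  qed
  \<comment> \<open>By \<open>quad\<close> the smallest \<open>P\<close> is the worst, and
    \<open>27/4 * m^2\<close> is the least value compatible with the cubic bound;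
    \<open>P \<le> 3\<close> then limits \<open>m\<close> to \<open>2/3\<close>. This is the
    double-root case.\<close>
  have extreme: "0 \<le> a0 - a1*m + 27/4 * m^2 * (a2 - a3*m + a4*m^2)" if "0 \<le> m" "m \<le> 2/3" for m
  proof -
    define t where "t = 3/2 * m"
    have m: "m = 2/3*t" and t: "0 \<le> t" "t \<le> 1" using that by (auto simp: t_def)
    have lt: "l*t \<le> 1" using t l by (simp add: mult_le_one)
    have "8*l^2*(1-c)*((c-l^2) - l*(l-c)*t + 2*l^2*(1-c)*t^2)
        = (4*l^2*(1-c)*t - l*(l-c))^2 + l^2*(8*(1-c)*(c-l^2) - (l-c)^2)"
      by (simp add: algebra_simps power2_eq_square)
    moreover have "0 \<le> l^2*(8*(1-c)*(c-l^2) - (l-c)^2)"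
      using disc' by (intro mult_nonneg_nonneg) simp_all
    ultimately have "0 \<le> 8*l^2*(1-c)*((c-l^2) - l*(l-c)*t + 2*l^2*(1-c)*t^2)" 
      by (metis add_nonneg_nonneg zero_le_power2)
    moreover have "0 < 8*l^2*(1-c)" using l by simp
    ultimately have "0 \<le> (c-l^2) - l*(l-c)*t + 2*l^2*(1-c)*t^2" by (rule nonneg_of_mult_nonneg[rotated])
    then have "0 \<le> 2*(1-t)*(1-l*t)*((c-l^2) - l*(l-c)*t + 2*l^2*(1-c)*t^2)"
      using t lt by (intro mult_nonneg_nonneg) simp_all
    also have "\<dots> = a0 - a1*m + 27/4 * m^2 * (a2 - a3*m + a4*m^2)"
      unfolding a_defs m by (simp add: algebra_simps power2_eq_square power3_eq_cube power4_eq_xxxx)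
    finally show ?thesis .
  qed
  have id: "c * (2*P - 3*M) * (1 - l^2*P + l^3*M) - l^2 * (2*P - 3*l*M) * (1 - P + M)
      = a0*P - a1*M + a2*P^2 - a3*P*M + a4*M^2"
    unfolding a_defs
    by (simp add: algebra_simps power2_eq_square power3_eq_cube)
  show "l^2 * (2*P - 3*l*M) * (1 - P + M) \<le> c * (2*P - 3*M) * (1 - l^2*P + l^3*M)"
  proof (cases "P = 0")
    case True
    then show ?thesis using M by simp
  next
    case False
    define m where "m = M / P"
    have Mm: "M = m*P" using False by (simp add: m_def)
    have "27 * m^2 * P^2 \<le> 4 * P * P^2" using M unfolding Mm
      by (simp add: power2_eq_square power3_eq_cube ac_simps)
    then have Pm: "27/4 * m^2 \<le> P" using False P by simp
    have "a0*P - a1*M + a2*P^2 - a3*P*M + a4*M^2 = P * (a0 - a1*m + P * (a2 - a3*m + a4*m^2))"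
      unfolding Mm by (simp add: algebra_simps power2_eq_square)
    moreover have "0 \<le> a0 - a1*m + P * (a2 - a3*m + a4*m^2)"
    proof (cases "m \<ge> 0")
      case True
      have "m^2 \<le> (2/3)^2" using Pm P3 by (simp add: power2_eq_square)
      then have "m \<le> 2/3" by (rule power2_le_imp_le) simp
      with True have "0 \<le> a0 - a1*m + 27/4 * m^2 * (a2 - a3*m + a4*m^2)" by (rule extreme)
      also have "\<dots> \<le> a0 - a1*m + P * (a2 - a3*m + a4*m^2)"
        using Pm quad by (intro add_left_mono mult_right_mono) auto
      finally show ?thesis .
    next
      case False
      have "a1*m \<le> 0" using False nn by (simp add: mult_nonneg_nonpos)
      moreover have "0 \<le> P * (a2 - a3*m + a4*m^2)" using P quad by simp
      ultimately show ?thesis using nn by linarith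
    qed
    ultimately have "0 \<le> a0*P - a1*M + a2*P^2 - a3*P*M + a4*M^2" using P by simp
    then show ?thesis using id by linarith
  qed
qed

text \<open>In this and the next two lemmas \<open>m\<close> is the claimed endpoint for \<lambda>,
  and \<open>c\<close> is 0.99/2, 0.98/3 and 0.98/2.5: a number just below 1 divided by the mean
  offspring number.\<close>

lemma contracts_binary: "contracts (69/100) (99/200)"
  by (rule contractsI) (simp_all add: power2_eq_square)

lemma contracts_ternary: "contracts (555/1000) (98/300)"
  by (rule contractsI) (simp_all add: power2_eq_square)

lemma contracts_mixed: "contracts (61/100) (98/250)"
  by (rule contractsI) (simp_all add: power2_eq_square)

lemma contracts_mono:
  assumes "contracts m c" "0 < l" "l \<le> m" "x + y + z = 0" "1 + x > 0" "1 + y > 0" "1 + z > 0"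
  shows "l*x * ln (1+l*x) + l*y * ln (1+l*y) + l*z * ln (1+l*z) \<le> 
     c * (x * ln (1+x) + y * ln (1+y) + z * ln (1+z))"
proof -
  have m: "m < 1" using assms(1) by (simp add: contracts_def)
  have "l*x * ln (1+l*x) + l*y * ln (1+l*y) + l*z * ln (1+l*z)
      \<le> m*x * ln (1+m*x) + m*y * ln (1+m*y) + m*z * ln (1+m*z)"
    using assms m by (intro add_mono mult_ln_mono) auto
  also have "\<dots> \<le> c * (x * ln (1+x) + y * ln (1+y) + z * ln (1+z))"
    using assms by (intro log_sum_contraction) (auto simp: contracts_def)
  finally show ?thesis .
qed

text \<open>The contribution of a single leaf configuration with likelihoods \<open>x\<close>,
  \<open>y\<close>, \<open>z\<close> to the symmetrized divergences of the three pairs of root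
  colors. It is homogeneous of degree one, so likelihoods need not be normalized.\<close>

definition J_div :: "real \<Rightarrow> real \<Rightarrow> real \<Rightarrow> real" where
  "J_div x y z = (x-y)*(ln x - ln y) + (x-z)*(ln x - ln z) + (y-z)*(ln y - ln z)"

lemma J_div_contraction:
  assumes c: "contracts m c" "0 < l" "l \<le> m" and pos: "x > 0" "y > 0" "z > 0"
  defines "S \<equiv> (x+y+z)/3"
  shows "J_div ((1-l)*S + l*x) ((1-l)*S + l*y) ((1-l)*S + l*z) \<le> c * J_div x y z"
proof -
  have S: "S > 0" using pos by (simp add: S_def)
  \<comment> \<open>The term \<open>ln S\<close> cancels in the differences, and for zero-sum
    numbers the sum of \<open>(u-v)*(f u - f v)\<close> over the pairs is three times the sum of
    \<open>u * f u\<close>.\<close>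
  have J: "J_div (S*(1+u)) (S*(1+v)) (S*(1+w)) = 3 * S * (u * ln (1+u) + v * ln (1+v) + w * ln (1+w))"
    if "u + v + w = 0" "1 + u > 0" "1 + v > 0" "1 + w > 0" for u v w
  proof -
    have w: "w = - u - v" using that by simp
    have "J_div (S*(1+u)) (S*(1+v)) (S*(1+w)) = S * ((u-v)*(ln (1+u) - ln (1+v)) 
       + (u-w)*(ln (1+u) - ln (1+w)) + (v-w)*(ln (1+v) - ln (1+w)))"
    proof -
      have ln: "ln (S*(1+r)) = ln S + ln (1+r)" if "1 + r > 0" for r
        using that S by (rule ln_mult_pos[rotated])
      show ?thesis unfolding J_div_def using that by (simp only: ln) (simp add: algebra_simps)
    qed
    also have "\<dots> = 3 * S * (u * ln (1+u) + v * ln (1+v) + w * ln (1+w))"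
      unfolding w by (simp add: algebra_simps)
    finally show ?thesis .
  qed
  define u where "u = x/S - 1"
  define v where "v = y/S - 1"
  define w where "w = z/S - 1"
  have xs: "x = S*(1+u)" "y = S*(1+v)" "z = S*(1+w)" using S by (auto simp: u_def v_def w_def)
  have uvw: "1 + u > 0" "1 + v > 0" "1 + w > 0" using S pos by (auto simp: u_def v_def w_def)
  have "x + y + z = 3*S" by (simp add: S_def)
  then have "S * (u + v + w) = 0" using xs by (simp add: algebra_simps)
  then have sum0: "u + v + w = 0" using S by simp
  have l: "l < 1" using c by (simp add: contracts_def)
  have pos_l: "1 + l*r > 0" if "1 + r > 0" for r
  proof -
    have "1 + l*r = (1-l) + l*(1+r)" by (simp add: algebra_simps)
    also have "\<dots> > 0" using that l c(2) by (simp add: add_pos_pos)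
    finally show ?thesis .
  qed
  have "(1-l)*S + l*(S*(1+r)) = S*(1+l*r)" for r by (simp add: algebra_simps)
  then have "J_div ((1-l)*S + l*x) ((1-l)*S + l*y) ((1-l)*S + l*z)
     = J_div (S*(1+l*u)) (S*(1+l * v)) (S*(1+l*w))" using xs by simp
  also have "\<dots> = 3*S*(l*u * ln (1+l*u) + l * v * ln (1+l * v) + l*w * ln (1+l*w))"
    using sum0 uvw pos_l by (intro J) (auto simp flip: distrib_left)
  also have "\<dots> \<le> 3*S*(c * (u * ln (1+u) + v * ln (1+v) + w * ln (1+w)))"
    using S by (intro mult_left_mono contracts_mono[OF c sum0 uvw]) auto
  also have "\<dots> = c * J_div x y z" unfolding xs J[OF sum0 uvw] by simp
  finally show ?thesis .
qed

section \<open>Comparison of the divergence with total variation\<close>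

lemma diff_ln_diff_ge:
  fixes x y :: real
  assumes "x > 0" "y > 0"
  shows "(x-y)^2/(x+y) \<le> (x-y)*(ln x - ln y)"
proof -
  have *: "(x-y)^2/(x+y) \<le> (x-y)*(ln x - ln y)" if "x > 0" "y > 0" "y \<le> x" for x y :: real
  proof -
    have "ln (y/x) \<le> y/x - 1" using that by (intro ln_le_minus_one) simp
    then have "ln x - ln y \<ge> (x-y)/x" using that by (simp add: ln_div diff_divide_distrib)
    moreover have "(x-y)/x \<ge> (x-y)/(x+y)" using that by (intro divide_left_mono) auto
    ultimately have "(x-y)*((x-y)/(x+y)) \<le> (x-y)*(ln x - ln y)"
      using that by (intro mult_left_mono) auto
    then show ?thesis by (simp add: power2_eq_square)
  qed
  have "(y-x)^2 = (x-y)^2" "y + x = x + y" "(y-x)*(ln y - ln x) = (x-y)*(ln x - ln y)"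
    by (simp_all add: power2_commute algebra_simps)
  then show ?thesis using *[of x y] *[of y x] assms by (cases "y \<le> x") (simp_all add: add.commute)
qed

text \<open>A linearized Cauchy--Schwarz inequality: it can be summed over configurations term by
  term, and \<open>e\<close> remains free to be chosen per generation.\<close>

lemma abs_diff_le_eps:
  fixes x y e :: real
  assumes "x \<ge> 0" "y \<ge> 0" "e > 0"
  shows "\<bar>x-y\<bar> \<le> e*(x+y) + (x-y)^2/(x+y)/e"
proof (cases "x + y = 0")
  case False
  define a where "a = \<bar>x-y\<bar>"
  define s where "s = x + y"
  have s: "s > 0" using False assms by (simp add: s_def)
  have "0 \<le> (a - e * s)^2 + a*(e * s)" using assms s by (simp add: a_def)
  then have "a * (e * s) \<le> (e * s)*(e * s) + a^2" by (simp add: power2_eq_square algebra_simps)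
  then have "a \<le> ((e * s)*(e * s) + a^2) / (e * s)" using assms s by (simp add: pos_le_divide_eq)
  also have "\<dots> = e * s + a^2/s/e" using assms s by (simp add: add_divide_distrib mult.commute)
  finally show ?thesis by (simp add: a_def s_def)
qed (use assms in auto)

section \<open>The chi-square inequalities for colorings\<close>

text \<open>These polynomials have nonnegative coefficients in the Bernstein basis of the interval.\<close>

lemma vertex_edge_poly_low:
  fixes n :: real
  assumes "0 \<le> n" "n \<le> 1/3"
  shows "0 \<le> 11/60 - 3/5*n - 2/5*n^2 + 23/8*n^3 - 2*n^4"
proof -
  have "11/60 - 3/5*n - 2/5*n^2 + 23/8*n^3 - 2*n^4 =
    297/20*(1/3-n)^4
    + 216/5*n^1*(1/3-n)^3
    + 369/10*n^2*(1/3-n)^2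
    + 489/40*n^3*(1/3-n)^1
    + 67/40*n^4"
    by (simp add: eval_nat_numeral field_simps)
  also have "\<dots> \<ge> 0"
    using assms by (intro add_nonneg_nonneg mult_nonneg_nonneg zero_le_power) auto
  finally show ?thesis .
qed

text \<open>Over the whole interval from \<open>0\<close> to \<open>2/3\<close> one of the
  degree-four Bernstein coefficients is negative, so the interval is cut at
  \<open>1/3\<close>.\<close>

lemma vertex_edge_poly_high:
  fixes n :: real
  assumes "1/3 \<le> n" "n \<le> 2/3"
  shows "0 \<le> 11/60 - 3/5*n - 2/5*n^2 + 23/8*n^3 - 2*n^4"
proof -
  have "11/60 - 3/5*n - 2/5*n^2 + 23/8*n^3 - 2*n^4 =
    67/40*(2/3-n)^4
    + 47/40*(n-1/3)^1*(2/3-n)^3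
    + 15/4*(n-1/3)^2*(2/3-n)^2
    + 113/10*(n-1/3)^3*(2/3-n)^1
    + 101/20*(n-1/3)^4"
    by (simp add: eval_nat_numeral field_simps)
  also have "\<dots> \<ge> 0"
    using assms by (intro add_nonneg_nonneg mult_nonneg_nonneg zero_le_power) auto
  finally show ?thesis .
qed

lemma vertex_mid_poly:
  fixes n :: real
  assumes "0 \<le> n" "n \<le> 2/3"
  shows "0 \<le> 11/60 - 7/20*n + 9/20*n^2 + 3/8*n^3 - 9/16*n^4"
proof -
  have "11/60 - 7/20*n + 9/20*n^2 + 3/8*n^3 - 9/16*n^4 =
    297/320*(2/3-n)^4
    + 81/32*n^1*(2/3-n)^3
    + 243/80*n^2*(2/3-n)^2
    + 441/160*n^3*(2/3-n)^1
    + 243/320*n^4"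
    by (simp add: eval_nat_numeral field_simps)
  also have "\<dots> \<ge> 0"
    using assms by (intro add_nonneg_nonneg mult_nonneg_nonneg zero_le_power) auto
  finally show ?thesis .
qed

lemma face_mid_poly:
  fixes n :: real
  assumes "0 \<le> n" "n \<le> 2/3"
  shows "0 \<le> 11/60 + 3/20*n - 57/40*n^2 + 21/8*n^3 - 45/32*n^4"
proof -
  have "11/60 + 3/20*n - 57/40*n^2 + 21/8*n^3 - 45/32*n^4 =
    297/320*(2/3-n)^4
    + 135/32*n^1*(2/3-n)^3
    + 621/160*n^2*(2/3-n)^2
    + 441/160*n^3*(2/3-n)^1
    + 243/320*n^4"
    by (simp add: eval_nat_numeral field_simps)
  also have "\<dots> \<ge> 0"
    using assms by (intro add_nonneg_nonneg mult_nonneg_nonneg zero_le_power) auto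
  finally show ?thesis .
qed

lemma face_edge_poly:
  fixes n :: real
  assumes "0 \<le> n" "n \<le> 2/3"
  shows "0 \<le> 11/60 - 1/10*n - 7/5*n^2 + 7/2*n^3 - 2*n^4"
proof -
  have "11/60 - 1/10*n - 7/5*n^2 + 7/2*n^3 - 2*n^4 =
    297/320*(2/3-n)^4
    + 27/8*n^1*(2/3-n)^3
    + 45/32*n^2*(2/3-n)^2
    + 33/20*n^3*(2/3-n)^1
    + 221/320*n^4"
    by (simp add: eval_nat_numeral field_simps)
  also have "\<dots> \<ge> 0"
    using assms by (intro add_nonneg_nonneg mult_nonneg_nonneg zero_le_power) auto
  finally show ?thesis .
qed

lemma pair_vertex_mid_poly:
  fixes n :: real
  assumes "0 \<le> n" "n \<le> 1/6"
  shows "0 \<le> 1/180 - 23/360*n + 7/12*n^2 - 3/2*n^4 + 9/16*n^5"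
proof -
  have "1/180 - 23/360*n + 7/12*n^2 - 3/2*n^4 + 9/16*n^5 =
    216/5*(1/6-n)^5
    + 666/5*n^1*(1/6-n)^4
    + 1134/5*n^2*(1/6-n)^3
    + 1566/5*n^3*(1/6-n)^2
    + 1269/5*n^4*(1/6-n)^1
    + 6237/80*n^5"
    by (simp add: eval_nat_numeral field_simps)
  also have "\<dots> \<ge> 0"
    using assms by (intro add_nonneg_nonneg mult_nonneg_nonneg zero_le_power) auto
  finally show ?thesis .
qed

lemma pair_vertex_edge_poly:
  fixes n :: real
  assumes "0 \<le> n" "n \<le> 1/6"
  shows "0 \<le> 1/180 - 23/360*n + 7/3*n^2 - 12*n^3 - 6*n^4 + 36*n^5"
proof -
  have "1/180 - 23/360*n + 7/3*n^2 - 12*n^3 - 6*n^4 + 36*n^5 =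
    216/5*(1/6-n)^5
    + 666/5*n^1*(1/6-n)^4
    + 3024/5*n^2*(1/6-n)^3
    + 5076/5*n^3*(1/6-n)^2
    + 2484/5*n^4*(1/6-n)^1
    + 162/5*n^5"
    by (simp add: eval_nat_numeral field_simps)
  also have "\<dots> \<ge> 0"
    using assms by (intro add_nonneg_nonneg mult_nonneg_nonneg zero_le_power) auto
  finally show ?thesis .
qed

lemma pair_face_mid_poly:
  fixes n :: real
  assumes "0 \<le> n" "n \<le> 1/6"
  shows "0 \<le> 1/180 - 23/360*n + 5/6*n^2 - 3/8*n^3 - 33/16*n^4 + 45/32*n^5"
proof -
  have "1/180 - 23/360*n + 5/6*n^2 - 3/8*n^3 - 33/16*n^4 + 45/32*n^5 =
    216/5*(1/6-n)^5
    + 666/5*n^1*(1/6-n)^4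
    + 1404/5*n^2*(1/6-n)^3
    + 4617/10*n^3*(1/6-n)^2
    + 15417/40*n^4*(1/6-n)^1
    + 18549/160*n^5"
    by (simp add: eval_nat_numeral field_simps)
  also have "\<dots> \<ge> 0"
    using assms by (intro add_nonneg_nonneg mult_nonneg_nonneg zero_le_power) auto
  finally show ?thesis .
qed

lemma pair_face_edge_poly:
  fixes n :: real
  assumes "0 \<le> n" "n \<le> 1/6"
  shows "0 \<le> 1/180 - 23/360*n + 10/3*n^2 - 9*n^3 - 15*n^4 + 9*n^5"
proof -
  have "1/180 - 23/360*n + 10/3*n^2 - 9*n^3 - 15*n^4 + 9*n^5 =
    216/5*(1/6-n)^5
    + 666/5*n^1*(1/6-n)^4
    + 4104/5*n^2*(1/6-n)^3
    + 8856/5*n^3*(1/6-n)^2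
    + 6534/5*n^4*(1/6-n)^1
    + 1377/5*n^5"
    by (simp add: eval_nat_numeral field_simps)
  also have "\<dots> \<ge> 0"
    using assms by (intro add_nonneg_nonneg mult_nonneg_nonneg zero_le_power) auto
  finally show ?thesis .
qed

section \<open>Averages over permutations of a law on three colors\<close>

lemma concave_quadratic_nonneg:
  fixes a b c t :: real
  assumes "0 \<le> t" "t \<le> 1" "0 \<le> a" "c \<le> 0" "0 \<le> a + b + c"
  shows "0 \<le> a + b*t + c*t^2"
proof -
  have "a + b*t + c*t^2 = (1-t)*a + t*(a+b+c) + (-c)*(t*(1-t))"
    by (simp add: algebra_simps power2_eq_square)
  moreover have "0 \<le> (1-t)*a" "0 \<le> t*(a+b+c)" "0 \<le> (-c)*(t*(1-t))"
    using assms by (simp_all add: mult_nonpos_nonneg)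
  ultimately show ?thesis by linarith
qed

text \<open>In the square sum of \<open>a*(1-p)\<close>, \<open>b*(1-q)\<close>,
  \<open>c*(1-r)\<close> this is the part left over once everything divisible by the mass
  \<open>1-u\<close>, with \<open>u = a*p+b*q+c*r\<close>, is split off. For
  \<open>a + b + c = 1\<close> it does not change when a constant is subtracted from all three
  arguments.\<close>

definition wdev :: "real \<Rightarrow> real \<Rightarrow> real \<Rightarrow> real \<Rightarrow> real \<Rightarrow> real \<Rightarrow> real" where
  "wdev a b c x y z = a^2*(x - (a*x+b*y+c*z))^2 + b^2*(y - (a*x+b*y+c*z))^2 + c^2*(z - (a*x+b*y+c*z))^2"

definition perm_sum :: "(real \<Rightarrow> real \<Rightarrow> real \<Rightarrow> real) \<Rightarrow> real \<Rightarrow> real \<Rightarrow> real \<Rightarrow> real" where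
  "perm_sum f x y z = f x y z + f x z y + f y x z + f y z x + f z x y + f z y x"

text \<open>On zero-sum triples the symmetric polynomials of degree at most three are spanned by
  \<open>1\<close>, \<open>D\<close> and \<open>M\<close>, so symmetrization leaves only these two
  quantities.\<close>

lemma perm_sum_square_linear:
  fixes a b c p q r x y z K :: real
  assumes "a + b + c = 1" "p + q + r = 0" "x + y + z = 0"
  defines "D \<equiv> x^2 + y^2 + z^2" and "M \<equiv> x^3 + y^3 + z^3"
  shows "perm_sum (\<lambda>x y z. (p*x+q*y+r*z)^2 * (K + (a*x+b*y+c*z))) x y z
     = 3*K*D*(p^2+q^2+r^2) + 3*M*(p^2*(3*a-1) + q^2*(3*b-1) + r^2*(3*c-1))"
proof -
  have c: "c = 1 - a - b" and z: "z = - x - y" and r: "r = - p - q" using assms by auto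
  show ?thesis unfolding perm_sum_def D_def M_def c z r
    by (simp add: algebra_simps power2_eq_square power3_eq_cube)
qed

lemma perm_sum_add: "perm_sum (\<lambda>x y z. f x y z + g x y z) x y z = perm_sum f x y z + perm_sum g x y z"
  by (simp add: perm_sum_def)

lemma perm_sum_cmult: "perm_sum (\<lambda>x y z. d * f x y z) x y z = d * perm_sum f x y z"
  by (simp add: perm_sum_def algebra_simps)

lemma perm_sum_wdev:
  fixes a b c x y z K :: real
  assumes "a + b + c = 1" "x + y + z = 0"
  defines "S \<equiv> a^2 + b^2 + c^2" and "C \<equiv> a^3 + b^3 + c^3" and "Q \<equiv> a^4 + b^4 + c^4"
  defines "D \<equiv> x^2 + y^2 + z^2" and "M \<equiv> x^3 + y^3 + z^3"
  shows "perm_sum (\<lambda>x y z. wdev a b c x y z * (K + (a*x+b*y+c*z))) x y z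
     = 3*K*D*(S + S^2 - 2*C) + 3*M*(S*(3*C-S-1) + 5*C - 6*Q)"
proof -
  \<comment> \<open>Each deviation is a linear form whose coefficients sum to zero, as
    \<open>perm_sum_square_linear\<close> requires.\<close>
  have "wdev a b c x y z * (K + (a*x+b*y+c*z)) =
      a^2 * (((1-a)*x+(-b)*y+(-c)*z)^2 * (K + (a*x+b*y+c*z))) 
      + b^2 * (((-a)*x+(1-b)*y+(-c)*z)^2 * (K + (a*x+b*y+c*z))) 
      + c^2 * (((-a)*x+(-b)*y+(1-c)*z)^2 * (K + (a*x+b*y+c*z)))" for x y z
  proof -
    have e: "x - (a*x+b*y+c*z) = (1-a)*x+(-b)*y+(-c)*z" "y - (a*x+b*y+c*z) = (-a)*x+(1-b)*y+(-c)*z"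
       "z - (a*x+b*y+c*z) = (-a)*x+(-b)*y+(1-c)*z" by (simp_all add: algebra_simps)
    show ?thesis unfolding wdev_def e by (simp only: distrib_right mult.assoc)
  qed
  then have "perm_sum (\<lambda>x y z. wdev a b c x y z * (K + (a*x+b*y+c*z))) x y z =
     a^2 * perm_sum (\<lambda>x y z. ((1-a)*x+(-b)*y+(-c)*z)^2 * (K + (a*x+b*y+c*z))) x y z
      + b^2 * perm_sum (\<lambda>x y z. ((-a)*x+(1-b)*y+(-c)*z)^2 * (K + (a*x+b*y+c*z))) x y z
      + c^2 * perm_sum (\<lambda>x y z. ((-a)*x+(-b)*y+(1-c)*z)^2 * (K + (a*x+b*y+c*z))) x y z"
    by (simp only: perm_sum_add perm_sum_cmult)
  also have "\<dots> = a^2 * (3*K*D*((1-a)^2+(-b)^2+(-c)^2) + 3*M*((1-a)^2*(3*a-1) + (-b)^2*(3*b-1) + (-c)^2*(3*c-1)))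
     + b^2 * (3*K*D*((-a)^2+(1-b)^2+(-c)^2) + 3*M*((-a)^2*(3*a-1) + (1-b)^2*(3*b-1) + (-c)^2*(3*c-1)))
     + c^2 * (3*K*D*((-a)^2+(-b)^2+(1-c)^2) + 3*M*((-a)^2*(3*a-1) + (-b)^2*(3*b-1) + (1-c)^2*(3*c-1)))"
    unfolding D_def M_def
    by (subst (1 2 3) perm_sum_square_linear) (use assms in auto)
  also have "\<dots> = 3*K*D*(S + S^2 - 2*C) + 3*M*(S*(3*C-S-1) + 5*C - 6*Q)"
  proof -
    have e: "(1-t)^2 = 1 - 2*t + t^2" "(1-t)^2*(3*t-1) = -1 + 5*t - 7*t^2 + 3*t^3"  for t :: real
      by (simp_all add: algebra_simps eval_nat_numeral)
    have "(1-a)^2+(-b)^2+(-c)^2 = 1 - 2*a + S" "(-a)^2+(1-b)^2+(-c)^2 = 1 - 2*b + S"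
      "(-a)^2+(-b)^2+(1-c)^2 = 1 - 2*c + S"
      "(1-a)^2*(3*a-1) + (-b)^2*(3*b-1) + (-c)^2*(3*c-1) = 3*C - S - 1 + 5*a - 6*a^2"
      "(-a)^2*(3*a-1) + (1-b)^2*(3*b-1) + (-c)^2*(3*c-1) = 3*C - S - 1 + 5*b - 6*b^2"
      "(-a)^2*(3*a-1) + (-b)^2*(3*b-1) + (1-c)^2*(3*c-1) = 3*C - S - 1 + 5*c - 6*c^2"
      unfolding e S_def C_def by (simp_all add: algebra_simps eval_nat_numeral)
    then have "a^2 * (3*K*D*((1-a)^2+(-b)^2+(-c)^2) + 3*M*((1-a)^2*(3*a-1) + (-b)^2*(3*b-1) + (-c)^2*(3*c-1)))
     + b^2 * (3*K*D*((-a)^2+(1-b)^2+(-c)^2) + 3*M*((-a)^2*(3*a-1) + (1-b)^2*(3*b-1) + (-c)^2*(3*c-1)))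
     + c^2 * (3*K*D*((-a)^2+(-b)^2+(1-c)^2) + 3*M*((-a)^2*(3*a-1) + (-b)^2*(3*b-1) + (1-c)^2*(3*c-1)))
     = a^2 * (3*K*D*(1 - 2*a + S) + 3*M*(3*C - S - 1 + 5*a - 6*a^2))
     + b^2 * (3*K*D*(1 - 2*b + S) + 3*M*(3*C - S - 1 + 5*b - 6*b^2))
     + c^2 * (3*K*D*(1 - 2*c + S) + 3*M*(3*C - S - 1 + 5*c - 6*c^2))" by simp
    also have "\<dots> = 3*K*D*((a^2+b^2+c^2) + (a^2+b^2+c^2)*S - 2*(a^3+b^3+c^3)) 
      + 3*M*((a^2+b^2+c^2)*(3*C-S-1) + 5*(a^3+b^3+c^3) - 6*(a^4+b^4+c^4))"
      by (simp add: algebra_simps power2_eq_square power3_eq_cube power4_eq_xxxx)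
    also have "\<dots> = 3*K*D*(S + S^2 - 2*C) + 3*M*(S*(3*C-S-1) + 5*C - 6*Q)"
      by (simp add: S_def C_def Q_def power2_eq_square)
    finally show ?thesis .
  qed
  finally show ?thesis .
qed

text \<open>The upper bound is attained at the vertices of the simplex, the lower one at the midpoints of
  its edges.\<close>

lemma simplex_cubic_bounds:
  fixes p q r :: real
  assumes "p \<ge> 0" "q \<ge> 0" "r \<ge> 0" "p + q + r = 1"
  defines "D \<equiv> (p-1/3)^2 + (q-1/3)^2 + (r-1/3)^2" and "M \<equiv> (p-1/3)^3 + (q-1/3)^3 + (r-1/3)^3"
  shows "M \<le> D/3" "- D/6 \<le> M"
proof -
  have r: "r = 1 - p - q" using assms by simp
  have "D/3 - M = (p*(q-r)^2 + q*(p-r)^2 + r*(p-q)^2) / 3"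
    unfolding D_def M_def r by (simp add: field_simps power2_eq_square power3_eq_cube)
  also have "\<dots> \<ge> 0" using assms by simp
  finally show "M \<le> D/3" by simp
  \<comment> \<open>Schur's inequality of degree three; by symmetry the ordered case
    suffices.\<close>
  have schur: "0 \<le> u*(u-v)*(u-w) + v * (v-u)*(v-w) + w*(w-u)*(w-v)" 
    if "u \<ge> v" "v \<ge> w" "w \<ge> 0" for u v w :: real
  proof -
    have "u*(u-v)*(u-w) + v * (v-u)*(v-w) + w*(w-u)*(w-v) = (u-v)^2*(u+v-w) + w*(u-w)*(v-w)"
      by (simp add: algebra_simps power2_eq_square)
    also have "\<dots> \<ge> 0" using that by (intro add_nonneg_nonneg mult_nonneg_nonneg) auto
    finally show ?thesis .
  qed
  have "0 \<le> p*(p-q)*(p-r) + q*(q-p)*(q-r) + r*(r-p)*(r-q)"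
    using schur[of p q r] schur[of p r q] schur[of q p r] schur[of q r p] schur[of r p q] schur[of r q p] assms(1-3)
    by (cases "p \<le> q"; cases "q \<le> r"; cases "p \<le> r") (simp_all add: algebra_simps)
  also have "\<dots> = 3 * (M + D/6)"
    unfolding D_def M_def r by (simp add: field_simps power2_eq_square power3_eq_cube)
  finally show "- D/6 \<le> M" by simp
qed

text \<open>The symmetrized sum \<open>A*D + 3*B*M\<close> is linear in \<open>M\<close>, hence
  maximal at an end of the range of \<open>M\<close>. The ends \<open>D/3\<close> and
  \<open>- D/6\<close> give the two hypotheses \<open>A + B \<le> R\<close> and
  \<open>A - B/2 \<le> R\<close>.\<close>

lemma perm_sum_wdev_le:
  fixes a b c p q r K R :: real
  assumes "p \<ge> 0" "q \<ge> 0" "r \<ge> 0" "p + q + r = 1" "a + b + c = 1"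
  defines "S \<equiv> a^2 + b^2 + c^2" and "C \<equiv> a^3 + b^3 + c^3" and "Q \<equiv> a^4 + b^4 + c^4"
  defines "A \<equiv> 3*K*(S + S^2 - 2*C)" and "B \<equiv> S*(3*C-S-1) + 5*C - 6*Q"
  defines "D \<equiv> (p-1/3)^2 + (q-1/3)^2 + (r-1/3)^2"
  assumes "A + B \<le> R" "A - B/2 \<le> R"
  shows "perm_sum (\<lambda>p q r. wdev a b c (p-1/3) (q-1/3) (r-1/3) * (K + (a*(p-1/3)+b*(q-1/3)+c*(r-1/3)))) p q r \<le> R * D"
proof -
  define M where "M = (p-1/3)^3 + (q-1/3)^3 + (r-1/3)^3"
  have M: "M \<le> D/3" "- D/6 \<le> M" unfolding M_def D_def by (intro simplex_cubic_bounds assms)+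
  have "perm_sum (\<lambda>p q r. wdev a b c (p-1/3) (q-1/3) (r-1/3) * (K + (a*(p-1/3)+b*(q-1/3)+c*(r-1/3)))) p q r
    = perm_sum (\<lambda>x y z. wdev a b c x y z * (K + (a*x+b*y+c*z))) (p-1/3) (q-1/3) (r-1/3)"
    by (simp add: perm_sum_def)
  also have "\<dots> = A * D + 3*B*M"
    unfolding A_def B_def S_def C_def Q_def D_def M_def
    by (subst perm_sum_wdev) (use assms in \<open>simp_all add: algebra_simps\<close>)
  also have "\<dots> = (A+B) * ((D+6*M)/3) + (A-B/2)*((2*D-6*M)/3)" by (simp add: field_simps)
  also have "\<dots> \<le> R * ((D+6*M)/3) + R*((2*D-6*M)/3)"
    using M assms by (intro add_mono mult_right_mono) auto
  also have "\<dots> = R * D" by (simp add: field_simps)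
  finally show ?thesis .
qed

text \<open>Here \<open>k\<close> stands for the \<open>t^2\<close> of the lemmas below. Without the
  nonnegative term \<open>n^3/8*k^2\<close> the polynomial is concave in \<open>k\<close>, so only
  \<open>k = 0\<close> and \<open>k = 1\<close> remain: the \<open>mid\<close> and
  \<open>edge\<close> polynomials. In the names, \<open>vertex\<close> refers to
  \<open>A + B\<close> and \<open>face\<close> to \<open>A - B/2\<close>.\<close>

lemma any_vertex_poly:
  fixes n k :: real
  assumes n: "0 \<le> n" "n \<le> 2/3" and k: "0 \<le> k" "k \<le> 1"
  shows "0 \<le> (11/60 - 7/20*n + 9/20*n^2 + 3/8*n^3 - 9/16*n^4)
    + (- 1/4*n - 17/20*n^2 + 5/2*n^3 - 9/8*n^4) * k + (n^3/8 - 5/16*n^4) * k^2"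
proof -
  have "0 \<le> 11/60 - 3/5*n - 2/5*n^2 + 23/8*n^3 - 2*n^4"
    using vertex_edge_poly_low[of n] vertex_edge_poly_high[of n] n by (cases "n \<le> 1/3") auto
  then have "0 \<le> (11/60 - 7/20*n + 9/20*n^2 + 3/8*n^3 - 9/16*n^4)
    + (- 1/4*n - 17/20*n^2 + 5/2*n^3 - 9/8*n^4) * k + (- 5/16*n^4) * k^2"
    using vertex_mid_poly[of n] n k by (intro concave_quadratic_nonneg) auto
  moreover have "0 \<le> n^3/8*k^2" using n by simp
  ultimately show ?thesis by (simp add: algebra_simps)
qed

lemma any_face_poly:
  fixes n k :: real
  assumes n: "0 \<le> n" "n \<le> 2/3" and k: "0 \<le> k" "k \<le> 1"
  shows "0 \<le> (11/60 + 3/20*n - 57/40*n^2 + 21/8*n^3 - 45/32*n^4)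
    + (- 1/4*n + 1/40*n^2 + n^3 - 9/16*n^4) * k + (- 1/8*n^3 - 1/32*n^4) * k^2"
proof (rule concave_quadratic_nonneg[OF k])
  have "0 \<le> n^3" "0 \<le> n^4" using n by simp_all
  then show "- 1/8*n^3 - 1/32*n^4 \<le> 0" by linarith
qed (use face_mid_poly[of n] face_edge_poly[of n] n in \<open>simp_all add: field_simps\<close>)

lemma pair_vertex_poly:
  fixes n k :: real
  assumes n: "0 \<le> n" "n \<le> 1/6" and k: "0 \<le> k" "k \<le> 1"
  shows "0 \<le> (1/180 - 23/360*n + 7/12*n^2 - 3/2*n^4 + 9/16*n^5)
    + (7/4*n^2 - 12*n^3 + 9/4*n^4 + 81/8*n^5) * k + (- 27/4*n^4 + 405/16*n^5) * k^2"
proof -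
  have "405/16*n^5 = n^4 * (405/16*n)" by (simp add: eval_nat_numeral)
  also have "\<dots> \<le> n^4 * (27/4)" using n by (intro mult_left_mono) auto
  finally show ?thesis
    using pair_vertex_mid_poly[of n] pair_vertex_edge_poly[of n] n k
    by (intro concave_quadratic_nonneg) auto
qed

lemma pair_face_poly:
  fixes n k :: real
  assumes n: "0 \<le> n" "n \<le> 1/6" and k: "0 \<le> k" "k \<le> 1"
  shows "0 \<le> (1/180 - 23/360*n + 5/6*n^2 - 3/8*n^3 - 33/16*n^4 + 45/32*n^5)
    + (5/2*n^2 - 69/8*n^3 - 9/8*n^4 + 81/16*n^5) * k + (- 189/16*n^4 + 81/32*n^5) * k^2"
proof -
  have "81/32*n^5 = n^4 * (81/32*n)" by (simp add: eval_nat_numeral)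
  also have "\<dots> \<le> n^4 * (189/16)" using n by (intro mult_left_mono) auto
  finally show ?thesis
    using pair_face_mid_poly[of n] pair_face_edge_poly[of n] n k
    by (intro concave_quadratic_nonneg) auto
qed

text \<open>Meant for \<open>a\<close> the largest weight, whence \<open>n \<le> 2/3\<close>;
  \<open>t\<close> divides the remaining mass \<open>n\<close> between \<open>b\<close> and
  \<open>c\<close>. With \<open>m = a\<close> the factors \<open>1-m\<close> and
  \<open>4/3-m\<close> become \<open>n\<close> and \<open>n + 1/3\<close>. The right-hand constant
  is \<open>19/10/3 - 2/5*(S - 1/3)\<close>.\<close>

lemma any_extremes:
  fixes n t :: real
  assumes n: "0 \<le> n" "n \<le> 2/3" and t: "\<bar>t\<bar> \<le> 1"
  defines "a \<equiv> 1 - n" and "b \<equiv> n/2*(1+t)" and "c \<equiv> n/2*(1-t)"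
  defines "S \<equiv> a^2 + b^2 + c^2" and "C \<equiv> a^3 + b^3 + c^3" and "Q \<equiv> a^4 + b^4 + c^4"
  defines "A \<equiv> 3*(n+1/3)*(S + S^2 - 2*C)" and "B \<equiv> S*(3*C-S-1) + 5*C - 6*Q"
  shows "A + B \<le> 3*n*(23/30 - 2/5*S)" "A - B/2 \<le> 3*n*(23/30 - 2/5*S)"
proof -
  have k: "0 \<le> t^2" "t^2 \<le> 1" using t by (simp_all add: abs_square_le_1)
  have "3*n*(23/30 - 2/5*S) - (A + B) = 6*n*((11/60 - 7/20*n + 9/20*n^2 + 3/8*n^3 - 9/16*n^4)
    + (- 1/4*n - 17/20*n^2 + 5/2*n^3 - 9/8*n^4) * t^2 + (n^3/8 - 5/16*n^4) * (t^2)^2)"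
    unfolding A_def B_def S_def C_def Q_def a_def b_def c_def
    by (simp add: field_simps eval_nat_numeral)
  also have "\<dots> \<ge> 0" using any_vertex_poly[OF n k] n by simp
  finally show "A + B \<le> 3*n*(23/30 - 2/5*S)" by simp
  have "3*n*(23/30 - 2/5*S) - (A - B/2) = 6*n*((11/60 + 3/20*n - 57/40*n^2 + 21/8*n^3 - 45/32*n^4)
    + (- 1/4*n + 1/40*n^2 + n^3 - 9/16*n^4) * t^2 + (- 1/8*n^3 - 1/32*n^4) * (t^2)^2)"
    unfolding A_def B_def S_def C_def Q_def a_def b_def c_def
    by (simp add: field_simps eval_nat_numeral)
  also have "\<dots> \<ge> 0" using any_face_poly[OF n k] n by simp
  finally show "A - B/2 \<le> 3*n*(23/30 - 2/5*S)" by simp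
qed

text \<open>Now \<open>a \<le> 1/2\<close>, hence \<open>n \<le> 1/6\<close>; at
  \<open>t = 1\<close> or \<open>t = -1\<close> one of the other weights equals \<open>a\<close>.
  The factor \<open>S + 1/60\<close> is \<open>21/20/3 + (S - 1/3)\<close>.\<close>

lemma pair_extremes:
  fixes n t :: real
  assumes n: "0 \<le> n" "n \<le> 1/6" and t: "\<bar>t\<bar> \<le> 1"
  defines "a \<equiv> 1/3 + n" and "b \<equiv> 1/3 - n/2 + 3/2*n*t" and "c \<equiv> 1/3 - n/2 - 3/2*n*t"
  defines "S \<equiv> a^2 + b^2 + c^2" and "C \<equiv> a^3 + b^3 + c^3" and "Q \<equiv> a^4 + b^4 + c^4"
  defines "A \<equiv> 3*(1-n)*(S + S^2 - 2*C)" and "B \<equiv> S*(3*C-S-1) + 5*C - 6*Q"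
  shows "A + B \<le> 3*(2/3-n)*(S + 1/60)" "A - B/2 \<le> 3*(2/3-n)*(S + 1/60)"
proof -
  have k: "0 \<le> t^2" "t^2 \<le> 1" using t by (simp_all add: abs_square_le_1)
  have "3*(2/3-n)*(S + 1/60) - (A + B) = 6*((1/180 - 23/360*n + 7/12*n^2 - 3/2*n^4 + 9/16*n^5)
    + (7/4*n^2 - 12*n^3 + 9/4*n^4 + 81/8*n^5) * t^2 + (- 27/4*n^4 + 405/16*n^5) * (t^2)^2)"
    unfolding A_def B_def S_def C_def Q_def a_def b_def c_def
    by (simp add: field_simps eval_nat_numeral)
  also have "\<dots> \<ge> 0" using pair_vertex_poly[OF n k] by simp
  finally show "A + B \<le> 3*(2/3-n)*(S + 1/60)" by simp
  have "3*(2/3-n)*(S + 1/60) - (A - B/2) = 6*((1/180 - 23/360*n + 5/6*n^2 - 3/8*n^3 - 33/16*n^4 + 45/32*n^5)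
    + (5/2*n^2 - 69/8*n^3 - 9/8*n^4 + 81/16*n^5) * t^2 + (- 189/16*n^4 + 81/32*n^5) * (t^2)^2)"
    unfolding A_def B_def S_def C_def Q_def a_def b_def c_def
    by (simp add: field_simps eval_nat_numeral)
  also have "\<dots> \<ge> 0" using pair_face_poly[OF n k] by simp
  finally show "A - B/2 \<le> 3*(2/3-n)*(S + 1/60)" by simp
qed

section \<open>Chi-square information of a product of two messages\<close>

text \<open>\<open>1/3\<close> of the chi-square distance of the normalized triple from the uniform law, times the mass;
  division by zero gives the right value \<open>chi 0 0 0 = 0\<close>.\<close>

definition chi :: "real \<Rightarrow> real \<Rightarrow> real \<Rightarrow> real" where
  "chi a b c = (a^2+b^2+c^2) / (a+b+c) - (a+b+c)/3"

lemma perm_sum_mono: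
  assumes "\<And>x' y' z'. {x', y', z'} = {x, y, z} \<Longrightarrow> x' + y' + z' = x + y + z \<Longrightarrow> f x' y' z' \<le> g x' y' z'"
  shows "perm_sum f x y z \<le> perm_sum g x y z"
  unfolding perm_sum_def by (intro add_mono assms) auto

text \<open>The reweighted law has total mass \<open>(1 - u) / 2\<close>. Replacing \<open>1 / (1 - u)\<close> by \<open>(1 - m + u) / (1 - m)\<close>
  leaves a polynomial in \<open>(p, q, r)\<close>, whose average over permutations is explicit.\<close>

lemma chi_product_le:
  fixes a b c p q r m :: real
  assumes "p \<ge> 0" "q \<ge> 0" "r \<ge> 0" "p + q + r = 1"
    and "a \<ge> 0" "b \<ge> 0" "c \<ge> 0" "a + b + c = 1" "a \<le> m" "b \<le> m" "c \<le> m" "m < 1"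
  defines "S \<equiv> a^2 + b^2 + c^2" and "u \<equiv> a*p+b*q+c*r"
  shows "chi (a*(q+r)/2) (b*(p+r)/2) (c*(p+q)/2) \<le> S*(1-u)/2 + (S*u - (a^2*p+b^2*q+c^2*r)) - (1-u)/6
    + wdev a b c (p-1/3) (q-1/3) (r-1/3) * ((4/3-m) + (a*(p-1/3)+b*(q-1/3)+c*(r-1/3))) / (2*(1-m))"
proof -
  have um: "u \<le> m"
  proof -
    have "u \<le> m*p + m*q + m*r" unfolding u_def using assms by (intro add_mono mult_right_mono) auto
    also have "\<dots> = m" using assms by (simp flip: distrib_left)
    finally show ?thesis .
  qed
  then have u1: "1 - u > 0" using assms by simp
  have u0: "u \<ge> 0" unfolding u_def using assms by simp
  have w: "a*(p-1/3)+b*(q-1/3)+c*(r-1/3) = u - 1/3"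
    using assms by (simp add: u_def algebra_simps flip: add_divide_distrib)
  define W where "W = a^2*(p-u)^2 + b^2*(q-u)^2 + c^2*(r-u)^2"
  have W: "wdev a b c (p-1/3) (q-1/3) (r-1/3) = W" unfolding wdev_def w W_def by simp
  have W0: "W \<ge> 0" by (simp add: W_def)
  have qr: "q + r = 1 - p" "p + r = 1 - q" "p + q = 1 - r" using assms by auto
  have s: "a*(1-p)/2 + b*(1-q)/2 + c*(1-r)/2 = (1-u)/2"
    using assms by (simp add: u_def algebra_simps flip: add_divide_distrib)
  \<comment> \<open>Expansion of \<open>1-p\<close> as \<open>(1-u) + (u-p)\<close>, and likewise
    for \<open>q\<close> and \<open>r\<close>.\<close>
  have sq: "(a*(1-p)/2)^2 + (b*(1-q)/2)^2 + (c*(1-r)/2)^2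
    = (S*(1-u)^2 + 2*(1-u)*(S*u - (a^2*p+b^2*q+c^2*r)) + W)/4"
    unfolding S_def W_def by (simp add: field_simps power2_eq_square)
  have "chi (a*(q+r)/2) (b*(p+r)/2) (c*(p+q)/2)
    = (S*(1-u)^2 + 2*(1-u)*(S*u - (a^2*p+b^2*q+c^2*r)) + W)/4 / ((1-u)/2) - (1-u)/6"
    unfolding chi_def qr s sq by simp
  also have "\<dots> = S*(1-u)/2 + (S*u - (a^2*p+b^2*q+c^2*r)) - (1-u)/6 + W / (2*(1-u))"
    using u1 by (simp add: field_simps power2_eq_square)
  also have "W / (2*(1-u)) \<le> W * (1-m+u) / (2*(1-m))"
  proof -
    \<comment> \<open>The function \<open>1 + u/(1-m)\<close> is the chord over the interval from
      \<open>0\<close> to \<open>m\<close> of the convex function \<open>1/(1-u)\<close>, hence an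
      upper bound there.\<close>
    have "0 \<le> u * (m - u)" using um u0 by simp
    then have "1 - m \<le> (1-m+u) * (1-u)" by (simp add: algebra_simps)
    then have "W * (1 - m) \<le> W * ((1-m+u) * (1-u))" using W0 by (intro mult_left_mono)
    moreover have "1 - m > 0" using assms by simp
    ultimately have "W / (1-u) \<le> W * (1-m+u) / (1-m)" 
      using u1 by (simp add: pos_divide_le_eq pos_le_divide_eq mult.assoc)
    then have "W / (1-u) / 2 \<le> W * (1-m+u) / (1-m) / 2" by (rule divide_right_mono) simp
    then show ?thesis by (simp add: mult.commute)
  qed
  finally show ?thesis unfolding W w by (simp add: algebra_simps)
qed

text \<open>The terms other than \<open>wdev\<close> average exactly to the information of
  \<open>(a,b,c)\<close>; the whole influence of \<open>(p,q,r)\<close> sits in \<open>wdev\<close>,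
  and \<open>R\<close> measures it relative to \<open>chi p q r\<close>.\<close>

lemma perm_sum_chi_product_le:
  fixes a b c p q r m R :: real
  assumes "p \<ge> 0" "q \<ge> 0" "r \<ge> 0" "p + q + r = 1"
    and "a \<ge> 0" "b \<ge> 0" "c \<ge> 0" "a + b + c = 1" "a \<le> m" "b \<le> m" "c \<le> m" "m < 1"
  defines "S \<equiv> a^2 + b^2 + c^2" and "C \<equiv> a^3 + b^3 + c^3" and "Q \<equiv> a^4 + b^4 + c^4"
  defines "A \<equiv> 3*(4/3-m)*(S + S^2 - 2*C)" and "B \<equiv> S*(3*C-S-1) + 5*C - 6*Q"
  assumes "A + B \<le> 3*(1-m)*R" "A - B/2 \<le> 3*(1-m)*R"
  shows "perm_sum (\<lambda>p q r. chi (a*(q+r)/2) (b*(p+r)/2) (c*(p+q)/2)) p q r 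
     \<le> 2 * (S - 1/3) + 3/2 * R * chi p q r"
proof -
  define f where "f p q r = (let u = a*p+b*q+c*r in S*(1-u)/2 + (S*u - (a^2*p+b^2*q+c^2*r)) - (1-u)/6)" for p q r
  define g where "g p q r = wdev a b c (p-1/3) (q-1/3) (r-1/3) * ((4/3-m) + (a*(p-1/3)+b*(q-1/3)+c*(r-1/3)))" for p q r
  have "perm_sum (\<lambda>p q r. chi (a*(q+r)/2) (b*(p+r)/2) (c*(p+q)/2)) p q r
    \<le> perm_sum (\<lambda>p q r. f p q r + 1/(2*(1-m)) * g p q r) p q r"
  proof (rule perm_sum_mono)
    fix x y z assume xyz: "{x, y, z} = {p, q, r}" "x + y + z = p + q + r"
    then have "x \<in> {p,q,r}" "y \<in> {p,q,r}" "z \<in> {p,q,r}" by blast+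
    then have "x \<ge> 0" "y \<ge> 0" "z \<ge> 0" using assms by auto
    then show "chi (a*(y+z)/2) (b*(x+z)/2) (c*(x+y)/2) \<le> f x y z + 1/(2*(1-m)) * g x y z"
      using chi_product_le[of x y z a b c m] assms xyz by (simp add: f_def g_def Let_def)
  qed
  also have "\<dots> = perm_sum f p q r + 1/(2*(1-m)) * perm_sum g p q r"
    by (simp only: perm_sum_add perm_sum_cmult)
  also have "perm_sum f p q r = 2 * (S - 1/3)"
  proof -
    have r: "r = 1 - p - q" and c: "c = 1 - a - b" using assms by auto
    show ?thesis unfolding perm_sum_def f_def Let_def S_def r c 
      by (simp add: field_simps power2_eq_square)
  qed
  also have "1/(2*(1-m)) * perm_sum g p q r \<le> 1/(2*(1-m)) * (3*(1-m)*R * chi p q r)"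
  proof (rule mult_left_mono)
    have r: "r = 1 - p - q" using assms by auto
    have "perm_sum g p q r \<le> 3*(1-m)*R * ((p-1/3)^2 + (q-1/3)^2 + (r-1/3)^2)"
      unfolding g_def using assms by (intro perm_sum_wdev_le) auto
    also have "(p-1/3)^2 + (q-1/3)^2 + (r-1/3)^2 = chi p q r"
      unfolding chi_def r by (simp add: field_simps power2_eq_square)
    finally show "perm_sum g p q r \<le> 3*(1-m)*R * chi p q r" .
  qed (use \<open>m < 1\<close> in simp)
  also have "1/(2*(1-m)) * (3*(1-m)*R * chi p q r) = 3/2 * R * chi p q r"
  proof -
    have "1/(2*k) * (3*k*R*X) = 3/2 * R * X" if "k > 0" for k X :: real
      using that by (simp add: field_simps)
    from this[of "1 - m" "chi p q r"] \<open>m < 1\<close> show ?thesis by linarith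
  qed
  finally show ?thesis by simp
qed

lemma chi_scale: "chi (s*a) (s*b) (s*c) = s * chi a b c"
proof (cases "s = 0")
  case False
  have "(s*a)^2 + (s*b)^2 + (s*c)^2 = s * (s * (a^2+b^2+c^2))" "s*a + s*b + s*c = s * (a+b+c)"
    by (simp_all add: algebra_simps power2_eq_square)
  then show ?thesis using False by (simp add: chi_def right_diff_distrib)
qed (simp add: chi_def)

lemma chi_nonneg:
  assumes "a \<ge> 0" "b \<ge> 0" "c \<ge> 0"
  shows "chi a b c \<ge> 0"
proof (cases "a + b + c = 0")
  case False
  have "(a+b+c)*(a+b+c) \<le> 3*(a^2+b^2+c^2)"
    using sum_squares_ge_zero[of "a-b" "b-c"] zero_le_power2[of "a-c"]
    by (simp add: algebra_simps power2_eq_square)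
  then show ?thesis using False assms by (simp add: chi_def field_simps)
qed (simp add: chi_def)

lemma perm_sum_chi_commute:
  "perm_sum (\<lambda>p q r. chi (b*(q+r)/2) (a*(p+r)/2) (c*(p+q)/2)) p q r
     = perm_sum (\<lambda>p q r. chi (a*(q+r)/2) (b*(p+r)/2) (c*(p+q)/2)) p q r"
  "perm_sum (\<lambda>p q r. chi (c*(q+r)/2) (b*(p+r)/2) (a*(p+q)/2)) p q r
     = perm_sum (\<lambda>p q r. chi (a*(q+r)/2) (b*(p+r)/2) (c*(p+q)/2)) p q r"
  by (simp_all add: perm_sum_def chi_def add_ac)

lemma chi_commute: "chi b a c = chi a b c" "chi c b a = chi a b c"
  by (simp_all add: chi_def add_ac)

text \<open>Both sides are homogeneous of degree one in \<open>(a,b,c)\<close> and in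
  \<open>(p,q,r)\<close>, which is why the masses appear, and symmetric in \<open>a\<close>,
  \<open>b\<close>, \<open>c\<close> because of the average. So both triples may be normalized and
  \<open>a\<close> taken as the largest weight; \<open>P\<close> carries a side condition respected
  by these reductions.\<close>

lemma perm_sum_chi_normalize:
  fixes \<beta> \<gamma> :: real
  assumes simplex: "\<And>a b c p q r. a \<ge> 0 \<Longrightarrow> b \<ge> 0 \<Longrightarrow> c \<ge> 0 \<Longrightarrow> a + b + c = 1 \<Longrightarrow> P a b c \<Longrightarrow> b \<le> a \<Longrightarrow> c \<le> a \<Longrightarrow>
      p \<ge> 0 \<Longrightarrow> q \<ge> 0 \<Longrightarrow> r \<ge> 0 \<Longrightarrow> p + q + r = 1 \<Longrightarrow>
      perm_sum (\<lambda>p q r. chi (a*(q+r)/2) (b*(p+r)/2) (c*(p+q)/2)) p q r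
        \<le> 2 * chi a b c + 3/2 * chi p q r * (\<beta>/3 + \<gamma> * chi a b c)"
    and P_scale: "\<And>a b c s. P a b c \<Longrightarrow> s > 0 \<Longrightarrow> P (a/s) (b/s) (c/s)"
    and P_commute: "\<And>a b c. P a b c \<Longrightarrow> P b a c" "\<And>a b c. P a b c \<Longrightarrow> P c b a"
    and nonneg: "a \<ge> 0" "b \<ge> 0" "c \<ge> 0" "p \<ge> 0" "q \<ge> 0" "r \<ge> 0" and "P a b c"
  shows "perm_sum (\<lambda>p q r. chi (a*(q+r)/2) (b*(p+r)/2) (c*(p+q)/2)) p q r
        \<le> 2 * (p+q+r) * chi a b c + 3/2 * chi p q r * (\<beta>*(a+b+c)/3 + \<gamma> * chi a b c)"
proof (cases "a + b + c = 0 \<or> p + q + r = 0")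
  case True
  then have "a = 0 \<and> b = 0 \<and> c = 0 \<or> p = 0 \<and> q = 0 \<and> r = 0" using nonneg by auto
  then show ?thesis by (auto simp: perm_sum_def chi_def)
next
  case False
  have ordered: "perm_sum (\<lambda>p q r. chi (a*(q+r)/2) (b*(p+r)/2) (c*(p+q)/2)) p q r
        \<le> 2 * chi a b c + 3/2 * chi p q r * (\<beta>/3 + \<gamma> * chi a b c)"
    if "a \<ge> 0" "b \<ge> 0" "c \<ge> 0" "a + b + c = 1" "P a b c" "p \<ge> 0" "q \<ge> 0" "r \<ge> 0" "p + q + r = 1"
    for a b c p q r
  proof -
    consider "b \<le> a" "c \<le> a" | "a \<le> b" "c \<le> b" | "a \<le> c" "b \<le> c" by linarith
    then show ?thesis
    proof cases
      case 1
      then show ?thesis using that by (intro simplex)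
    next
      case 2
      then show ?thesis using that simplex[of b a c p q r] P_commute(1)[of a b c]
        by (simp add: perm_sum_chi_commute(1)[of b a c] chi_commute(1)[of b a c] add_ac)
    next
      case 3
      then show ?thesis using that simplex[of c b a p q r] P_commute(2)[of a b c]
        by (simp add: perm_sum_chi_commute(2)[of c b a] chi_commute(2)[of c b a] add_ac)
    qed
  qed
  define s where "s = a + b + c"
  define t where "t = p + q + r"
  have st: "s > 0" "t > 0" using False nonneg by (auto simp: s_def t_def)
  define a' b' c' where "a' = a/s" and "b' = b/s" and "c' = c/s"
  define p' q' r' where "p' = p/t" and "q' = q/t" and "r' = r/t"
  have e: "a = s*a'" "b = s*b'" "c = s*c'" "p = t*p'" "q = t*q'" "r = t*r'"
    using st by (auto simp: a'_def b'_def c'_def p'_def q'_def r'_def)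
  have 1: "a' + b' + c' = 1" "p' + q' + r' = 1" using st
    by (simp_all add: a'_def b'_def c'_def p'_def q'_def r'_def s_def t_def flip: add_divide_distrib)
  have "perm_sum (\<lambda>p q r. chi (a*(q+r)/2) (b*(p+r)/2) (c*(p+q)/2)) p q r
     = s * t * perm_sum (\<lambda>p q r. chi (a'*(q+r)/2) (b'*(p+r)/2) (c'*(p+q)/2)) p' q' r'"
  proof -
    have h: "s*u*(t*y+t*z)/2 = (s*t)*(u*(y+z)/2)" for u y z :: real by (simp add: algebra_simps)
    show ?thesis unfolding e perm_sum_def h chi_scale by (simp add: algebra_simps)
  qed
  also have "\<dots> \<le> s * t * (2 * chi a' b' c' + 3/2 * chi p' q' r' * (\<beta>/3 + \<gamma> * chi a' b' c'))"
    using st 1 nonneg P_scale[OF \<open>P a b c\<close> st(1)]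
    by (intro mult_left_mono ordered) (auto simp: a'_def b'_def c'_def p'_def q'_def r'_def)
  also have "\<dots> = 2 * t * chi a b c + 3/2 * chi p q r * (\<beta> * s/3 + \<gamma> * chi a b c)"
    unfolding e chi_scale by (simp add: algebra_simps)
  finally show ?thesis unfolding s_def t_def .
qed

lemma perm_sum_chi_any_le:
  assumes "a \<ge> 0" "b \<ge> 0" "c \<ge> 0" "p \<ge> 0" "q \<ge> 0" "r \<ge> 0"
  shows "perm_sum (\<lambda>p q r. chi (a*(q+r)/2) (b*(p+r)/2) (c*(p+q)/2)) p q r
        \<le> 2 * (p+q+r) * chi a b c + 3/2 * chi p q r * (19/10*(a+b+c)/3 + (-2/5) * chi a b c)"
proof (rule perm_sum_chi_normalize[where P = "\<lambda>_ _ _. True"])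
  fix a b c p q r :: real
  assume abc: "a \<ge> 0" "b \<ge> 0" "c \<ge> 0" "a + b + c = 1" "b \<le> a" "c \<le> a"
    and pqr: "p \<ge> 0" "q \<ge> 0" "r \<ge> 0" "p + q + r = 1"
  show "perm_sum (\<lambda>p q r. chi (a*(q+r)/2) (b*(p+r)/2) (c*(p+q)/2)) p q r
        \<le> 2 * chi a b c + 3/2 * chi p q r * (19/10/3 + (-2/5) * chi a b c)"
  \<comment> \<open>At a point mass the choice \<open>m = a\<close> would make the denominator
    \<open>1-m\<close> of the chord bound vanish; the sum is then computed directly.\<close>
  proof (cases "a = 1")
    case True
    then have bc: "b = 0" "c = 0" using abc by auto
    have h: "chi (x/2) 0 0 = x/3" for x by (simp add: chi_def power2_eq_square)
    have "perm_sum (\<lambda>p q r. chi (a*(q+r)/2) (b*(p+r)/2) (c*(p+q)/2)) p q r = 4/3 * (p+q+r)"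
      unfolding True bc perm_sum_def by (simp add: h) (simp add: add_divide_distrib)
    moreover have "0 \<le> chi p q r" using pqr by (intro chi_nonneg)
    ultimately show ?thesis using pqr unfolding True bc by (simp add: chi_def[of 1])
  next
    case False
    define n where "n = 1 - a"
    have n: "0 < n" "n \<le> 2/3" using abc False by (auto simp: n_def)
    define t where "t = (b - c) / n"
    have t: "\<bar>t\<bar> \<le> 1" using abc n by (auto simp: t_def n_def abs_le_iff divide_simps)
    have nt: "n*t = b - c" using n by (simp add: t_def)
    have "n/2*(1+t) = (n + n*t)/2" "n/2*(1-t) = (n - n*t)/2" by (simp_all add: field_simps)
    then have e: "a = 1 - n" "b = n/2*(1+t)" "c = n/2*(1-t)"
      using abc unfolding nt by (auto simp: n_def field_simps)
    define S where "S = a^2 + b^2 + c^2"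
    have chi: "chi a b c = S - 1/3" using abc by (simp add: chi_def S_def)
    have "perm_sum (\<lambda>p q r. chi (a*(q+r)/2) (b*(p+r)/2) (c*(p+q)/2)) p q r 
     \<le> 2 * (S - 1/3) + 3/2 * (23/30 - 2/5*S) * chi p q r"
      unfolding S_def
    proof (rule perm_sum_chi_product_le[where m = a, OF pqr abc(1-4)])
      have m: "4/3 - a = n + 1/3" "1 - a = n" by (simp_all add: n_def)
      have "0 \<le> n" using n by simp
      note ex = any_extremes[OF this n(2) t, folded e]
      show "3*(4/3-a)*((a^2+b^2+c^2) + (a^2+b^2+c^2)^2 - 2*(a^3+b^3+c^3)) + ((a^2+b^2+c^2)*(3*(a^3+b^3+c^3)-(a^2+b^2+c^2)-1) + 5*(a^3+b^3+c^3) - 6*(a^4+b^4+c^4)) \<le> 3*(1-a)*(23/30 - 2/5*(a^2+b^2+c^2))"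
        unfolding m by (rule ex(1))
      show "3*(4/3-a)*((a^2+b^2+c^2) + (a^2+b^2+c^2)^2 - 2*(a^3+b^3+c^3)) - ((a^2+b^2+c^2)*(3*(a^3+b^3+c^3)-(a^2+b^2+c^2)-1) + 5*(a^3+b^3+c^3) - 6*(a^4+b^4+c^4))/2 \<le> 3*(1-a)*(23/30 - 2/5*(a^2+b^2+c^2))"
        unfolding m by (rule ex(2))
    qed (use abc n in \<open>auto simp: n_def\<close>)
    then show ?thesis unfolding chi by (simp add: algebra_simps add_divide_distrib diff_divide_distrib)
  qed
qed (use assms in auto)

text \<open>The triangle conditions say that no color has more than half of the mass. They hold for
  a message \<open>((y+z)/2, (x+z)/2, (x+y)/2)\<close> that has crossed one coloring edge.\<close>

lemma perm_sum_chi_pair_le: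
  assumes "a \<ge> 0" "b \<ge> 0" "c \<ge> 0" "p \<ge> 0" "q \<ge> 0" "r \<ge> 0"
    and "a \<le> b + c" "b \<le> a + c" "c \<le> a + b"
  shows "perm_sum (\<lambda>p q r. chi (a*(q+r)/2) (b*(p+r)/2) (c*(p+q)/2)) p q r
        \<le> 2 * (p+q+r) * chi a b c + 3/2 * chi p q r * (21/20*(a+b+c)/3 + 1 * chi a b c)"
proof (rule perm_sum_chi_normalize[where P = "\<lambda>a b c. a \<le> b + c \<and> b \<le> a + c \<and> c \<le> a + b"])
  fix a b c p q r :: real
  assume abc: "a \<ge> 0" "b \<ge> 0" "c \<ge> 0" "a + b + c = 1" 
    and half: "a \<le> b + c \<and> b \<le> a + c \<and> c \<le> a + b"
    and le: "b \<le> a" "c \<le> a"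
    and pqr: "p \<ge> 0" "q \<ge> 0" "r \<ge> 0" "p + q + r = 1"
  define n where "n = a - 1/3"
  have n: "0 \<le> n" "n \<le> 1/6" using abc half le by (auto simp: n_def)
  define t where "t = (b - c) / (3*n)"
  have bc: "\<bar>b - c\<bar> \<le> 3*n" using abc le by (auto simp: n_def)
  then have t: "\<bar>t\<bar> \<le> 1" using n by (auto simp: t_def divide_le_eq abs_divide)
  have tn: "3/2*n*t = (b - c)/2" using bc by (cases "n = 0") (auto simp: t_def)
  have e: "a = 1/3 + n" "b = 1/3 - n/2 + 3/2*n*t" "c = 1/3 - n/2 - 3/2*n*t"
    unfolding tn using abc by (auto simp: n_def field_simps)
  define S where "S = a^2 + b^2 + c^2"
  have chi: "chi a b c = S - 1/3" using abc by (simp add: chi_def S_def)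
  have "perm_sum (\<lambda>p q r. chi (a*(q+r)/2) (b*(p+r)/2) (c*(p+q)/2)) p q r 
   \<le> 2 * (S - 1/3) + 3/2 * (S + 1/60) * chi p q r"
    unfolding S_def
  proof (rule perm_sum_chi_product_le[where m = a, OF pqr abc(1-4)])
    have m: "4/3 - a = 1 - n" "1 - a = 2/3 - n" by (simp_all add: n_def)
    note ex = pair_extremes[OF n t, folded e]
    show "3*(4/3-a)*((a^2+b^2+c^2) + (a^2+b^2+c^2)^2 - 2*(a^3+b^3+c^3)) + ((a^2+b^2+c^2)*(3*(a^3+b^3+c^3)-(a^2+b^2+c^2)-1) + 5*(a^3+b^3+c^3) - 6*(a^4+b^4+c^4)) \<le> 3*(1-a)*((a^2+b^2+c^2) + 1/60)"
      unfolding m by (rule ex(1))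
    show "3*(4/3-a)*((a^2+b^2+c^2) + (a^2+b^2+c^2)^2 - 2*(a^3+b^3+c^3)) - ((a^2+b^2+c^2)*(3*(a^3+b^3+c^3)-(a^2+b^2+c^2)-1) + 5*(a^3+b^3+c^3) - 6*(a^4+b^4+c^4))/2 \<le> 3*(1-a)*((a^2+b^2+c^2) + 1/60)"
      unfolding m by (rule ex(2))
  qed (use le n in \<open>auto simp: n_def\<close>)
  then show "perm_sum (\<lambda>p q r. chi (a*(q+r)/2) (b*(p+r)/2) (c*(p+q)/2)) p q r
        \<le> 2 * chi a b c + 3/2 * chi p q r * (21/20/3 + 1 * chi a b c)" 
    unfolding chi by (simp add: algebra_simps add_divide_distrib)
qed (use assms in \<open>auto simp: field_simps\<close>)

section \<open>Likelihoods on trees\<close>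

lemma finite_colors [simp]: "finite colors" and card_colors [simp]: "card colors = 3"
  by (simp_all add: colors_def)

lemma sum_colors: "sum f colors = f 1 + f 2 + f (3::nat)"
  by (simp add: colors_def add.assoc)

definition depends_on :: "'a set \<Rightarrow> (('a \<Rightarrow> 'b) \<Rightarrow> 'c) \<Rightarrow> bool" where
  "depends_on A F \<longleftrightarrow> (\<forall>\<tau> \<tau>'. (\<forall>x\<in>A. \<tau> x = \<tau>' x) \<longrightarrow> F \<tau> = F \<tau>')"

lemma depends_onD: "depends_on A F \<Longrightarrow> (\<And>x. x \<in> A \<Longrightarrow> \<tau> x = \<tau>' x) \<Longrightarrow> F \<tau> = F \<tau>'"
  by (simp add: depends_on_def)

lemma sum_PiE_Un:
  fixes F :: "('a \<Rightarrow> 'b) \<Rightarrow> 'c :: comm_monoid_add"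
  assumes "A \<inter> B = {}"
  shows "(\<Sum>\<tau>\<in>PiE (A \<union> B) (\<lambda>_. C). F \<tau>) = 
    (\<Sum>\<sigma>\<in>PiE A (\<lambda>_. C). \<Sum>\<rho>\<in>PiE B (\<lambda>_. C). F (\<lambda>x. if x \<in> A then \<sigma> x else \<rho> x))"
proof -
  have "(\<Sum>\<tau>\<in>PiE (A \<union> B) (\<lambda>_. C). F \<tau>) =
    (\<Sum>(\<sigma>, \<rho>)\<in>PiE A (\<lambda>_. C) \<times> PiE B (\<lambda>_. C). F (\<lambda>x. if x \<in> A then \<sigma> x else \<rho> x))"
    by (rule sum.reindex_bij_witness[where j = "\<lambda>\<tau>. (restrict \<tau> A, restrict \<tau> B)" 
          and i = "\<lambda>(\<sigma>, \<rho>). (\<lambda>x. if x \<in> A then \<sigma> x else \<rho> x)"])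
       (use assms in \<open>auto simp: fun_eq_iff PiE_def Pi_def extensional_def restrict_def intro!: arg_cong[of _ _ F]\<close>)
  then show ?thesis by (simp add: sum.cartesian_product)
qed

text \<open>The algebraic form of independence of disjoint subtrees: a sum over joint configurations
  of a product factors.\<close>

lemma sum_PiE_UN_prod:
  fixes F :: "'i \<Rightarrow> ('a \<Rightarrow> 'b) \<Rightarrow> 'c :: comm_semiring_1"
  assumes "finite I" and "\<And>i j. i \<in> I \<Longrightarrow> j \<in> I \<Longrightarrow> i \<noteq> j \<Longrightarrow> A i \<inter> A j = {}"
    and "\<And>i. i \<in> I \<Longrightarrow> depends_on (A i) (F i)"
  shows "(\<Sum>\<tau>\<in>PiE (\<Union>i\<in>I. A i) (\<lambda>_. C). \<Prod>i\<in>I. F i \<tau>) = (\<Prod>i\<in>I. \<Sum>\<tau>\<in>PiE (A i) (\<lambda>_. C). F i \<tau>)"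
  using assms
proof (induction I)
  case (insert k I)
  let ?B = "\<Union>i\<in>I. A i"
  have dis: "A k \<inter> ?B = {}" using insert by fast
  have "(\<Sum>\<tau>\<in>PiE (\<Union>i\<in>insert k I. A i) (\<lambda>_. C). \<Prod>i\<in>insert k I. F i \<tau>)
     = (\<Sum>\<sigma>\<in>PiE (A k) (\<lambda>_. C). \<Sum>\<rho>\<in>PiE ?B (\<lambda>_. C). 
        (\<Prod>i\<in>insert k I. F i (\<lambda>x. if x \<in> A k then \<sigma> x else \<rho> x)))"
    using sum_PiE_Un[OF dis, of "\<lambda>\<tau>. \<Prod>i\<in>insert k I. F i \<tau>" C] by simp
  also have "\<dots> = (\<Sum>\<sigma>\<in>PiE (A k) (\<lambda>_. C). \<Sum>\<rho>\<in>PiE ?B (\<lambda>_. C). F k \<sigma> * (\<Prod>i\<in>I. F i \<rho>))"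
  proof (intro sum.cong refl)
    fix \<sigma> \<rho>
    have "F k (\<lambda>x. if x \<in> A k then \<sigma> x else \<rho> x) = F k \<sigma>"
      by (rule depends_onD[OF insert(5)[of k]]) simp_all
    moreover have "F i (\<lambda>x. if x \<in> A k then \<sigma> x else \<rho> x) = F i \<rho>" if "i \<in> I" for i
    proof -
      have "(if x \<in> A k then \<sigma> x else \<rho> x) = \<rho> x" if "x \<in> A i" for x 
        using dis that \<open>i \<in> I\<close> by auto
      with that show ?thesis by (intro depends_onD[OF insert(5)[of i]]) simp_all
    qed
    ultimately show "(\<Prod>i\<in>insert k I. F i (\<lambda>x. if x \<in> A k then \<sigma> x else \<rho> x)) = F k \<sigma> * (\<Prod>i\<in>I. F i \<rho>)"
      using insert(1,2) by simp
  qed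
  also have "\<dots> = (\<Sum>\<sigma>\<in>PiE (A k) (\<lambda>_. C). F k \<sigma>) * (\<Sum>\<rho>\<in>PiE ?B (\<lambda>_. C). \<Prod>i\<in>I. F i \<rho>)"
    by (simp only: sum_product)
  also have "(\<Sum>\<rho>\<in>PiE ?B (\<lambda>_. C). \<Prod>i\<in>I. F i \<rho>) = (\<Prod>i\<in>I. \<Sum>\<tau>\<in>PiE (A i) (\<lambda>_. C). F i \<tau>)"
    using insert by (intro insert.IH) auto
  finally show ?case using insert by simp
qed simp

text \<open>\<open>generation\<close> grows at the leaves, whereas likelihoods recurse at the top.
  This version splits off the children of \<open>v\<close> first; \<open>desc_Suc\<close> reconciles
  the two.\<close>

primrec desc :: "rtree \<Rightarrow> nat \<Rightarrow> nat list \<Rightarrow> nat list set" where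
  "desc t 0 v = {v}"
| "desc t (Suc k) v = (\<Union>i<t v. desc t k (v @ [i]))"

lemma finite_desc [simp]: "finite (desc t k v)"
  by (induction k arbitrary: v) auto

lemma desc_prefix: "w \<in> desc t k v \<Longrightarrow> take (length v) w = v"
proof (induction k arbitrary: v)
  case (Suc k)
  then obtain i where "w \<in> desc t k (v @ [i])" by auto
  from Suc.IH[OF this] have "take (length v + 1) w = v @ [i]" by simp
  then have "take (length v) (take (length v + 1) w) = v" by simp
  then show ?case by (simp add: min_def)
qed simp

lemma desc_disjoint: "i \<noteq> j \<Longrightarrow> desc t k (v @ [i]) \<inter> desc t k (v @ [j]) = {}"
proof -
  assume "i \<noteq> j"
  then have "v @ [i] \<noteq> v @ [j]" by simp
  moreover have "take (length v + 1) w = v @ [i]" if "w \<in> desc t k (v @ [i])" for w i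
    using desc_prefix[OF that] by simp
  ultimately show ?thesis by (metis disjoint_iff)
qed

lemma desc_Suc: "desc t (Suc k) v = {w @ [i] | w i. w \<in> desc t k v \<and> i < t w}"
proof (induction k arbitrary: v)
  case (Suc k)
  have "desc t (Suc (Suc k)) v = (\<Union>j<t v. desc t (Suc k) (v @ [j]))" by (rule desc.simps)
  also have "\<dots> = (\<Union>j<t v. {w @ [i] | w i. w \<in> desc t k (v @ [j]) \<and> i < t w})"
    by (simp only: Suc.IH)
  also have "\<dots> = {w @ [i] | w i. w \<in> desc t (Suc k) v \<and> i < t w}" by auto
  finally show ?case .
qed auto

lemma generation_eq_desc: "generation t n = desc t n []"
proof (induction n)
  case (Suc n)
  then show ?case using desc_Suc[of t n "[]"] by simp
qed simp

text \<open>Probability that the descendants of \<open>v\<close> at distance \<open>k\<close> are colored as in \<open>\<tau>\<close>, given color \<open>a\<close>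
  at \<open>v\<close>; for \<open>elik\<close>, given color \<open>a\<close> at the parent of \<open>v\<close>.\<close>

primrec lik :: "real \<Rightarrow> rtree \<Rightarrow> nat \<Rightarrow> nat list \<Rightarrow> nat \<Rightarrow> (nat list \<Rightarrow> nat) \<Rightarrow> real" where
  "lik p t 0 v a \<tau> = (if \<tau> v = a then 1 else 0)"
| "lik p t (Suc k) v a \<tau> = (\<Prod>i<t v. \<Sum>c\<in>colors. potts_M p a c * lik p t k (v @ [i]) c \<tau>)"

definition elik :: "real \<Rightarrow> rtree \<Rightarrow> nat \<Rightarrow> nat list \<Rightarrow> nat \<Rightarrow> (nat list \<Rightarrow> nat) \<Rightarrow> real" where
  "elik p t k v a \<tau> = (\<Sum>c\<in>colors. potts_M p a c * lik p t k v c \<tau>)"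

lemma lik_Suc: "lik p t (Suc k) v a \<tau> = (\<Prod>i<t v. elik p t k (v @ [i]) a \<tau>)"
  by (simp add: elik_def)

lemma lik_cong: "(\<And>w. w \<in> desc t k v \<Longrightarrow> \<tau> w = \<tau>' w) \<Longrightarrow> lik p t k v a \<tau> = lik p t k v a \<tau>'"
proof (induction k arbitrary: v a)
  case (Suc k)
  have "lik p t k (v @ [i]) c \<tau> = lik p t k (v @ [i]) c \<tau>'" if "i < t v" for i c
    using that by (intro Suc) auto
  then show ?case by simp
qed auto

lemma depends_on_elik: "depends_on (desc t k v) (elik p t k v a)"
  unfolding depends_on_def elik_def by (intro allI impI sum.cong arg_cong2[of _ _ _ _ "(*)"] lik_cong refl) simp

lemma depends_on_mult:
  "depends_on A F \<Longrightarrow> depends_on A G \<Longrightarrow> depends_on A (\<lambda>\<tau>. F \<tau> * G \<tau>)"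
  unfolding depends_on_def by metis

context
  fixes p :: real
  assumes p: "0 \<le> p" "p \<le> 1"
begin

lemma potts_M_nonneg: "0 \<le> potts_M p a c"
  using p by (simp add: potts_M_def)

lemma lik_nonneg: "0 \<le> lik p t k v a \<tau>"
  by (induction k arbitrary: v a) (auto intro!: prod_nonneg sum_nonneg mult_nonneg_nonneg potts_M_nonneg)

end

lemma potts_M_sum_right: "a \<in> colors \<Longrightarrow> (\<Sum>c\<in>colors. potts_M p a c) = 1"
  by (auto simp: colors_def potts_M_def)

lemma sum_PiE_singleton: "(\<Sum>\<tau>\<in>PiE {v} (\<lambda>_. C). f (\<tau> v)) = (\<Sum>c\<in>C. f c)"
  by (rule sum.reindex_bij_witness[where j = "\<lambda>\<tau>. \<tau> v" and i = "\<lambda>c. (\<lambda>x\<in>{v}. c)"])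
     (auto simp: PiE_def extensional_def)

abbreviation configs :: "rtree \<Rightarrow> nat \<Rightarrow> nat list \<Rightarrow> (nat list \<Rightarrow> nat) set" where
  "configs t k v \<equiv> PiE (desc t k v) (\<lambda>_. colors)"

lemma finite_configs [simp]: "finite (configs t k v)"
  by (intro finite_PiE) auto

lemma sum_lik: "a \<in> colors \<Longrightarrow> (\<Sum>\<tau>\<in>configs t k v. lik p t k v a \<tau>) = 1"
proof (induction k arbitrary: v a)
  case 0
  have "(\<Sum>\<tau>\<in>configs t 0 v. lik p t 0 v a \<tau>) = (\<Sum>c\<in>colors. if c = a then 1 else 0)"
    using sum_PiE_singleton[of "\<lambda>c. if c = a then 1 else (0::real)" v colors] by simp
  then show ?case using 0 by simp
next
  case (Suc k)
  have e: "(\<Sum>\<tau>\<in>configs t k (v @ [i]). elik p t k (v @ [i]) a \<tau>) = 1" for i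
  proof -
    have "(\<Sum>\<tau>\<in>configs t k (v @ [i]). elik p t k (v @ [i]) a \<tau>)
       = (\<Sum>c\<in>colors. potts_M p a c * (\<Sum>\<tau>\<in>configs t k (v @ [i]). lik p t k (v @ [i]) c \<tau>))"
      unfolding elik_def sum_distrib_left by (rule sum.swap)
    also have "\<dots> = 1" using Suc potts_M_sum_right[of a p] by simp
    finally show ?thesis .
  qed
  have "(\<Sum>\<tau>\<in>configs t (Suc k) v. lik p t (Suc k) v a \<tau>) 
     = (\<Prod>i<t v. \<Sum>\<tau>\<in>configs t k (v @ [i]). elik p t k (v @ [i]) a \<tau>)"
    unfolding lik_Suc desc.simps
    by (intro sum_PiE_UN_prod depends_on_elik desc_disjoint) auto
  then show ?case by (simp add: e)
qed

lemma sum_elik: "a \<in> colors \<Longrightarrow> (\<Sum>\<tau>\<in>configs t k v. elik p t k v a \<tau>) = 1"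
proof -
  assume a: "a \<in> colors"
  have "(\<Sum>\<tau>\<in>configs t k v. elik p t k v a \<tau>) = (\<Sum>c\<in>colors. potts_M p a c * (\<Sum>\<tau>\<in>configs t k v. lik p t k v c \<tau>))"
    unfolding elik_def sum_distrib_left by (rule sum.swap)
  then show ?thesis using a potts_M_sum_right[of a p] by (simp add: sum_lik)
qed

text \<open>The subtrees other than that of \<open>j\<close> contribute factors \<open>1\<close>,
  since \<open>elik\<close> sums to one over each of them.\<close>

lemma sum_lik_marginal:
  assumes "a \<in> colors" "j < t v" "depends_on (desc t k (v @ [j])) h"
  shows "(\<Sum>\<tau>\<in>configs t (Suc k) v. lik p t (Suc k) v a \<tau> * h \<tau>)
     = (\<Sum>\<tau>\<in>configs t k (v @ [j]). elik p t k (v @ [j]) a \<tau> * h \<tau>)"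
proof -
  define F where "F i \<tau> = elik p t k (v @ [i]) a \<tau> * (if i = j then h \<tau> else 1)" for i \<tau>
  have "(\<Sum>\<tau>\<in>configs t (Suc k) v. lik p t (Suc k) v a \<tau> * h \<tau>) = (\<Sum>\<tau>\<in>configs t (Suc k) v. \<Prod>i<t v. F i \<tau>)"
    using assms(2) unfolding F_def lik_Suc prod.distrib by (simp add: prod.delta)
  also have "\<dots> = (\<Prod>i<t v. \<Sum>\<tau>\<in>configs t k (v @ [i]). F i \<tau>)"
    unfolding desc.simps
  proof (intro sum_PiE_UN_prod desc_disjoint)
    show "depends_on (desc t k (v @ [i])) (F i)" for i
    proof (cases "i = j")
      case True
      then show ?thesis using depends_on_mult[OF depends_on_elik assms(3), of p a] by (simp add: F_def[abs_def])
    next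
      case False
      then show ?thesis using depends_on_elik by (simp add: F_def[abs_def])
    qed
  qed auto
  also have "\<dots> = (\<Prod>i<t v. if i = j then \<Sum>\<tau>\<in>configs t k (v @ [j]). elik p t k (v @ [j]) a \<tau> * h \<tau> else 1)"
    using assms(1) by (intro prod.cong) (auto simp: F_def sum_elik)
  also have "\<dots> = (\<Sum>\<tau>\<in>configs t k (v @ [j]). elik p t k (v @ [j]) a \<tau> * h \<tau>)"
    using assms(2) by (simp add: prod.delta)
  finally show ?thesis .
qed

section \<open>Color symmetry\<close>

lemma lik_permute_colors:
  assumes \<pi>: "bij_betw \<pi> colors colors"
  shows "a \<in> colors \<Longrightarrow> (\<And>w. w \<in> desc t k v \<Longrightarrow> \<tau> w \<in> colors) \<Longrightarrow> 
     lik p t k v (\<pi> a) (\<lambda>w. \<pi> (\<tau> w)) = lik p t k v a \<tau>"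
proof (induction k arbitrary: v a)
  case 0
  then show ?case using \<pi> by (auto simp: bij_betw_def inj_on_def)
next
  case (Suc k)
  have M: "potts_M p (\<pi> a) (\<pi> c) = potts_M p a c" if "c \<in> colors" for c
    using \<pi> Suc(2) that by (auto simp: potts_M_def bij_betw_def inj_on_def)
  have "(\<Sum>c\<in>colors. potts_M p (\<pi> a) c * lik p t k (v @ [i]) c (\<lambda>w. \<pi> (\<tau> w)))
      = (\<Sum>c\<in>colors. potts_M p a c * lik p t k (v @ [i]) c \<tau>)" if "i < t v" for i
  proof -
    have "(\<Sum>c\<in>colors. potts_M p (\<pi> a) c * lik p t k (v @ [i]) c (\<lambda>w. \<pi> (\<tau> w)))
      = (\<Sum>c\<in>colors. potts_M p (\<pi> a) (\<pi> c) * lik p t k (v @ [i]) (\<pi> c) (\<lambda>w. \<pi> (\<tau> w)))"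
      by (rule sum.reindex_bij_betw[OF \<pi>, symmetric])
    also have "\<dots> = (\<Sum>c\<in>colors. potts_M p a c * lik p t k (v @ [i]) c \<tau>)"
      using that Suc.prems by (intro sum.cong refl arg_cong2[of _ _ _ _ "(*)"] M Suc.IH) auto
    finally show ?thesis .
  qed
  then show ?case by simp
qed

text \<open>\<open>potts_M\<close> only distinguishes equal from unequal colors. A permutation of
  the root colors is therefore undone by permuting the leaf colors, which is a bijection of the
  configurations.\<close>

lemma sum_lik_permute_colors:
  assumes \<pi>: "bij_betw \<pi> colors colors"
  shows "(\<Sum>\<tau>\<in>configs t k v. \<phi> (lik p t k v (\<pi> 1) \<tau>) (lik p t k v (\<pi> 2) \<tau>) (lik p t k v (\<pi> 3) \<tau>))
       = (\<Sum>\<tau>\<in>configs t k v. \<phi> (lik p t k v 1 \<tau>) (lik p t k v 2 \<tau>) (lik p t k v 3 \<tau>))"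
proof -
  let ?D = "desc t k v"
  define \<pi>' where "\<pi>' = inv_into colors \<pi>"
  have \<pi>': "\<pi>' c \<in> colors" "\<pi> (\<pi>' c) = c" if "c \<in> colors" for c
    using \<pi> that by (auto simp: \<pi>'_def bij_betw_def f_inv_into_f inv_into_into)
  have \<pi>'': "\<pi> c \<in> colors" "\<pi>' (\<pi> c) = c" if "c \<in> colors" for c
    using \<pi> that by (auto simp: \<pi>'_def bij_betw_def)
  have lik: "lik p t k v (\<pi> a) (\<lambda>w\<in>?D. \<pi> (\<tau> w)) = lik p t k v a \<tau>" if "\<tau> \<in> configs t k v" "a \<in> colors" for \<tau> a
  proof -
    have "lik p t k v (\<pi> a) (\<lambda>w\<in>?D. \<pi> (\<tau> w)) = lik p t k v (\<pi> a) (\<lambda>w. \<pi> (\<tau> w))"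
      by (rule lik_cong) simp
    also have "\<dots> = lik p t k v a \<tau>" using that by (intro lik_permute_colors \<pi>) auto
    finally show ?thesis .
  qed
  have lik': "lik p t k v (\<pi> a) \<tau> = lik p t k v a (\<lambda>w\<in>?D. \<pi>' (\<tau> w))" if "\<tau> \<in> configs t k v" "a \<in> colors" for \<tau> a
  proof -
    have "(\<lambda>w\<in>?D. \<pi>' (\<tau> w)) \<in> configs t k v" using that \<pi>'(1) by auto
    from lik[OF this that(2)] show ?thesis
    proof (rule trans[rotated])
      show "lik p t k v (\<pi> a) \<tau> = lik p t k v (\<pi> a) (\<lambda>w\<in>?D. \<pi> ((\<lambda>w\<in>?D. \<pi>' (\<tau> w)) w))"
        using PiE_mem[OF that(1)] \<pi>'(2) by (intro lik_cong) simp
    qed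
  qed
  have c: "1 \<in> colors" "2 \<in> colors" "3 \<in> colors" by (simp_all add: colors_def)
  show ?thesis
  proof (rule sum.reindex_bij_witness[where j = "\<lambda>\<tau>. (\<lambda>w\<in>?D. \<pi>' (\<tau> w))" and i = "\<lambda>\<tau>. (\<lambda>w\<in>?D. \<pi> (\<tau> w))"])
    fix \<tau> assume \<tau>: "\<tau> \<in> configs t k v"
    show "(\<lambda>w\<in>?D. \<pi> ((\<lambda>w\<in>?D. \<pi>' (\<tau> w)) w)) = \<tau>" "(\<lambda>w\<in>?D. \<pi>' ((\<lambda>w\<in>?D. \<pi> (\<tau> w)) w)) = \<tau>"
      using \<tau> \<pi>' \<pi>'' by (auto simp: PiE_def Pi_def extensional_def fun_eq_iff)
    show "(\<lambda>w\<in>?D. \<pi>' (\<tau> w)) \<in> configs t k v" "(\<lambda>w\<in>?D. \<pi> (\<tau> w)) \<in> configs t k v"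
      using \<tau> \<pi>'(1) \<pi>''(1) by auto
    show "\<phi> (lik p t k v 1 (\<lambda>w\<in>?D. \<pi>' (\<tau> w))) (lik p t k v 2 (\<lambda>w\<in>?D. \<pi>' (\<tau> w))) (lik p t k v 3 (\<lambda>w\<in>?D. \<pi>' (\<tau> w)))
      = \<phi> (lik p t k v (\<pi> 1) \<tau>) (lik p t k v (\<pi> 2) \<tau>) (lik p t k v (\<pi> 3) \<tau>)"
      by (simp only: lik'[OF \<tau> c(1)] lik'[OF \<tau> c(2)] lik'[OF \<tau> c(3)])
  qed
qed

section \<open>The level law in terms of likelihoods\<close>

lemma expectation_bind_pmf:
  fixes f :: "'a \<Rightarrow> real"
  assumes "\<And>x. 0 \<le> f x" "\<And>x. f x \<le> 1"
  shows "measure_pmf.expectation (bind_pmf M N) f = measure_pmf.expectation M (\<lambda>x. measure_pmf.expectation (N x) f)"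
proof -
  have int: "integrable (measure_pmf P) f" for P
    using assms by (intro measure_pmf.integrable_const_bound[where B = 1]) auto
  have "measure_pmf.expectation (bind_pmf M N) f = enn2real (\<integral>\<^sup>+x. ennreal (f x) \<partial>bind_pmf M N)"
    using assms by (intro integral_eq_nn_integral) auto
  also have "(\<integral>\<^sup>+x. ennreal (f x) \<partial>bind_pmf M N) = (\<integral>\<^sup>+x. ennreal (measure_pmf.expectation (N x) f) \<partial>M)"
    using assms by (simp add: nn_integral_eq_integral[OF int])
  also have "enn2real \<dots> = measure_pmf.expectation M (\<lambda>x. measure_pmf.expectation (N x) f)"
    using assms by (intro integral_eq_nn_integral[symmetric]) (auto intro!: Bochner_Integration.integral_nonneg)
  finally show ?thesis .
qed

lemma generation_Suc_conv: "w \<in> generation t (Suc n) \<longleftrightarrow> w \<noteq> [] \<and> butlast w \<in> generation t n \<and> last w < t (butlast w)"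
  by (cases w rule: rev_cases) auto

lemma Nil_in_generation: "[] \<in> generation t n \<longleftrightarrow> n = 0"
  by (cases n) auto

lemma prod_generation_Suc:
  "(\<Prod>w\<in>generation t (Suc n). f w) = (\<Prod>v\<in>generation t n. \<Prod>i<t v. f (v @ [i]))"
proof -
  have "(\<Prod>v\<in>generation t n. \<Prod>i<t v. f (v @ [i])) = (\<Prod>(v, i)\<in>Sigma (generation t n) (\<lambda>v. {..<t v}). f (v @ [i]))"
    by (rule prod.Sigma) (auto simp: finite_generation)
  also have "\<dots> = (\<Prod>w\<in>generation t (Suc n). f w)"
    by (rule prod.reindex_bij_witness[where i = "\<lambda>w. (butlast w, last w)" and j = "\<lambda>(v, i). v @ [i]"]) auto
  finally show ?thesis by simp
qed

context
  fixes p :: real and t :: rtree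
  assumes p: "0 \<le> p" "p \<le> 1"
begin

lemma set_potts_row: "a \<in> colors \<Longrightarrow> set_pmf (potts_row p a) \<subseteq> colors"
  using pmf_potts_row[OF p] by (auto simp: set_pmf_iff split: if_splits)

lemma broadcast_colors: "\<sigma> \<in> set_pmf (broadcast p t n) \<Longrightarrow> v \<in> generation t n \<Longrightarrow> \<sigma> v \<in> colors"
proof (induction n arbitrary: \<sigma> v)
  case 0
  then show ?case by (auto simp: colors_def)
next
  case (Suc n)
  from Suc.prems(1) obtain \<sigma>' \<tau> where \<sigma>': "\<sigma>' \<in> set_pmf (broadcast p t n)"
    and \<tau>: "\<tau> \<in> set_pmf (Pi_pmf (generation t (Suc n)) undefined (\<lambda>v. potts_row p (\<sigma>' (butlast v))))"
    and \<sigma>: "\<sigma> = override_on \<sigma>' \<tau> (generation t (Suc n))"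
    by (auto simp del: generation.simps)
  have "\<tau> v \<in> set_pmf (potts_row p (\<sigma>' (butlast v)))"
    using \<tau> Suc.prems(2) by (simp add: set_Pi_pmf finite_generation PiE_dflt_def del: generation.simps)
  moreover have "\<sigma>' (butlast v) \<in> colors"
    using Suc.IH[OF \<sigma>'] Suc.prems(2) by (simp add: generation_Suc_conv del: generation.simps)
  ultimately have "\<tau> v \<in> colors" using set_potts_row by blast
  then show ?case using \<sigma> Suc.prems(2) by (simp del: generation.simps)
qed

lemma lik_le_1: "a \<in> colors \<Longrightarrow> lik p t k v a \<tau> \<le> 1"
proof (induction k arbitrary: v a)
  case (Suc k)
  have "(\<Sum>c\<in>colors. potts_M p a c * lik p t k w c \<tau>) \<le> 1" if "\<forall>c\<in>colors. lik p t k w c \<tau> \<le> 1" for w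
  proof -
    have "(\<Sum>c\<in>colors. potts_M p a c * lik p t k w c \<tau>) \<le> (\<Sum>c\<in>colors. potts_M p a c * 1)"
      using that p by (intro sum_mono mult_left_mono) (auto simp: potts_M_nonneg)
    then show ?thesis using potts_M_sum_right[OF Suc.prems, of p] by simp
  qed
  then show ?case unfolding lik.simps using Suc.IH p
    by (intro prod_le_1) (auto intro!: sum_nonneg mult_nonneg_nonneg potts_M_nonneg lik_nonneg)
qed auto

lemma expectation_potts_row:
  "a \<in> colors \<Longrightarrow> measure_pmf.expectation (potts_row p a) f = (\<Sum>c\<in>colors. potts_M p a c * f c)" for f :: "nat \<Rightarrow> real"
  using set_potts_row[of a]
  by (subst integral_measure_pmf_real[of colors]) (auto simp: pmf_potts_row[OF p] mult.commute intro!: sum.cong)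

text \<open>Integrates out the last generation: given its parents, its colors are independent, and
  averaging a likelihood over one edge gives \<open>elik\<close>. The guard with \<open>0\<close>
  keeps the integrand in the unit interval everywhere, because \<open>potts_M\<close> rows outside
  \<open>colors\<close> need not sum to one.\<close>

lemma expectation_broadcast_Suc:
  fixes g :: "nat \<Rightarrow> real"
  assumes g: "\<And>a. 0 \<le> g a" "\<And>a. g a \<le> 1"
  shows "measure_pmf.expectation (broadcast p t (Suc m)) 
      (\<lambda>\<sigma>. g (\<sigma> []) * (\<Prod>w\<in>generation t (Suc m). if \<sigma> w \<in> colors then lik p t k w (\<sigma> w) \<tau> else 0))
    = measure_pmf.expectation (broadcast p t m) 
      (\<lambda>\<sigma>. g (\<sigma> []) * (\<Prod>v\<in>generation t m. if \<sigma> v \<in> colors then lik p t (Suc k) v (\<sigma> v) \<tau> else 0))"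
proof -
  let ?G = "generation t (Suc m)"
  define F where "F \<sigma> = g (\<sigma> []) * (\<Prod>w\<in>?G. if \<sigma> w \<in> colors then lik p t k w (\<sigma> w) \<tau> else 0)" for \<sigma>
  have bounds: "0 \<le> (if c \<in> colors then lik p t k w c \<tau> else 0)" "(if c \<in> colors then lik p t k w c \<tau> else 0) \<le> 1" for c w
    using lik_nonneg[OF p] lik_le_1 by auto
  have "0 \<le> F \<sigma>" "F \<sigma> \<le> 1" for \<sigma>
  proof -
    show "0 \<le> F \<sigma>" unfolding F_def using g bounds by (intro mult_nonneg_nonneg prod_nonneg) auto
    have "F \<sigma> \<le> 1 * 1" unfolding F_def using g bounds by (intro mult_mono prod_le_1 prod_nonneg) auto
    then show "F \<sigma> \<le> 1" by simp
  qed
  then have "measure_pmf.expectation (broadcast p t (Suc m)) F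
    = measure_pmf.expectation (broadcast p t m) (\<lambda>\<sigma>. measure_pmf.expectation 
        (map_pmf (\<lambda>\<tau>. override_on \<sigma> \<tau> ?G) (Pi_pmf ?G undefined (\<lambda>v. potts_row p (\<sigma> (butlast v))))) F)"
    unfolding broadcast.simps by (intro expectation_bind_pmf)
  also have "\<dots> = measure_pmf.expectation (broadcast p t m) 
      (\<lambda>\<sigma>. g (\<sigma> []) * (\<Prod>v\<in>generation t m. if \<sigma> v \<in> colors then lik p t (Suc k) v (\<sigma> v) \<tau> else 0))"
  proof (intro integral_cong_AE)
    show "AE \<sigma> in measure_pmf (broadcast p t m). 
       measure_pmf.expectation (map_pmf (\<lambda>\<tau>. override_on \<sigma> \<tau> ?G) (Pi_pmf ?G undefined (\<lambda>v. potts_row p (\<sigma> (butlast v))))) F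
        = g (\<sigma> []) * (\<Prod>v\<in>generation t m. if \<sigma> v \<in> colors then lik p t (Suc k) v (\<sigma> v) \<tau> else 0)"
      unfolding AE_measure_pmf_iff
    proof
      fix \<sigma> assume \<sigma>: "\<sigma> \<in> set_pmf (broadcast p t m)"
      have "F (override_on \<sigma> \<rho> ?G) = g (\<sigma> []) * (\<Prod>w\<in>?G. if \<rho> w \<in> colors then lik p t k w (\<rho> w) \<tau> else 0)" for \<rho>
      proof -
        have "override_on \<sigma> \<rho> ?G [] = \<sigma> []" using Nil_in_generation[of t "Suc m"] by simp
        moreover have "(\<Prod>w\<in>?G. if override_on \<sigma> \<rho> ?G w \<in> colors then lik p t k w (override_on \<sigma> \<rho> ?G w) \<tau> else 0)
          = (\<Prod>w\<in>?G. if \<rho> w \<in> colors then lik p t k w (\<rho> w) \<tau> else 0)"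
          by (intro prod.cong refl) (simp only: override_on_apply_in)
        ultimately show ?thesis unfolding F_def by simp
      qed
      then have "measure_pmf.expectation (map_pmf (\<lambda>\<tau>. override_on \<sigma> \<tau> ?G) (Pi_pmf ?G undefined (\<lambda>v. potts_row p (\<sigma> (butlast v))))) F
         = g (\<sigma> []) * measure_pmf.expectation (Pi_pmf ?G undefined (\<lambda>v. potts_row p (\<sigma> (butlast v)))) 
            (\<lambda>\<rho>. \<Prod>w\<in>?G. (\<lambda>c. if c \<in> colors then lik p t k w c \<tau> else 0) (\<rho> w))"
        by (simp del: generation.simps)
      also have "measure_pmf.expectation (Pi_pmf ?G undefined (\<lambda>v. potts_row p (\<sigma> (butlast v)))) 
            (\<lambda>\<rho>. \<Prod>w\<in>?G. (\<lambda>c. if c \<in> colors then lik p t k w c \<tau> else 0) (\<rho> w))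
         = (\<Prod>w\<in>?G. measure_pmf.expectation (potts_row p (\<sigma> (butlast w))) (\<lambda>c. if c \<in> colors then lik p t k w c \<tau> else 0))"
        using bounds by (intro expectation_prod_Pi_pmf finite_generation measure_pmf.integrable_const_bound[where B = 1]) auto
      also have "\<dots> = (\<Prod>w\<in>?G. elik p t k w (\<sigma> (butlast w)) \<tau>)"
      proof (intro prod.cong refl)
        fix w assume "w \<in> ?G"
        then have "\<sigma> (butlast w) \<in> colors"
          using broadcast_colors[OF \<sigma>] by (simp add: generation_Suc_conv del: generation.simps)
        then show "measure_pmf.expectation (potts_row p (\<sigma> (butlast w))) (\<lambda>c. if c \<in> colors then lik p t k w c \<tau> else 0)
           = elik p t k w (\<sigma> (butlast w)) \<tau>"
          by (simp add: expectation_potts_row elik_def)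
      qed
      also have "\<dots> = (\<Prod>v\<in>generation t m. lik p t (Suc k) v (\<sigma> v) \<tau>)"
        unfolding prod_generation_Suc lik_Suc by simp
      also have "\<dots> = (\<Prod>v\<in>generation t m. if \<sigma> v \<in> colors then lik p t (Suc k) v (\<sigma> v) \<tau> else 0)"
        using broadcast_colors[OF \<sigma>] by (intro prod.cong refl) simp
      finally show "measure_pmf.expectation (map_pmf (\<lambda>\<tau>. override_on \<sigma> \<tau> ?G) (Pi_pmf ?G undefined (\<lambda>v. potts_row p (\<sigma> (butlast v))))) F
        = g (\<sigma> []) * (\<Prod>v\<in>generation t m. if \<sigma> v \<in> colors then lik p t (Suc k) v (\<sigma> v) \<tau> else 0)" .
    qed
  qed auto
  finally show ?thesis unfolding F_def .
qed

text \<open>Interpolates between simulation and likelihood: each induction step moves one generation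
  from \<open>broadcast\<close> into \<open>lik\<close>, leaving \<open>n + k\<close> fixed. The
  divisor \<open>3\<close> is the uniform root color.\<close>

lemma expectation_broadcast:
  fixes g :: "nat \<Rightarrow> real"
  assumes g: "\<And>a. 0 \<le> g a" "\<And>a. g a \<le> 1"
  shows "measure_pmf.expectation (broadcast p t n) 
      (\<lambda>\<sigma>. g (\<sigma> []) * (\<Prod>w\<in>generation t n. if \<sigma> w \<in> colors then lik p t k w (\<sigma> w) \<tau> else 0))
    = (\<Sum>a\<in>colors. g a * lik p t (n + k) [] a \<tau>) / 3"
proof (induction n arbitrary: k)
  case 0
  have "colors \<noteq> {}" by (simp add: colors_def)
  then show ?case by (simp add: integral_pmf_of_set)
next
  case (Suc n)
  show ?case
    using trans[OF expectation_broadcast_Suc[OF g] Suc.IH[of "Suc k"]] by (simp only: add_Suc_shift)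
qed

lemma pmf_level_law_config:
  assumes a: "a \<in> colors" and \<tau>: "\<tau> \<in> configs t n []"
  shows "pmf (level_law p t a n) \<tau> = lik p t n [] a \<tau>"
proof -
  let ?B = "broadcast p t n" and ?G = "generation t n"
  have ne: "set_pmf ?B \<inter> {\<sigma>. \<sigma> [] = a} \<noteq> {}" by (rule root_color_possible[OF a])
  have root: "measure ?B {\<sigma>. \<sigma> [] = a} = 1/3"
  proof -
    have "measure ?B {\<sigma>. \<sigma> [] = a} = pmf (map_pmf (\<lambda>\<sigma>. \<sigma> []) ?B) a"
      by (simp add: pmf_map vimage_def)
    also have "\<dots> = 1/3" using a unfolding map_broadcast_root by (simp add: colors_def)
    finally show ?thesis .
  qed
  have \<tau>c: "\<tau> w \<in> colors" if "w \<in> ?G" for w using \<tau> that by (auto simp: generation_eq_desc)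
  have \<tau>u: "\<tau> w = undefined" if "w \<notin> ?G" for w using \<tau> that by (auto simp: generation_eq_desc)
  have "pmf (level_law p t a n) \<tau> = measure (cond_pmf ?B {\<sigma>. \<sigma> [] = a}) ((\<lambda>\<sigma>. restrict \<sigma> ?G) -` {\<tau>})"
    by (simp add: level_law_def pmf_map)
  also have "\<dots> = measure ?B ({\<sigma>. \<sigma> [] = a} \<inter> (\<lambda>\<sigma>. restrict \<sigma> ?G) -` {\<tau>}) / measure ?B {\<sigma>. \<sigma> [] = a}"
    using measure_measure_pmf_not_zero[OF ne]
    by (simp add: cond_pmf.rep_eq[OF ne] measure_uniform_measure emeasure_measure_pmf_not_zero[OF ne] 
      measure_pmf.emeasure_eq_measure)
  also have "measure ?B ({\<sigma>. \<sigma> [] = a} \<inter> (\<lambda>\<sigma>. restrict \<sigma> ?G) -` {\<tau>})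
    = measure_pmf.expectation ?B (indicator ({\<sigma>. \<sigma> [] = a} \<inter> (\<lambda>\<sigma>. restrict \<sigma> ?G) -` {\<tau>}))"
    by simp
  \<comment> \<open>With remaining depth \<open>0\<close> each likelihood is an indicator, so the
    product tests whether the whole generation agrees with \<open>\<tau>\<close>.\<close>
  also have "\<dots> = measure_pmf.expectation ?B (\<lambda>\<sigma>. (if \<sigma> [] = a then 1 else 0) 
      * (\<Prod>w\<in>?G. if \<sigma> w \<in> colors then lik p t 0 w (\<sigma> w) \<tau> else 0))"
  proof (intro arg_cong[of _ _ "measure_pmf.expectation ?B"] ext)
    fix \<sigma> :: "nat list \<Rightarrow> nat"
    have "restrict \<sigma> ?G = \<tau> \<longleftrightarrow> (\<forall>w\<in>?G. \<sigma> w = \<tau> w)"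
      using \<tau>u by (auto simp: fun_eq_iff restrict_def)
    moreover have "(\<Prod>w\<in>?G. if \<sigma> w \<in> colors then lik p t 0 w (\<sigma> w) \<tau> else 0) 
       = (if \<forall>w\<in>?G. \<sigma> w = \<tau> w then 1 else (0::real))"
    proof (cases "\<forall>w\<in>?G. \<sigma> w = \<tau> w")
      case True
      then have "(\<Prod>w\<in>?G. if \<sigma> w \<in> colors then lik p t 0 w (\<sigma> w) \<tau> else 0) = (\<Prod>w\<in>?G. 1)"
        using \<tau>c by (intro prod.cong) auto
      with True show ?thesis by simp
    next
      case False
      then show ?thesis by (auto simp: prod_zero_iff finite_generation intro!: bexI)
    qed
    ultimately show "indicator ({\<sigma>. \<sigma> [] = a} \<inter> (\<lambda>\<sigma>. restrict \<sigma> ?G) -` {\<tau>}) \<sigma> = (if \<sigma> [] = a then 1 else 0) 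
      * (\<Prod>w\<in>?G. if \<sigma> w \<in> colors then lik p t 0 w (\<sigma> w) \<tau> else (0::real))"
      by (simp add: indicator_def)
  qed
  also have "\<dots> = (\<Sum>c\<in>colors. (if c = a then 1 else 0) * lik p t (n + 0) [] c \<tau>) / 3"
    by (rule expectation_broadcast) simp_all
  also have "\<dots> = lik p t n [] a \<tau> / 3" using a by (simp add: if_distrib[of "\<lambda>x. x * _"] sum.delta cong: if_cong)
  finally show ?thesis unfolding root by simp
qed

text \<open>The likelihoods on \<open>configs\<close> already sum to one, so no mass is left
  elsewhere.\<close>

lemma pmf_level_law_outside:
  assumes a: "a \<in> colors" and \<tau>: "\<tau> \<notin> configs t n []"
  shows "pmf (level_law p t a n) \<tau> = 0"
proof -
  have "measure (level_law p t a n) (configs t n []) = (\<Sum>\<tau>\<in>configs t n []. lik p t n [] a \<tau>)"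
    by (simp add: measure_measure_pmf_finite pmf_level_law_config[OF a])
  also have "\<dots> = 1" by (rule sum_lik[OF a])
  finally have "set_pmf (level_law p t a n) \<subseteq> configs t n []"
    by (simp add: measure_pmf.prob_eq_1 AE_measure_pmf_iff subset_iff)
  then show ?thesis using \<tau> by (auto simp: set_pmf_iff)
qed

lemma d_TV_level_law:
  assumes "a \<in> colors" "b \<in> colors"
  shows "d_TV (level_law p t a n) (level_law p t b n) 
     = (\<Sum>\<tau>\<in>configs t n []. \<bar>lik p t n [] a \<tau> - lik p t n [] b \<tau>\<bar>) / 2"
proof -
  have "(\<Sum>\<^sub>\<infinity>\<sigma>. \<bar>pmf (level_law p t a n) \<sigma> - pmf (level_law p t b n) \<sigma>\<bar>)
      = (\<Sum>\<^sub>\<infinity>\<sigma>\<in>configs t n []. \<bar>pmf (level_law p t a n) \<sigma> - pmf (level_law p t b n) \<sigma>\<bar>)"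
    by (rule infsum_cong_neutral) (simp_all add: pmf_level_law_outside assms)
  also have "\<dots> = (\<Sum>\<tau>\<in>configs t n []. \<bar>lik p t n [] a \<tau> - lik p t n [] b \<tau>\<bar>)"
    by (simp add: pmf_level_law_config assms)
  finally show ?thesis by (simp add: d_TV_def)
qed

end

section \<open>Recursion for the symmetrized divergence\<close>

lemma elik_eq:
  assumes "a \<in> colors"
  shows "elik p t k v a \<tau> = (1 - (1 - 3*p/2)) * ((lik p t k v 1 \<tau> + lik p t k v 2 \<tau> + lik p t k v 3 \<tau>)/3) 
     + (1 - 3*p/2) * lik p t k v a \<tau>"
  using assms unfolding elik_def sum_colors
  by (auto simp: colors_def potts_M_def field_simps)

definition J_lik :: "real \<Rightarrow> rtree \<Rightarrow> nat \<Rightarrow> nat list \<Rightarrow> real" where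
  "J_lik p t k v = (\<Sum>\<tau>\<in>configs t k v. J_div (lik p t k v 1 \<tau>) (lik p t k v 2 \<tau>) (lik p t k v 3 \<tau>))"

definition J_elik :: "real \<Rightarrow> rtree \<Rightarrow> nat \<Rightarrow> nat list \<Rightarrow> real" where
  "J_elik p t k v = (\<Sum>\<tau>\<in>configs t k v. J_div (elik p t k v 1 \<tau>) (elik p t k v 2 \<tau>) (elik p t k v 3 \<tau>))"

context
  fixes p :: real and t :: rtree
  assumes p: "0 < p" "p < 1"
begin

text \<open>After one edge all probabilities are positive. At depth \<open>0\<close> the likelihood
  \<open>lik\<close> itself is an indicator and its logarithm meaningless, so the divergence
  recursion starts from \<open>J_elik\<close> at depth \<open>0\<close>.\<close>

lemma elik_pos: "a \<in> colors \<Longrightarrow> \<tau> \<in> configs t k v \<Longrightarrow> 0 < elik p t k v a \<tau>"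
proof (induction k arbitrary: v a \<tau>)
  case 0
  then have "\<tau> v \<in> colors" by auto
  then have "elik p t 0 v a \<tau> = potts_M p a (\<tau> v)"
    unfolding elik_def sum_colors by (auto simp: colors_def)
  then show ?case using p by (simp add: potts_M_def)
next
  case (Suc k)
  have "0 < lik p t (Suc k) v c \<tau>" if "c \<in> colors" for c
    unfolding lik_Suc
  proof (intro prod_pos ballI)
    fix i assume i: "i \<in> {..<t v}"
    let ?\<tau> = "restrict \<tau> (desc t k (v @ [i]))"
    have "?\<tau> \<in> configs t k (v @ [i])" using Suc.prems(2) i by (auto simp: PiE_def Pi_def)
    then have "0 < elik p t k (v @ [i]) c ?\<tau>" by (intro Suc.IH that)
    also have "elik p t k (v @ [i]) c ?\<tau> = elik p t k (v @ [i]) c \<tau>"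
      by (rule depends_onD[OF depends_on_elik]) simp
    finally show "0 < elik p t k (v @ [i]) c \<tau>" .
  qed
  then show ?case unfolding elik_def using p
    by (intro sum_pos mult_pos_pos) (auto simp: potts_M_def colors_def)
qed

lemma lik_pos:
  assumes "a \<in> colors" "\<tau> \<in> configs t (Suc k) v"
  shows "0 < lik p t (Suc k) v a \<tau>"
  unfolding lik_Suc
proof (intro prod_pos ballI)
  fix i assume i: "i \<in> {..<t v}"
  let ?\<tau> = "restrict \<tau> (desc t k (v @ [i]))"
  have "?\<tau> \<in> configs t k (v @ [i])" using assms(2) i by (auto simp: PiE_def Pi_def)
  then have "0 < elik p t k (v @ [i]) a ?\<tau>" by (intro elik_pos assms)
  also have "elik p t k (v @ [i]) a ?\<tau> = elik p t k (v @ [i]) a \<tau>"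
    by (rule depends_onD[OF depends_on_elik]) simp
  finally show "0 < elik p t k (v @ [i]) a \<tau>" .
qed

text \<open>The log-likelihood ratio is a sum over the children whose \<open>i\<close>-th term
  depends on the \<open>i\<close>-th subtree only; against it, \<open>lik\<close> can be replaced by
  its marginal on that subtree.\<close>

lemma sum_log_ratio_Suc:
  assumes "a \<in> colors" "b \<in> colors"
  shows "(\<Sum>\<tau>\<in>configs t (Suc k) v. (lik p t (Suc k) v a \<tau> - lik p t (Suc k) v b \<tau>) 
        * (ln (lik p t (Suc k) v a \<tau>) - ln (lik p t (Suc k) v b \<tau>)))
    = (\<Sum>i<t v. \<Sum>\<tau>\<in>configs t k (v @ [i]). (elik p t k (v @ [i]) a \<tau> - elik p t k (v @ [i]) b \<tau>) 
        * (ln (elik p t k (v @ [i]) a \<tau>) - ln (elik p t k (v @ [i]) b \<tau>)))"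
proof -
  define h where "h i \<tau> = ln (elik p t k (v @ [i]) a \<tau>) - ln (elik p t k (v @ [i]) b \<tau>)" for i \<tau>
  have h: "depends_on (desc t k (v @ [i])) (h i)" for i
    unfolding depends_on_def h_def using depends_onD[OF depends_on_elik] by metis
  have pos: "0 < elik p t k (v @ [i]) c \<tau>" if "\<tau> \<in> configs t (Suc k) v" "i < t v" "c \<in> colors" for c \<tau> i
  proof -
    let ?\<tau> = "restrict \<tau> (desc t k (v @ [i]))"
    have "?\<tau> \<in> configs t k (v @ [i])" using that by (auto simp: PiE_def Pi_def)
    then have "0 < elik p t k (v @ [i]) c ?\<tau>" by (intro elik_pos that)
    also have "elik p t k (v @ [i]) c ?\<tau> = elik p t k (v @ [i]) c \<tau>"
      by (rule depends_onD[OF depends_on_elik]) simp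
    finally show ?thesis .
  qed
  have "(\<Sum>\<tau>\<in>configs t (Suc k) v. (lik p t (Suc k) v a \<tau> - lik p t (Suc k) v b \<tau>) 
        * (ln (lik p t (Suc k) v a \<tau>) - ln (lik p t (Suc k) v b \<tau>)))
    = (\<Sum>\<tau>\<in>configs t (Suc k) v. \<Sum>i<t v. lik p t (Suc k) v a \<tau> * h i \<tau> - lik p t (Suc k) v b \<tau> * h i \<tau>)"
  proof (intro sum.cong refl)
    fix \<tau> assume \<tau>: "\<tau> \<in> configs t (Suc k) v"
    have ln: "ln (lik p t (Suc k) v c \<tau>) = (\<Sum>i<t v. ln (elik p t k (v @ [i]) c \<tau>))" if "c \<in> colors" for c
      unfolding lik_Suc
    proof (rule ln_prod)
      show "elik p t k (v @ [i]) c \<tau> \<noteq> 0" if "i \<in> {..<t v}" for i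
        using pos[OF \<tau> _ \<open>c \<in> colors\<close>, of i] that by simp
    qed simp
    show "(lik p t (Suc k) v a \<tau> - lik p t (Suc k) v b \<tau>) * (ln (lik p t (Suc k) v a \<tau>) - ln (lik p t (Suc k) v b \<tau>))
      = (\<Sum>i<t v. lik p t (Suc k) v a \<tau> * h i \<tau> - lik p t (Suc k) v b \<tau> * h i \<tau>)"
      unfolding ln[OF assms(1)] ln[OF assms(2)] h_def
      by (simp only: sum_subtractf[symmetric] sum_distrib_left left_diff_distrib)
  qed
  also have "\<dots> = (\<Sum>i<t v. (\<Sum>\<tau>\<in>configs t (Suc k) v. lik p t (Suc k) v a \<tau> * h i \<tau>) 
      - (\<Sum>\<tau>\<in>configs t (Suc k) v. lik p t (Suc k) v b \<tau> * h i \<tau>))"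
    by (subst sum.swap) (simp only: sum_subtractf)
  also have "\<dots> = (\<Sum>i<t v. (\<Sum>\<tau>\<in>configs t k (v @ [i]). elik p t k (v @ [i]) a \<tau> * h i \<tau>) 
      - (\<Sum>\<tau>\<in>configs t k (v @ [i]). elik p t k (v @ [i]) b \<tau> * h i \<tau>))"
    by (intro sum.cong refl arg_cong2[of _ _ _ _ "(-)"] sum_lik_marginal assms h) simp_all
  also have "\<dots> = (\<Sum>i<t v. \<Sum>\<tau>\<in>configs t k (v @ [i]). (elik p t k (v @ [i]) a \<tau> - elik p t k (v @ [i]) b \<tau>) * h i \<tau>)"
    by (simp only: sum_subtractf[symmetric] left_diff_distrib)
  finally show ?thesis unfolding h_def .
qed

lemma J_lik_Suc: "J_lik p t (Suc k) v = (\<Sum>i<t v. J_elik p t k (v @ [i]))"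
proof -
  have c: "1 \<in> colors" "2 \<in> colors" "3 \<in> colors" by (simp_all add: colors_def)
  show ?thesis unfolding J_lik_def J_elik_def J_div_def sum.distrib
    by (simp only: sum_log_ratio_Suc[OF c(1) c(2)] sum_log_ratio_Suc[OF c(1) c(3)] sum_log_ratio_Suc[OF c(2) c(3)])
qed

lemma J_elik_contraction:
  assumes "contracts m c" "0 < 1 - 3*p/2" "1 - 3*p/2 \<le> m"
  shows "J_elik p t (Suc k) v \<le> c * J_lik p t (Suc k) v"
proof -
  have c: "1 \<in> colors" "2 \<in> colors" "3 \<in> colors" by (simp_all add: colors_def)
  show ?thesis
    unfolding J_elik_def J_lik_def sum_distrib_left elik_eq[OF c(1)] elik_eq[OF c(2)] elik_eq[OF c(3)]
    by (intro sum_mono J_div_contraction[OF assms] lik_pos c)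
qed

lemma J_elik_0: "J_elik p t 0 v = (\<Sum>c\<in>colors. J_div (potts_M p 1 c) (potts_M p 2 c) (potts_M p 3 c))"
proof -
  have "elik p t 0 v a \<tau> = potts_M p a (\<tau> v)" if "\<tau> \<in> configs t 0 v" for a \<tau>
  proof -
    have "\<tau> v \<in> colors" using that by auto
    then show ?thesis unfolding elik_def sum_colors by (auto simp: colors_def)
  qed
  then have "J_elik p t 0 v = (\<Sum>\<tau>\<in>configs t 0 v. J_div (potts_M p 1 (\<tau> v)) (potts_M p 2 (\<tau> v)) (potts_M p 3 (\<tau> v)))"
    unfolding J_elik_def by (intro sum.cong) auto
  then show ?thesis
    using sum_PiE_singleton[of "\<lambda>c. J_div (potts_M p 1 c) (potts_M p 2 c) (potts_M p 3 c)" v colors] by simp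
qed

text \<open>Holds for every fixed tree: each of the \<open>k\<close> contractions gives a factor
  \<open>c\<close>, and each descendant at distance \<open>k\<close> contributes the divergence
  \<open>C\<close> of a single edge.\<close>

lemma J_elik_le:
  assumes "contracts m c" "0 < 1 - 3*p/2" "1 - 3*p/2 \<le> m"
  defines "C \<equiv> \<Sum>c\<in>colors. J_div (potts_M p 1 c) (potts_M p 2 c) (potts_M p 3 c)"
  shows "J_elik p t k v \<le> c^k * C * card (desc t k v)"
proof (induction k arbitrary: v)
  case 0
  then show ?case using J_elik_0 by (simp add: C_def)
next
  case (Suc k)
  have c: "c \<ge> 0" using assms(1) by (auto simp: contracts_def intro: order_trans[OF zero_le_power2])
  have "J_elik p t (Suc k) v \<le> c * (\<Sum>i<t v. J_elik p t k (v @ [i]))"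
    using J_elik_contraction[OF assms(1-3)] by (simp add: J_lik_Suc)
  also have "\<dots> \<le> c * (\<Sum>i<t v. c^k * C * card (desc t k (v @ [i])))"
    using c by (intro mult_left_mono sum_mono Suc) auto
  also have "\<dots> = c^Suc k * C * (\<Sum>i<t v. card (desc t k (v @ [i])))"
    by (simp add: sum_distrib_left mult.assoc)
  also have "(\<Sum>i<t v. card (desc t k (v @ [i]))) = card (desc t (Suc k) v)"
    using desc_disjoint[of _ _ t k v] by (simp add: card_UN_disjoint)
  finally show ?case .
qed

lemma d_TV_le_J_lik:
  assumes "a \<in> colors" "b \<in> colors" "e > 0"
  shows "d_TV (level_law p t a (Suc n)) (level_law p t b (Suc n)) \<le> e + J_lik p t (Suc n) [] / (2*e)"
proof -
  let ?L = "lik p t (Suc n) []" and ?K = "configs t (Suc n) []"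
  have p': "0 \<le> p" "p \<le> 1" using p by auto
  have "(\<Sum>\<tau>\<in>?K. \<bar>?L a \<tau> - ?L b \<tau>\<bar>) \<le> (\<Sum>\<tau>\<in>?K. e * (?L a \<tau> + ?L b \<tau>) + J_div (?L 1 \<tau>) (?L 2 \<tau>) (?L 3 \<tau>) / e)"
  proof (rule sum_mono)
    fix \<tau> assume \<tau>: "\<tau> \<in> ?K"
    have pos: "0 < ?L c \<tau>" if "c \<in> colors" for c by (rule lik_pos[OF that \<tau>])
    have nonneg: "0 \<le> (?L c \<tau> - ?L d \<tau>) * (ln (?L c \<tau>) - ln (?L d \<tau>))" if "c \<in> colors" "d \<in> colors" for c d
      by (rule order_trans[OF _ diff_ln_diff_ge[OF pos pos]]) (use pos[of c] pos[of d] that in auto)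
    have "(?L a \<tau> - ?L b \<tau>)^2 / (?L a \<tau> + ?L b \<tau>) \<le> (?L a \<tau> - ?L b \<tau>) * (ln (?L a \<tau>) - ln (?L b \<tau>))"
      by (intro diff_ln_diff_ge pos assms)
    also have "\<dots> \<le> J_div (?L 1 \<tau>) (?L 2 \<tau>) (?L 3 \<tau>)"
    proof -
      have c: "1 \<in> colors" "2 \<in> colors" "3 \<in> colors" by (simp_all add: colors_def)
      note n = nonneg[OF c(1) c(2)] nonneg[OF c(1) c(3)] nonneg[OF c(2) c(3)]
      have sym: "(x - y) * (ln x - ln y) = (y - x) * (ln y - ln x)" for x y :: real by (simp add: algebra_simps)
      consider "a = b" | "{a, b} = {1, 2}" | "{a, b} = {1, 3}" | "{a, b} = {2, 3}"
        using assms(1,2) by (auto simp: colors_def)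
      then show ?thesis
      proof cases
        case 1
        then show ?thesis using n unfolding J_div_def by simp
      qed (use n sym[of "?L a \<tau>" "?L b \<tau>"] in \<open>auto simp: J_div_def doubleton_eq_iff\<close>)
    qed
    finally have "(?L a \<tau> - ?L b \<tau>)^2 / (?L a \<tau> + ?L b \<tau>) / e \<le> J_div (?L 1 \<tau>) (?L 2 \<tau>) (?L 3 \<tau>) / e"
      using assms by (intro divide_right_mono) auto
    moreover have "\<bar>?L a \<tau> - ?L b \<tau>\<bar> \<le> e * (?L a \<tau> + ?L b \<tau>) + (?L a \<tau> - ?L b \<tau>)^2 / (?L a \<tau> + ?L b \<tau>) / e"
      using pos assms by (intro abs_diff_le_eps) (auto intro: less_imp_le)
    ultimately show "\<bar>?L a \<tau> - ?L b \<tau>\<bar> \<le> e * (?L a \<tau> + ?L b \<tau>) + J_div (?L 1 \<tau>) (?L 2 \<tau>) (?L 3 \<tau>) / e"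
      by linarith
  qed
  also have "\<dots> = e * ((\<Sum>\<tau>\<in>?K. ?L a \<tau>) + (\<Sum>\<tau>\<in>?K. ?L b \<tau>)) + J_lik p t (Suc n) [] / e"
    unfolding J_lik_def by (simp only: sum.distrib sum_distrib_left[symmetric] sum_divide_distrib[symmetric])
  also have "\<dots> = 2*e + J_lik p t (Suc n) [] / e" by (simp only: sum_lik[OF assms(1)] sum_lik[OF assms(2)]) simp
  finally show ?thesis unfolding d_TV_level_law[OF p' assms(1,2)] by (simp add: field_simps)
qed

lemma d_TV_le_generation:
  assumes "contracts m c" "0 < 1 - 3*p/2" "1 - 3*p/2 \<le> m" "a \<in> colors" "b \<in> colors" "e > 0"
  defines "C \<equiv> \<Sum>c\<in>colors. J_div (potts_M p 1 c) (potts_M p 2 c) (potts_M p 3 c)"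
  shows "d_TV (level_law p t a (Suc n)) (level_law p t b (Suc n)) \<le> e + c^n * C * card (generation t (Suc n)) / (2*e)"
proof -
  have "J_lik p t (Suc n) [] \<le> (\<Sum>i<t []. c^n * C * card (desc t n ([] @ [i])))"
    unfolding J_lik_Suc C_def by (intro sum_mono J_elik_le[OF assms(1-3)])
  also have "\<dots> = c^n * C * (\<Sum>i<t []. card (desc t n ([] @ [i])))" by (simp add: sum_distrib_left)
  also have "(\<Sum>i<t []. card (desc t n ([] @ [i]))) = card (generation t (Suc n))"
    unfolding generation_eq_desc using desc_disjoint[of _ _ t n "[]"] by (simp add: card_UN_disjoint)
  finally have "J_lik p t (Suc n) [] / (2*e) \<le> c^n * C * card (generation t (Suc n)) / (2*e)"
    using assms(6) by (intro divide_right_mono) auto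
  with d_TV_le_J_lik[OF assms(4-6), of n] show ?thesis by linarith
qed

end

section \<open>Generation sizes\<close>

lemma generation_iff: "w \<in> generation t n \<longleftrightarrow> length w = n \<and> (\<forall>j<n. w ! j < t (take j w))"
proof (induction n arbitrary: w)
  case (Suc n)
  show ?case
  proof (cases w rule: rev_cases)
    case (snoc v i)
    have "(\<forall>j<n. (v @ [i]) ! j < t (take j (v @ [i]))) \<longleftrightarrow> (\<forall>j<n. v ! j < t (take j v))" if "length v = n"
      using that by (simp add: nth_append)
    then show ?thesis using Suc[of v] unfolding generation_Suc_conv snoc
      by (auto simp: less_Suc_eq)
  qed (auto simp: generation_Suc_conv)
qed auto

definition words :: "nat \<Rightarrow> nat \<Rightarrow> nat list set" where
  "words N n = {w. length w = n \<and> set w \<subseteq> {..<N}}"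

lemma finite_words [simp]: "finite (words N n)"
  unfolding words_def using finite_lists_length_eq[of "{..<N}" n] by (simp add: conj_commute)

lemma sum_words_prod: "(\<Sum>w\<in>words N n. \<Prod>j<n. q (w ! j)) = (\<Sum>i<N. q i :: real)^n"
proof (induction n)
  case 0
  have "words N 0 = {[]}" by (auto simp: words_def)
  then show ?case by simp
next
  case (Suc n)
  have "(\<Sum>w\<in>words N (Suc n). \<Prod>j<Suc n. q (w ! j)) = (\<Sum>(i, w)\<in>{..<N} \<times> words N n. q i * (\<Prod>j<n. q (w ! j)))"
  proof (rule sum.reindex_bij_witness[where i = "\<lambda>(i, w). i # w" and j = "\<lambda>w. (hd w, tl w)"])
    fix w assume w: "w \<in> words N (Suc n)"
    then obtain x xs where xs: "w = x # xs" by (cases w) (auto simp: words_def)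
    show "(case (hd w, tl w) of (i, w) \<Rightarrow> q i * (\<Prod>j<n. q (w ! j))) = (\<Prod>j<Suc n. q (w ! j))"
      unfolding xs prod.lessThan_Suc_shift by simp
    show "(hd w, tl w) \<in> {..<N} \<times> words N n" "(case (hd w, tl w) of (i, w) \<Rightarrow> i # w) = w"
      using w xs by (auto simp: words_def)
  qed (auto simp: words_def)
  also have "\<dots> = (\<Sum>i<N. q i) * (\<Sum>w\<in>words N n. \<Prod>j<n. q (w ! j))"
    by (simp add: sum.cartesian_product[symmetric] sum_product)
  finally show ?case using Suc by simp
qed

lemma prob_space_gw_tree: "prob_space (gw_tree d)"
  unfolding gw_tree_def by (intro prob_space_PiM) (rule measure_pmf.prob_space_axioms)

lemma AE_gw_tree_offspring: "AE t in gw_tree d. \<forall>v. t v \<in> set_pmf d"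
proof -
  interpret product_prob_space "\<lambda>_ :: nat list. measure_pmf d" UNIV by unfold_locales
  show ?thesis unfolding gw_tree_def AE_all_countable
    by (intro allI AE_component) (auto simp: AE_measure_pmf)
qed

text \<open>Membership of a word constrains the offspring numbers at its proper prefixes, which are
  distinct vertices and hence independent.\<close>

lemma prob_in_generation:
  assumes "length w = n"
  shows "measure (gw_tree d) {t \<in> space (gw_tree d). w \<in> generation t n} = (\<Prod>j<n. measure d {w ! j<..})"
proof -
  interpret product_prob_space "\<lambda>_ :: nat list. measure_pmf d" UNIV by unfold_locales
  define J where "J = (\<lambda>j. take j w) ` {..<n}"
  define X where "X u = {w ! length u<..}" for u :: "nat list"
  have inj: "inj_on (\<lambda>j. take j w) {..<n}"
  proof (rule inj_onI)
    fix i j assume "i \<in> {..<n}" "j \<in> {..<n}" "take i w = take j w"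
    then show "i = j" using assms by (metis length_take lessThan_iff less_imp_le min_absorb2)
  qed
  have finite_J: "finite J" by (simp add: J_def)
  have "{t \<in> space (gw_tree d). w \<in> generation t n} = {t \<in> space (gw_tree d). \<forall>u\<in>J. t u \<in> X u}"
    using assms by (auto simp: generation_iff J_def X_def)
  then have "emeasure (gw_tree d) {t \<in> space (gw_tree d). w \<in> generation t n} = (\<Prod>u\<in>J. emeasure d (X u))"
    unfolding gw_tree_def using emeasure_PiM_Collect[of J X] by (simp add: finite_J)
  also have "\<dots> = (\<Prod>j<n. emeasure d {w ! j<..})"
    unfolding J_def using inj assms by (simp add: prod.reindex X_def)
  also have "\<dots> = ennreal (\<Prod>j<n. measure d {w ! j<..})"
    by (simp add: measure_pmf.emeasure_eq_measure prod_ennreal)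
  finally show ?thesis by (simp add: measure_def prod_nonneg)
qed

text \<open>A sum of indicators over a fixed finite set of words, convenient for integration. It
  equals the size of the generation when no offspring number exceeds \<open>N\<close>.\<close>

definition gen_size :: "nat \<Rightarrow> nat \<Rightarrow> rtree \<Rightarrow> real" where
  "gen_size N n t = (\<Sum>w\<in>words N n. if w \<in> generation t n then 1 else 0)"

lemma card_generation_eq:
  assumes "\<And>v. t v \<le> N"
  shows "real (card (generation t n)) = gen_size N n t"
proof -
  have "generation t n \<subseteq> words N n"
  proof
    fix w assume w: "w \<in> generation t n"
    then have "w ! j < N" if "j < n" for j
      using assms[of "take j w"] that by (auto simp: generation_iff intro: less_le_trans)
    then show "w \<in> words N n" using w by (auto simp: words_def generation_iff in_set_conv_nth)
  qed
  then have "words N n \<inter> {w. w \<in> generation t n} = generation t n" by auto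
  then show ?thesis unfolding gen_size_def by (simp add: sum.If_cases)
qed

text \<open>The base of the power is the tail-sum formula for the mean offspring number, truncated
  at \<open>N\<close>.\<close>

lemma gen_size_integral:
  "integrable (gw_tree d) (gen_size N n)"
  "(\<integral>t. gen_size N n t \<partial>gw_tree d) = (\<Sum>i<N. measure d {i<..})^n"
proof -
  interpret prob_space "gw_tree d" by (rule prob_space_gw_tree)
  have e: "(if w \<in> generation t n then 1 else 0) = indicator {t \<in> space (gw_tree d). w \<in> generation t n} t"
    if "t \<in> space (gw_tree d)" for w t
    using that by (simp add: indicator_def)
  have m: "{t \<in> space (gw_tree d). w \<in> generation t n} \<in> sets (gw_tree d)" for w
    using generation_pred_measurable[where d = d and v = w and n = n] by simp
  have int: "integrable (gw_tree d) (\<lambda>t. if w \<in> generation t n then 1 else 0 :: real)" for w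
    using m by (subst Bochner_Integration.integrable_cong[OF refl e]) (auto simp: emeasure_eq_measure)
  show "integrable (gw_tree d) (gen_size N n)"
    unfolding gen_size_def[abs_def] by (intro Bochner_Integration.integrable_sum int)
  have "(\<integral>t. gen_size N n t \<partial>gw_tree d) = (\<Sum>w\<in>words N n. \<integral>t. (if w \<in> generation t n then 1 else 0) \<partial>gw_tree d)"
    unfolding gen_size_def by (intro Bochner_Integration.integral_sum int)
  also have "\<dots> = (\<Sum>w\<in>words N n. measure (gw_tree d) {t \<in> space (gw_tree d). w \<in> generation t n})"
    using m by (intro sum.cong refl, subst Bochner_Integration.integral_cong[OF refl e]) auto
  also have "\<dots> = (\<Sum>w\<in>words N n. \<Prod>j<n. measure d {w ! j<..})"
    by (intro sum.cong refl prob_in_generation) (simp add: words_def)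
  also have "\<dots> = (\<Sum>i<N. measure d {i<..})^n" by (rule sum_words_prod)
  finally show "(\<integral>t. gen_size N n t \<partial>gw_tree d) = (\<Sum>i<N. measure d {i<..})^n" .
qed

lemma integrable_d_TV: "integrable (gw_tree d) (\<lambda>t. d_TV (level_law p t a n) (level_law p t b n))"
proof -
  interpret prob_space "gw_tree d" by (rule prob_space_gw_tree)
  show ?thesis
    by (intro integrable_const_bound[where B = 1] d_TV_level_law_measurable AE_I2)
       (simp add: d_TV_bounds)
qed

lemma non_reconstruction_contraction:
  fixes d :: "nat pmf"
  assumes c: "contracts m c" and p: "0 < 1 - 3*p/2" "1 - 3*p/2 \<le> m"
    and N: "set_pmf d \<subseteq> {..N}" and q: "0 < (\<Sum>i<N. measure d {i<..})" "c * (\<Sum>i<N. measure d {i<..}) < 1"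
  shows "non_reconstruction d p"
  unfolding non_reconstruction_def
proof (intro ballI)
  fix a b assume ab: "a \<in> colors" "b \<in> colors"
  interpret prob_space "gw_tree d" by (rule prob_space_gw_tree)
  let ?TV = "\<lambda>n t. d_TV (level_law p t a n) (level_law p t b n)"
  define q where "q = (\<Sum>i<N. measure d {i<..})"
  have l: "1 - 3*p/2 < 1" "0 < (1 - 3*p/2)^2" using c p by (auto simp: contracts_def)
  have p01: "0 < p" "p < 1" using l(1) p by auto
  have c0: "0 < c" using c unfolding contracts_def by (metis less_le_trans zero_less_power)
  define C where "C = (\<Sum>c\<in>colors. J_div (potts_M p 1 c) (potts_M p 2 c) (potts_M p 3 c))"
  \<comment> \<open>With \<open>e = r^n\<close> the two terms of the total variation bound balance:
    \<open>(c*q)^n / r^n\<close> is again \<open>r^n\<close>.\<close>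
  define r where "r = sqrt (c * q)"
  have cq: "0 < c * q" "c * q < 1" using q c0 by (auto simp: q_def)
  then have r: "0 < r" "r < 1" "r^2 = c * q" by (auto simp: r_def)
  have bound: "(\<integral>t. ?TV (Suc n) t \<partial>gw_tree d) \<le> (1 + C * q / 2) * r^n" for n
  proof -
    have e: "0 < r^n" using r by simp
    have "(\<integral>t. ?TV (Suc n) t \<partial>gw_tree d) \<le> (\<integral>t. r^n + c^n * C / (2 * r^n) * gen_size N (Suc n) t \<partial>gw_tree d)"
    proof (rule integral_mono_AE)
      show "AE t in gw_tree d. ?TV (Suc n) t \<le> r^n + c^n * C / (2 * r^n) * gen_size N (Suc n) t"
        using AE_gw_tree_offspring[of d]
      proof eventually_elim
        case (elim t)
        then have "t v \<le> N" for v using N by auto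
        from card_generation_eq[OF this, where n = "Suc n"] 
          d_TV_le_generation[OF p01 c p ab e, of t n]
        show ?case by (simp add: C_def)
      qed
    qed (intro integrable_d_TV Bochner_Integration.integrable_add integrable_const integrable_mult_right gen_size_integral)+
    also have "\<dots> = r^n + c^n * C / (2 * r^n) * q^Suc n"
      using gen_size_integral[of d N "Suc n"] by (simp add: q_def prob_space)
    also have "\<dots> = r^n + (c*q)^n / r^n * (C * q / 2)" by (simp add: power_mult_distrib mult_ac)
    also have "(c*q)^n / r^n = r^n"
      unfolding r(3)[symmetric] using r(1) by (simp add: power2_eq_square power_mult_distrib)
    finally show ?thesis by (simp add: algebra_simps)
  qed
  have "(\<lambda>n. \<integral>t. ?TV (Suc n) t \<partial>gw_tree d) \<longlonglongrightarrow> 0"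
  proof (rule tendsto_sandwich[where f = "\<lambda>_. 0" and h = "\<lambda>n. (1 + C * q / 2) * r^n"])
    show "(\<lambda>n. (1 + C * q / 2) * r^n) \<longlonglongrightarrow> 0"
      using r by (intro tendsto_mult_right_zero LIMSEQ_power_zero) auto
    show "\<forall>\<^sub>F n in sequentially. 0 \<le> (\<integral>t. ?TV (Suc n) t \<partial>gw_tree d)"
      by (intro always_eventually allI Bochner_Integration.integral_nonneg d_TV_bounds)
  qed (use bound in auto)
  then show "(\<lambda>n. \<integral>t. ?TV n t \<partial>gw_tree d) \<longlonglongrightarrow> 0"
    by (rule LIMSEQ_imp_Suc)
qed

lemma binary_ternary_offspring:
  fixes d :: "nat pmf"
  assumes "pmf d 2 + pmf d 3 = 1"
  shows "set_pmf d \<subseteq> {2, 3}" "(\<Sum>i<3. measure d {i<..}) = 2 + pmf d 3"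
proof -
  have "measure d {2, 3} = 1" using assms by (simp add: measure_measure_pmf_finite)
  then show s: "set_pmf d \<subseteq> {2, 3}" by (simp add: measure_pmf.prob_eq_1 AE_measure_pmf_iff subset_iff)
  have "measure d {i<..} = 1" if "i < 2" for i
  proof -
    have "AE x in d. x \<in> {i<..}" using s that by (auto simp: AE_measure_pmf_iff)
    then show ?thesis by (simp add: measure_pmf.prob_eq_1)
  qed
  moreover have "measure d {2<..} = pmf d 3"
  proof -
    have "measure d {2<..} = measure d {3}"
      using s by (intro measure_pmf.finite_measure_eq_AE) (auto simp: AE_measure_pmf_iff)
    then show ?thesis by (simp add: pmf.rep_eq)
  qed
  ultimately show "(\<Sum>i<3. measure d {i<..}) = 2 + pmf d 3" by (simp add: eval_nat_numeral)
qed

text \<open>Common form of the three cases with positive \<lambda>: the mean offspring number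
  \<open>2 + pmf d 3\<close> is 2, 3 or 5/2.\<close>

lemma non_reconstruction_binary_ternary:
  assumes "pmf d 2 + pmf d 3 = 1" "contracts m c" "c * (2 + pmf d 3) < 1" "0 < 1 - 3*p/2" "1 - 3*p/2 \<le> m"
  shows "non_reconstruction d p"
proof (rule non_reconstruction_contraction[OF assms(2,4,5), where N = 3])
  note b = binary_ternary_offspring[OF assms(1)]
  show "set_pmf d \<subseteq> {..3}" using b(1) by auto
  show "0 < (\<Sum>i<3. measure d {i<..})" unfolding b(2) by (simp add: add_pos_nonneg)
  show "c * (\<Sum>i<3. measure d {i<..}) < 1" unfolding b(2) by (rule assms(3))
qed

section \<open>Proper colorings of the ternary tree\<close>

text \<open>Proper colorings are the case \<open>p = 1\<close>.\<close>

definition coloring_sum :: "rtree \<Rightarrow> nat \<Rightarrow> nat list \<Rightarrow> (real \<Rightarrow> real \<Rightarrow> real \<Rightarrow> real) \<Rightarrow> real" where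
  "coloring_sum t k v \<phi> = (\<Sum>\<tau>\<in>configs t k v. \<phi> (lik 1 t k v 1 \<tau>) (lik 1 t k v 2 \<tau>) (lik 1 t k v 3 \<tau>))"

lemma coloring_sum_add: "coloring_sum t k v (\<lambda>x y z. f x y z + g x y z) = coloring_sum t k v f + coloring_sum t k v g"
  by (simp add: coloring_sum_def sum.distrib)

lemma coloring_sum_cmult: "coloring_sum t k v (\<lambda>x y z. s * f x y z) = s * coloring_sum t k v f"
  by (simp add: coloring_sum_def sum_distrib_left)

lemma coloring_sum_mono:
  assumes "\<And>x y z. 0 \<le> x \<Longrightarrow> 0 \<le> y \<Longrightarrow> 0 \<le> z \<Longrightarrow> f x y z \<le> g x y z"
  shows "coloring_sum t k v f \<le> coloring_sum t k v g"
  unfolding coloring_sum_def by (intro sum_mono assms lik_nonneg) auto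

lemma coloring_sum_linear: "coloring_sum t k v (\<lambda>x y z. a * x + b * y + c * z) = a + b + c"
proof -
  have c: "1 \<in> colors" "2 \<in> colors" "3 \<in> colors" by (simp_all add: colors_def)
  show ?thesis unfolding coloring_sum_def sum.distrib sum_distrib_left[symmetric]
    by (simp only: sum_lik[OF c(1)] sum_lik[OF c(2)] sum_lik[OF c(3)] mult_1_right)
qed

lemma coloring_sum_chi_nonneg: "0 \<le> coloring_sum t k v chi"
  unfolding coloring_sum_def by (intro sum_nonneg chi_nonneg lik_nonneg) auto

lemma coloring_sum_linear_add:
  "coloring_sum t k v (\<lambda>x y z. (a * x + b * y + c * z) + s * f x y z) = a + b + c + s * coloring_sum t k v f"
  by (simp only: coloring_sum_add[of t k v "\<lambda>x y z. a * x + b * y + c * z" "\<lambda>x y z. s * f x y z"]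
      coloring_sum_linear coloring_sum_cmult)

lemma coloring_sum_combination:
  "coloring_sum t k v (\<lambda>x y z. r * f x y z + s * g x y z) = r * coloring_sum t k v f + s * coloring_sum t k v g"
  by (simp only: coloring_sum_add[of t k v "\<lambda>x y z. r * f x y z" "\<lambda>x y z. s * g x y z"] coloring_sum_cmult)

text \<open>Two transpositions generate all six permutations, and each leaves the sum unchanged by
  color symmetry.\<close>

lemma coloring_sum_perm_sum: "coloring_sum t k v \<phi> = coloring_sum t k v (perm_sum \<phi>) / 6"
proof -
  define s where "s = (\<lambda>c::nat. if c = 1 then 2 else if c = 2 then 1 else c)"
  define u where "u = (\<lambda>c::nat. if c = 2 then 3 else if c = 3 then 2 else c)"
  have bij: "bij_betw s colors colors" "bij_betw u colors colors"
    by (rule bij_betw_byWitness[where f' = s]; auto simp: s_def colors_def)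
       (rule bij_betw_byWitness[where f' = u]; auto simp: u_def colors_def)
  have s: "coloring_sum t k v (\<lambda>x y z. \<psi> y x z) = coloring_sum t k v \<psi>" for \<psi>
    using sum_lik_permute_colors[OF bij(1), of \<psi> 1 t k v] by (simp add: coloring_sum_def s_def)
  have u: "coloring_sum t k v (\<lambda>x y z. \<psi> x z y) = coloring_sum t k v \<psi>" for \<psi>
    using sum_lik_permute_colors[OF bij(2), of \<psi> 1 t k v] by (simp add: coloring_sum_def u_def)
  have "coloring_sum t k v (\<lambda>x y z. \<phi> x z y) = coloring_sum t k v \<phi>" by (rule u)
  moreover have "coloring_sum t k v (\<lambda>x y z. \<phi> y x z) = coloring_sum t k v \<phi>" by (rule s)
  moreover have "coloring_sum t k v (\<lambda>x y z. \<phi> y z x) = coloring_sum t k v \<phi>"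
    using u[of "\<lambda>x y z. \<phi> z y x"] s[of "\<lambda>x y z. \<phi> y x z"] u[of "\<lambda>x y z. \<phi> y x z"] s[of "\<lambda>x y z. \<phi> x z y"] u[of \<phi>] by simp
  moreover have "coloring_sum t k v (\<lambda>x y z. \<phi> z x y) = coloring_sum t k v \<phi>"
    using u[of "\<lambda>x y z. \<phi> y x z"] s[of \<phi>] by simp
  moreover have "coloring_sum t k v (\<lambda>x y z. \<phi> z y x) = coloring_sum t k v \<phi>"
    using s[of "\<lambda>x y z. \<phi> z x y"] u[of "\<lambda>x y z. \<phi> y x z"] s[of \<phi>] by simp
  ultimately show ?thesis unfolding perm_sum_def coloring_sum_add by simp
qed

lemma elik_coloring:
  "elik 1 t k v 1 \<tau> = (lik 1 t k v 2 \<tau> + lik 1 t k v 3 \<tau>) / 2"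
  "elik 1 t k v 2 \<tau> = (lik 1 t k v 1 \<tau> + lik 1 t k v 3 \<tau>) / 2"
  "elik 1 t k v 3 \<tau> = (lik 1 t k v 1 \<tau> + lik 1 t k v 2 \<tau>) / 2"
  by (simp_all add: elik_def sum_colors potts_M_def add_divide_distrib)

lemma coloring_sum_Suc:
  assumes "t v = 3"
  shows "coloring_sum t (Suc k) v \<phi> = 
    coloring_sum t k (v @ [0]) (\<lambda>x y z. coloring_sum t k (v @ [1]) (\<lambda>x' y' z'. coloring_sum t k (v @ [2]) (\<lambda>x'' y'' z''.
      \<phi> ((y+z)/2 * ((y'+z')/2) * (y''+z'')/2) ((x+z)/2 * ((x'+z')/2) * (x''+z'')/2) ((x+y)/2 * ((x'+y')/2) * (x''+y'')/2))))"
proof -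
  let ?D = "\<lambda>i. desc t k (v @ [i])"
  let ?m = "\<lambda>\<sigma> \<rho> \<rho>'. (\<lambda>x. if x \<in> ?D 0 then \<sigma> x else if x \<in> ?D 1 then \<rho> x else \<rho>' x)"
  have three: "{..<3} = {0, 1, 2::nat}" by auto
  have desc: "desc t (Suc k) v = ?D 0 \<union> (?D 1 \<union> ?D 2)" using assms by (simp add: three)
  have dis: "?D 0 \<inter> (?D 1 \<union> ?D 2) = {}" "?D 1 \<inter> ?D 2 = {}" "?D 0 \<inter> ?D 1 = {}" "?D 0 \<inter> ?D 2 = {}"
    using desc_disjoint[of 0 1 t k v] desc_disjoint[of 0 2 t k v] desc_disjoint[of 1 2 t k v] by auto
  have lik: "lik 1 t (Suc k) v a (?m \<sigma> \<rho> \<rho>') = elik 1 t k (v @ [0]) a \<sigma> * elik 1 t k (v @ [1]) a \<rho> * elik 1 t k (v @ [2]) a \<rho>'"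
    for a \<sigma> \<rho> \<rho>'
  proof -
    have "elik 1 t k (v @ [0]) a (?m \<sigma> \<rho> \<rho>') = elik 1 t k (v @ [0]) a \<sigma>"
      by (rule depends_onD[OF depends_on_elik]) simp
    moreover have "elik 1 t k (v @ [1]) a (?m \<sigma> \<rho> \<rho>') = elik 1 t k (v @ [1]) a \<rho>"
      using dis(3) by (intro depends_onD[OF depends_on_elik]) auto
    moreover have "elik 1 t k (v @ [2]) a (?m \<sigma> \<rho> \<rho>') = elik 1 t k (v @ [2]) a \<rho>'"
      using dis(2,4) by (intro depends_onD[OF depends_on_elik]) auto
    ultimately show ?thesis unfolding lik_Suc assms three by (simp add: mult.assoc)
  qed
  have "coloring_sum t (Suc k) v \<phi> = (\<Sum>\<sigma>\<in>configs t k (v @ [0]). \<Sum>\<rho>\<in>configs t k (v @ [1]). \<Sum>\<rho>'\<in>configs t k (v @ [2]).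
     \<phi> (lik 1 t (Suc k) v 1 (?m \<sigma> \<rho> \<rho>')) (lik 1 t (Suc k) v 2 (?m \<sigma> \<rho> \<rho>')) (lik 1 t (Suc k) v 3 (?m \<sigma> \<rho> \<rho>')))"
    unfolding coloring_sum_def desc sum_PiE_Un[OF dis(1)] sum_PiE_Un[OF dis(2)] ..
  then show ?thesis unfolding lik elik_coloring coloring_sum_def by simp
qed

lemma chi_edge: "chi ((y+z)/2) ((x+z)/2) ((x+y)/2) = chi x y z / 4"
proof (cases "x + y + z = 0")
  case True
  have "(y+z)/2 + (x+z)/2 + (x+y)/2 = 0" using True by (simp add: field_simps)
  then show ?thesis using True by (simp add: chi_def)
next
  case False
  have e: "(y+z)/2 + (x+z)/2 + (x+y)/2 = x + y + z" by (simp add: field_simps)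
  show ?thesis unfolding chi_def e using False
    by (simp add: field_simps power2_eq_square)
qed

text \<open>Division by six turns the mass term into \<open>chi a b c\<close>, since the three
  likelihoods each sum to one, and turns \<open>3/2\<close> into \<open>1/4\<close>: what enters is
  the information of the child after its edge.\<close>

lemma coloring_sum_average_le:
  assumes "\<And>x y z. 0 \<le> x \<Longrightarrow> 0 \<le> y \<Longrightarrow> 0 \<le> z \<Longrightarrow>
    perm_sum (\<lambda>p q r. chi (a*(q+r)/2) (b*(p+r)/2) (c*(p+q)/2)) x y z
        \<le> 2 * (x+y+z) * chi a b c + 3/2 * chi x y z * K"
  shows "coloring_sum t k v (\<lambda>p q r. chi (a*(q+r)/2) (b*(p+r)/2) (c*(p+q)/2)) 
     \<le> chi a b c + coloring_sum t k v chi / 4 * K"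
proof -
  have "coloring_sum t k v (\<lambda>p q r. chi (a*(q+r)/2) (b*(p+r)/2) (c*(p+q)/2))
     = coloring_sum t k v (perm_sum (\<lambda>p q r. chi (a*(q+r)/2) (b*(p+r)/2) (c*(p+q)/2))) / 6"
    by (rule coloring_sum_perm_sum)
  also have "\<dots> \<le> coloring_sum t k v (\<lambda>x y z. (2 * chi a b c * x + 2 * chi a b c * y + 2 * chi a b c * z) + 3/2*K * chi x y z) / 6"
    using assms by (intro divide_right_mono coloring_sum_mono) (simp_all add: algebra_simps)
  also have "\<dots> = chi a b c + coloring_sum t k v chi / 4 * K"
    unfolding coloring_sum_linear_add by simp
  finally show ?thesis .
qed

lemma coloring_chi_step:
  assumes t: "t v = 3" and e: "\<And>i. coloring_sum t k (v @ [i]) chi \<le> 4*y" and y: "0 \<le> y" "y \<le> 1/2"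
  shows "coloring_sum t (Suc k) v chi \<le> 4 * (995/1000 * y)"
proof -
  let ?S = "\<lambda>i. coloring_sum t k (v @ [i])"
  define G where "G = ?S 0 (\<lambda>x y z. ?S 1 (\<lambda>x' y' z'. chi ((y+z)/2 * (y'+z')/2) ((x+z)/2 * (x'+z')/2) ((x+y)/2 * (x'+y')/2)))"
  define e2 where "e2 = ?S 2 chi / 4"
  have e2: "0 \<le> e2" "e2 \<le> y"
    using coloring_sum_chi_nonneg e[of 2] by (simp_all add: e2_def)
  \<comment> \<open>The first two children: the first message has crossed one edge, so the pair
    estimate applies. Its \<open>chi\<close> factor is what produces the term
    \<open>y^2\<close>.\<close>
  have G: "G \<le> 205/100 * y + y^2"
  proof -
    define e1 where "e1 = ?S 1 chi / 4"
    have e1: "0 \<le> e1" "e1 \<le> y"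
      using coloring_sum_chi_nonneg e[of 1] by (simp_all add: e1_def)
    have "G \<le> ?S 0 (\<lambda>x y z. (e1 * (21/20) / 3 * x + e1 * (21/20) / 3 * y + e1 * (21/20) / 3 * z) + ((1 + e1) / 4) * chi x y z)"
      unfolding G_def
    proof (rule coloring_sum_mono)
      fix x y z :: real assume xyz: "0 \<le> x" "0 \<le> y" "0 \<le> z"
      let ?a = "(y+z)/2" and ?b = "(x+z)/2" and ?c = "(x+y)/2"
      have abc: "0 \<le> ?a" "0 \<le> ?b" "0 \<le> ?c" "?a \<le> ?b + ?c" "?b \<le> ?a + ?c" "?c \<le> ?a + ?b"
        using xyz by (auto simp: add_divide_distrib)
      have "?S 1 (\<lambda>x' y' z'. chi (?a * (y'+z')/2) (?b * (x'+z')/2) (?c * (x'+y')/2))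
        \<le> chi ?a ?b ?c + ?S 1 chi / 4 * (21/20*(?a+?b+?c)/3 + 1 * chi ?a ?b ?c)"
        by (intro coloring_sum_average_le perm_sum_chi_pair_le abc)
      also have "\<dots> = (e1 * (21/20) / 3 * x + e1 * (21/20) / 3 * y + e1 * (21/20) / 3 * z) + ((1 + e1) / 4) * chi x y z"
        unfolding chi_edge e1_def[symmetric] by (simp add: algebra_simps add_divide_distrib)
      finally show "?S 1 (\<lambda>x' y' z'. chi (?a * (y'+z')/2) (?b * (x'+z')/2) (?c * (x'+y')/2))
        \<le> (e1 * (21/20) / 3 * x + e1 * (21/20) / 3 * y + e1 * (21/20) / 3 * z) + ((1 + e1) / 4) * chi x y z" .
    qed
    also have "\<dots> = (1 + e1) * (?S 0 chi / 4) + 21/20 * e1"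
      unfolding coloring_sum_linear_add by simp
    also have "\<dots> \<le> (1 + y) * y + 21/20 * y"
      using e1 e[of 0] y coloring_sum_chi_nonneg by (intro add_mono mult_mono mult_left_mono) auto
    also have "\<dots> = 205/100 * y + y^2" by (simp add: algebra_simps power2_eq_square)
    finally show ?thesis .
  qed
  \<comment> \<open>The accumulated message is now a product of two, so only the general estimate is
    available.\<close>
  have inner: "?S 2 (\<lambda>x'' y'' z''. chi (a * (y''+z'')/2) (b * (x''+z'')/2) (c * (x''+y'')/2))
      \<le> (1 - 2/5 * e2) * chi a b c + e2 * (19/10) / 3 * (a + b + c)"
    if "0 \<le> a" "0 \<le> b" "0 \<le> c" for a b c
  proof -
    have "?S 2 (\<lambda>x'' y'' z''. chi (a * (y''+z'')/2) (b * (x''+z'')/2) (c * (x''+y'')/2))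
      \<le> chi a b c + ?S 2 chi / 4 * (19/10*(a+b+c)/3 + (-2/5) * chi a b c)"
      using that by (intro coloring_sum_average_le perm_sum_chi_any_le)
    also have "\<dots> = (1 - 2/5 * e2) * chi a b c + e2 * (19/10) / 3 * (a + b + c)"
      unfolding e2_def[symmetric] by (simp add: algebra_simps add_divide_distrib)
    finally show ?thesis .
  qed
  \<comment> \<open>Averaging over the second child restores the mass of the first message, so the
    \<open>19/10\<close> term is not inflated.\<close>
  have mass: "?S 1 (\<lambda>x' y' z'. (y+z)/2 * (y'+z')/2 + (x+z)/2 * (x'+z')/2 + (x+y)/2 * (x'+y')/2) = 1 * x + 1 * y + 1 * z" for x y z
  proof -
    have "(y+z)/2 * (y'+z')/2 + (x+z)/2 * (x'+z')/2 + (x+y)/2 * (x'+y')/2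
      = ((2*x+y+z)/4) * x' + ((x+2*y+z)/4) * y' + ((x+y+2*z)/4) * z'" for x' y' z'
      by (simp add: field_simps)
    then show ?thesis by (simp only: coloring_sum_linear) (simp add: field_simps)
  qed
  have "coloring_sum t (Suc k) v chi \<le> ?S 0 (\<lambda>x y z. ?S 1 (\<lambda>x' y' z'. 
      (1 - 2/5 * e2) * chi ((y+z)/2 * (y'+z')/2) ((x+z)/2 * (x'+z')/2) ((x+y)/2 * (x'+y')/2)
      + e2 * (19/10) / 3 * ((y+z)/2 * (y'+z')/2 + (x+z)/2 * (x'+z')/2 + (x+y)/2 * (x'+y')/2)))"
    unfolding coloring_sum_Suc[of t v k chi, OF t] times_divide_eq_right
    by (intro coloring_sum_mono inner[unfolded times_divide_eq_right]) simp_all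
  also have "\<dots> = (1 - 2/5 * e2) * G + e2 * (19/10) / 3 * ?S 0 (\<lambda>x y z. 1 * x + 1 * y + 1 * z)"
    unfolding G_def by (simp only: coloring_sum_combination mass)
  also have "\<dots> = (1 - 2/5 * e2) * G + 19/10 * e2"
    unfolding coloring_sum_linear by simp
  also have "(1 - 2/5 * e2) * G + 19/10 * e2 \<le> (1 - 2/5 * e2) * (205/100 * y + y^2) + 19/10 * e2"
    using G e2 y by (intro add_right_mono mult_left_mono) auto
  also have "\<dots> = (205/100 * y + y^2) + e2 * (19/10 - 2/5 * (205/100 * y + y^2))" by (simp add: field_simps)
  also have "\<dots> \<le> (205/100 * y + y^2) + y * (19/10 - 2/5 * (205/100 * y + y^2))"
  proof -
    have "y^2 \<le> 1/2 * y" unfolding power2_eq_square using y by (intro mult_right_mono)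
    then show ?thesis using e2 y by (intro add_left_mono mult_right_mono) auto
  qed
  also have "\<dots> \<le> 4 * (995/1000 * y)"
  proof -
    \<comment> \<open>The remaining slack \<open>3/100 - 9/50*y + 2/5*y^2\<close> per unit of
      \<open>y\<close>, with the square completed; it is positive for every
      \<open>y\<close>.\<close>
    have "0 \<le> y * (2/5*(y - 9/40)^2 + 39/4000)" using y by simp
    also have "\<dots> = 4 * (995/1000 * y) - ((205/100 * y + y^2) + y * (19/10 - 2/5 * (205/100 * y + y^2)))"
      by (simp add: field_simps power2_eq_square power3_eq_cube)
    finally show ?thesis by simp
  qed
  finally show ?thesis .
qed

text \<open>The recursion starts at \<open>4 * (1/2)\<close>, exactly the largest value that
  \<open>coloring_chi_step\<close> admits.\<close>

lemma coloring_chi_0: "coloring_sum t 0 v chi = 2"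
proof -
  have "coloring_sum t 0 v chi = (\<Sum>c\<in>colors. chi (if c = 1 then 1 else 0) (if c = 2 then 1 else 0) (if c = 3 then 1 else 0))"
    unfolding coloring_sum_def 
    using sum_PiE_singleton[of "\<lambda>c. chi (if c = 1 then 1 else 0) (if c = 2 then 1 else 0) (if c = 3 then 1 else 0)" v colors] by simp
  then show ?thesis by (simp add: sum_colors chi_def)
qed

lemma coloring_chi_le:
  assumes "\<And>v. t v = 3"
  shows "coloring_sum t k v chi \<le> 4 * (1/2 * (995/1000)^k)"
proof (induction k arbitrary: v)
  case (Suc k)
  have "(995/1000::real)^k \<le> 1" by (intro power_le_one) auto
  then have "coloring_sum t (Suc k) v chi \<le> 4 * (995/1000 * (1/2 * (995/1000)^k))"
    by (intro coloring_chi_step assms Suc) auto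
  then show ?case by simp
qed (simp add: coloring_chi_0)

text \<open>Uses that mass times \<open>chi\<close> equals \<open>(x-y)^2/2 + (x+y-2*z)^2/6\<close>,
  hence controls \<open>(x-y)^2\<close>.\<close>

lemma abs_diff_le_chi:
  assumes nonneg: "x \<ge> 0" "y \<ge> 0" "z \<ge> 0" and e: "e > 0"
  shows "\<bar>x - y\<bar> \<le> e * (x + y + z) + chi x y z / e"
proof (cases "x + y + z = 0")
  case True
  then have "x = 0" "y = 0" "z = 0" using nonneg by auto
  then show ?thesis by (simp add: chi_def)
next
  case False
  define s where "s = x + y + z"
  have s: "s > 0" using False nonneg by (simp add: s_def)
  have "s * chi x y z = (x^2+y^2+z^2) - s^2/3"
    using s unfolding chi_def s_def[symmetric] by (simp add: field_simps power2_eq_square)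
  also have "\<dots> = (x-y)^2/2 + (x + y - 2*z)^2/6"
    unfolding s_def by (simp add: field_simps power2_eq_square)
  finally have chi: "(x-y)^2 \<le> 2 * (s * chi x y z)" by simp
  have "0 \<le> (\<bar>x-y\<bar> - 2*(e * s))^2" by simp
  then have "4*(e * s)*\<bar>x-y\<bar> \<le> (x-y)^2 + 4*(e * s)^2"
    by (simp add: power2_diff power_mult_distrib algebra_simps)
  also have "\<dots> \<le> 2 * (s * chi x y z) + 4*(e * s)^2" using chi by simp
  also have "\<dots> = 4*(e * s) * (e * s + chi x y z / (2*e))"
    using e by (simp add: field_simps power2_eq_square)
  finally have "\<bar>x-y\<bar> \<le> e * s + chi x y z / (2*e)" using e s by simp
  also have "chi x y z / (2*e) \<le> chi x y z / e"
    using e chi_nonneg[OF nonneg] by (intro divide_left_mono) auto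
  finally show ?thesis by (simp add: s_def)
qed

lemma d_TV_coloring_le:
  assumes t: "\<And>v. t v = 3" and ab: "a \<in> colors" "b \<in> colors" and e: "e > 0"
  shows "d_TV (level_law 1 t a n) (level_law 1 t b n) \<le> 3/2 * e + (995/1000)^n / e"
proof -
  let ?L = "\<lambda>c \<tau>. lik 1 t n [] c \<tau>"
  have "\<bar>?L a \<tau> - ?L b \<tau>\<bar> \<le> e * (?L 1 \<tau> + ?L 2 \<tau> + ?L 3 \<tau>) + chi (?L 1 \<tau>) (?L 2 \<tau>) (?L 3 \<tau>) / e" for \<tau>
  proof -
    have L: "0 \<le> ?L c \<tau>" for c by (rule lik_nonneg) auto
    have chi: "chi x z y = chi x y z" "chi y z x = chi x y z" for x y z by (simp_all add: chi_def add_ac)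
    have "0 \<le> e * (?L 1 \<tau> + ?L 2 \<tau> + ?L 3 \<tau>) + chi (?L 1 \<tau>) (?L 2 \<tau>) (?L 3 \<tau>) / e"
      using L e chi_nonneg[OF L L L] by (intro add_nonneg_nonneg) auto
    moreover have "\<bar>?L 1 \<tau> - ?L 2 \<tau>\<bar> \<le> e * (?L 1 \<tau> + ?L 2 \<tau> + ?L 3 \<tau>) + chi (?L 1 \<tau>) (?L 2 \<tau>) (?L 3 \<tau>) / e"
      by (intro abs_diff_le_chi L e)
    moreover have "\<bar>?L 1 \<tau> - ?L 3 \<tau>\<bar> \<le> e * (?L 1 \<tau> + ?L 2 \<tau> + ?L 3 \<tau>) + chi (?L 1 \<tau>) (?L 2 \<tau>) (?L 3 \<tau>) / e"
      using abs_diff_le_chi[OF L[of 1] L[of 3] L[of 2] e]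
      by (simp only: chi(1)[where x = "?L 1 \<tau>" and y = "?L 2 \<tau>" and z = "?L 3 \<tau>"] add_ac)
    moreover have "\<bar>?L 2 \<tau> - ?L 3 \<tau>\<bar> \<le> e * (?L 1 \<tau> + ?L 2 \<tau> + ?L 3 \<tau>) + chi (?L 1 \<tau>) (?L 2 \<tau>) (?L 3 \<tau>) / e"
      using abs_diff_le_chi[OF L[of 2] L[of 3] L[of 1] e]
      by (simp only: chi(2)[where x = "?L 1 \<tau>" and y = "?L 2 \<tau>" and z = "?L 3 \<tau>"] add_ac)
    ultimately show ?thesis using ab by (auto simp: colors_def abs_minus_commute)
  qed
  then have "(\<Sum>\<tau>\<in>configs t n []. \<bar>?L a \<tau> - ?L b \<tau>\<bar>) 
     \<le> coloring_sum t n [] (\<lambda>x y z. (e * x + e * y + e * z) + 1/e * chi x y z)"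
    unfolding coloring_sum_def by (intro sum_mono) (simp add: distrib_left)
  also have "\<dots> = 3 * e + coloring_sum t n [] chi / e"
    unfolding coloring_sum_linear_add by simp
  also have "\<dots> \<le> 3 * e + 4 * (1/2 * (995/1000)^n) / e"
    using e by (intro add_left_mono divide_right_mono coloring_chi_le t) auto
  finally have "(\<Sum>\<tau>\<in>configs t n []. \<bar>?L a \<tau> - ?L b \<tau>\<bar>) / 2 \<le> (3 * e + 4 * (1/2 * (995/1000)^n) / e) / 2"
    by (rule divide_right_mono) simp
  also have "\<dots> = 3/2 * e + (995/1000)^n / e" by (simp add: add_divide_distrib)
  finally show ?thesis unfolding d_TV_level_law[OF zero_le_one order_refl ab] .
qed

lemma non_reconstruction_coloring:
  assumes "pmf d 3 = 1"
  shows "non_reconstruction d 1"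
  unfolding non_reconstruction_def
proof (intro ballI)
  fix a b assume ab: "a \<in> colors" "b \<in> colors"
  interpret prob_space "gw_tree d" by (rule prob_space_gw_tree)
  let ?TV = "\<lambda>n t. d_TV (level_law 1 t a n) (level_law 1 t b n)"
  define r :: real where "r = sqrt (995/1000)"
  have r: "0 < r" "r < 1" "r^2 = 995/1000" by (auto simp: r_def)
  have "set_pmf d = {3}"
  proof -
    have "measure d {3} = 1" using assms by (simp add: pmf.rep_eq)
    then have "set_pmf d \<subseteq> {3}" by (simp add: measure_pmf.prob_eq_1 AE_measure_pmf_iff subset_iff)
    then show ?thesis using set_pmf_not_empty[of d] by blast
  qed
  have bound: "(\<integral>t. ?TV n t \<partial>gw_tree d) \<le> 5/2 * r^n" for n
  proof -
    have "(\<integral>t. ?TV n t \<partial>gw_tree d) \<le> (\<integral>t. 5/2 * r^n \<partial>gw_tree d)"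
    proof (rule integral_mono_AE)
      show "AE t in gw_tree d. ?TV n t \<le> 5/2 * r^n"
        using AE_gw_tree_offspring[of d]
      proof eventually_elim
        case (elim t)
        have "0 < r^n" using r by simp
        then have "?TV n t \<le> 3/2 * r^n + (995/1000)^n / r^n"
          using elim \<open>set_pmf d = {3}\<close> by (intro d_TV_coloring_le ab) auto
        also have "(995/1000)^n / r^n = r^n"
          unfolding r(3)[symmetric] using r(1) by (simp add: power2_eq_square power_mult_distrib)
        finally show ?case by simp
      qed
    qed (intro integrable_d_TV integrable_const)+
    then show ?thesis by (simp add: prob_space)
  qed
  show "(\<lambda>n. \<integral>t. ?TV n t \<partial>gw_tree d) \<longlonglongrightarrow> 0"
  proof (rule tendsto_sandwich[where f = "\<lambda>_. 0" and h = "\<lambda>n. 5/2 * r^n"])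
    show "(\<lambda>n. 5/2 * r^n) \<longlonglongrightarrow> 0"
      using r by (intro tendsto_mult_right_zero LIMSEQ_power_zero) auto
    show "\<forall>\<^sub>F n in sequentially. 0 \<le> (\<integral>t. ?TV n t \<partial>gw_tree d)"
      by (intro always_eventually allI Bochner_Integration.integral_nonneg d_TV_bounds)
  qed (use bound in auto)
qed

theorem theorem7:
  fixes d :: "nat pmf" and p lam :: real
  assumes "0 \<le> p" and "p \<le> 1" and "lam = 1 - 3 * p / 2"
  shows "(pmf d 2 = 1 \<and> 0 < lam \<and> lam \<le> 0.69 \<longrightarrow> non_reconstruction d p) \<and>
    (pmf d 3 = 1 \<and> 0 < lam \<and> lam \<le> 0.555 \<longrightarrow> non_reconstruction d p) \<and>
    (pmf d 2 = 1 / 2 \<and> pmf d 3 = 1 / 2 \<and> 0 < lam \<and> lam \<le> 0.61 \<longrightarrow> non_reconstruction d p) \<and>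
    (pmf d 3 = 1 \<and> lam = - 1 / 2 \<longrightarrow> non_reconstruction d p)"
proof (intro conjI impI; elim conjE)
  have other_zero: "pmf d j = 0" if "pmf d i = 1" "i \<noteq> j" for i j
  proof -
    have "measure d {i, j} = pmf d i + pmf d j" using that by (simp add: measure_measure_pmf_finite)
    then have "pmf d i + pmf d j \<le> 1" using measure_pmf.prob_le_1[of d "{i, j}"] by simp
    then show ?thesis using that pmf_nonneg[of d j] by linarith
  qed
  show "non_reconstruction d p" if "pmf d 2 = 1" "0 < lam" "lam \<le> 0.69"
    using that assms other_zero[of 2 3] by (intro non_reconstruction_binary_ternary[OF _ contracts_binary]) auto
  show "non_reconstruction d p" if "pmf d 3 = 1" "0 < lam" "lam \<le> 0.555"
    using that assms other_zero[of 3 2] by (intro non_reconstruction_binary_ternary[OF _ contracts_ternary]) auto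
  show "non_reconstruction d p" if "pmf d 2 = 1 / 2" "pmf d 3 = 1 / 2" "0 < lam" "lam \<le> 0.61"
    using that assms by (intro non_reconstruction_binary_ternary[OF _ contracts_mixed]) auto
  show "non_reconstruction d p" if "pmf d 3 = 1" "lam = - 1 / 2"
  proof -
    have "p = 1" using that assms by simp
    then show ?thesis using non_reconstruction_coloring[OF that(1)] by simp
  qed
qed

end
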